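(* In the setting described in the context, for any increasing (not necessarily strictly) weight $w:[0,\infty)\to[1,\infty]$, for all $\nu>0$, all times $t$ and all radii $r\ge0$, as well as all random events $\omega$, we have the pointwise inequality $$\frac{d}{dt}\|\Pi_{\ge r}\phi^\nu_t\|_{L^2}^2+2\nu\|\Pi_{\ge r}\nabla\phi^\nu_t\|_{L^2}^2\le 4\pi r\,\|w(|k|)\hat u_t\|_{\ell^1}\; (w^{-1}*m^\nu_t)(r),$$ where, for the realization $m^\nu_{t,\omega}$ of $m^\nu_t$ at $\omega$, $$(w^{-1}*m^\nu_{t,\omega})(r):=\int_0^\infty\frac{1}{w(|r-z|)}\,m^\nu_{t,\omega}(dz).$$
   Context: Setting. $\mathbb{T}^d=\mathbb{R}^d/\mathbb{Z}^d$; Fourier coefficients are $\hat f(k)=\int_{\mathbb{T}^d}f(x)e^{-2\pi i k\cdot x}\,dx$, $k\in\mathbb{Z}^d$; $|k|$ is the Euclidean norm. For $r\ge0$, $\Pi_{\ge r}f=\sum_{|k|\ge r}\hat f(k)e^{2\pi i k\cdot x}$. The norm $\|f\|_{H^{-1}}^2=\sum_{k\ne0}(2\pi|k|)^{-2}|\hat f(k)|^2$ is used for mean-zero $f$. $(u_t)_{t\ge0}$ is a random process of divergence-free vector fields $u_t:\mathbb{T}^d\to\mathbb{R}^d$ with $u\in L^1_{\mathrm{loc}}([0,\infty);W^{1,\infty}(\mathbb{T}^d))$ almost surely, stationary in time: $t\mapsto u_{t+s}$ has the same law as $t\mapsto u_t$ for all $s\ge0$. The function $g\in L^2(\mathbb{T}^d)$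 is deterministic with $\int g\,dx=0$ and $\|g\|_{L^2}=1$. For $\nu>0$, $\phi^\nu_t$ is the (random) solution of $\partial_t\phi^\nu_t+u_t\cdot\nabla\phi^\nu_t-\nu\Delta\phi^\nu_t=0$ for $t\ge0$, $\phi^\nu_0=g$. Standing mixing assumption: there are $K\ge1$, $\gamma>0$ such that $\mathbb{E}\|\phi^\nu_t\|_{H^{-1}}^2\le Ke^{-\gamma t}$ for all $\nu,t>0$. Random instantaneous mass measure: for $E\subseteq[0,\infty)$, $m^\nu_t(E):=\sum_{|k|\in E}|\hat\phi^\nu_t(k)|^2$; thus $(w^{-1}*m^\nu_t)(r)=\sum_k w(||k|-r|)^{-1}|\hat\phi^\nu_t(k)|^2$. Notation: $w^{-1}=1/w$ with $1/\infty=0$, and $\|w(|k|)\hat u_t\|_{\ell^1}:=\sum_{k\in\mathbb{Z}^d}w(|k|)\,|\hat u_t(k)|$, where a term with $\hat u_t(k)=0$ counts as $0$ even if $w(|k|)=\infty$.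
   Formalization: Proved for almost every time t (as u is only L^1_loc in time, the derivative can fail to exist at some t), with local absolute continuity in t; for events where the velocity is in the assumed class; infinity times 0 in the product of the weighted norm and the convolution is read as infinity. *)

theory Defs
  imports "HOL-Probability.Probability"
begin

text \<open>
  A function on the torus \<open>\<real>\<^sup>d/\<int>\<^sup>d\<close> is a \<open>\<int>\<^sup>d\<close>-periodic function on \<open>real^'d\<close>; Lebesgue measure of the
  torus is Lebesgue measure on the fundamental cell \<open>[0,1)\<^sup>d\<close>. Scalars are complex, so real-valued
  scalar fields are included. Frequencies \<open>k \<in> \<int>\<^sup>d\<close> have type \<open>int^'d\<close>.
\<close>

definition freq :: "int^'d::finite \<Rightarrow> real^'d" where
  "freq k = (\<chi> i. real_of_int (k $ i))"

definition torus :: "(real^'d::finite) measure" where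
  "torus = restrict_space lborel {x. \<forall>i. 0 \<le> x $ i \<and> x $ i < 1}"

definition periodic :: "(real^'d::finite \<Rightarrow> 'b) \<Rightarrow> bool" where
  "periodic f \<longleftrightarrow> (\<forall>x k. f (x + freq k) = f x)"

definition character :: "int^'d::finite \<Rightarrow> real^'d \<Rightarrow> complex" where
  "character k x = cis (2 * pi * (freq k \<bullet> x))"

definition fourier :: "(real^'d::finite \<Rightarrow> complex) \<Rightarrow> int^'d \<Rightarrow> complex" where
  "fourier f k = (\<integral>x. f x * character (- k) x \<partial>torus)"

definition comp_fun :: "(real^'d::finite \<Rightarrow> real^'d) \<Rightarrow> 'd \<Rightarrow> real^'d \<Rightarrow> complex" where
  "comp_fun v i x = complex_of_real (v x $ i)"

definition fourier_vec :: "(real^'d::finite \<Rightarrow> real^'d) \<Rightarrow> int^'d \<Rightarrow> complex^'d" where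
  "fourier_vec v k = (\<chi> i. fourier (comp_fun v i) k)"


subsection \<open>Function spaces on the torus\<close>

definition L2_norm :: "(real^'d::finite \<Rightarrow> complex) \<Rightarrow> real" where
  "L2_norm f = sqrt (\<integral>x. (cmod (f x))\<^sup>2 \<partial>torus)"

definition L2_torus :: "(real^'d::finite \<Rightarrow> complex) set" where
  "L2_torus = {f. periodic f \<and> f \<in> borel_measurable borel \<and>
     integrable torus (\<lambda>x. (cmod (f x))\<^sup>2)}"

definition Linf_norm :: "(real^'d::finite \<Rightarrow> 'b::real_normed_vector) \<Rightarrow> ennreal" where
  "Linf_norm f = esssup torus (\<lambda>x. ennreal (norm (f x)))"

text \<open>
  Distributional derivative \<open>\<partial>\<^sub>j f = h\<close> on the torus, for integrable \<open>f\<close> and \<open>h\<close>. The identity is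
  the integration by parts formula tested against the exponentials \<open>character (- k)\<close>; their linear
  combinations are dense in the smooth functions on the torus.
\<close>

definition has_weak_deriv ::
    "'d::finite \<Rightarrow> (real^'d \<Rightarrow> complex) \<Rightarrow> (real^'d \<Rightarrow> complex) \<Rightarrow> bool" where
  "has_weak_deriv j f h \<longleftrightarrow> periodic h \<and> integrable torus f \<and> integrable torus h \<and>
     (\<forall>k. fourier h k = 2 * pi * \<i> * of_int (k $ j) * fourier f k)"

text \<open>A representative of the weak derivative, which is unique up to null sets when it exists.\<close>

definition weak_deriv :: "'d::finite \<Rightarrow> (real^'d \<Rightarrow> complex) \<Rightarrow> real^'d \<Rightarrow> complex" where
  "weak_deriv j f = (SOME h. has_weak_deriv j f h)"

definition H1_torus :: "(real^'d::finite \<Rightarrow> complex) set" where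
  "H1_torus = {f \<in> L2_torus. \<forall>j. \<exists>h\<in>L2_torus. has_weak_deriv j f h}"

definition W1inf_norm :: "(real^'d::finite \<Rightarrow> real^'d) \<Rightarrow> ennreal" where
  "W1inf_norm v = Linf_norm v + (\<Sum>i\<in>UNIV. \<Sum>j\<in>UNIV. Linf_norm (weak_deriv j (comp_fun v i)))"

definition W1inf_torus :: "(real^'d::finite \<Rightarrow> real^'d) set" where
  "W1inf_torus = {v. periodic v \<and> v \<in> borel_measurable borel \<and>
     (\<forall>i j. \<exists>h. has_weak_deriv j (comp_fun v i) h) \<and> W1inf_norm v < \<infinity>}"

definition divergence_free :: "(real^'d::finite \<Rightarrow> real^'d) \<Rightarrow> bool" where
  "divergence_free v \<longleftrightarrow> (AE x in torus. (\<Sum>j\<in>UNIV. weak_deriv j (comp_fun v j) x) = 0)"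

definition Hm1_norm_sq :: "(real^'d::finite \<Rightarrow> complex) \<Rightarrow> ennreal" where
  "Hm1_norm_sq f =
     (\<integral>\<^sup>+k. ennreal ((cmod (fourier f k))\<^sup>2 / (2 * pi * norm (freq k))\<^sup>2) \<partial>count_space (UNIV - {0}))"

text \<open>
  \<open>\<Pi>\<^bsub>\<ge>r\<^esub> f\<close>: the sum, in \<open>L\<^sup>2\<close>, of the Fourier series of \<open>f\<close> restricted to \<open>|k| \<ge> r\<close>. Like every element
  of \<open>L\<^sup>2\<close> it is determined only up to null sets, and a representative is chosen.
\<close>

definition Pi_ge :: "real \<Rightarrow> (real^'d::finite \<Rightarrow> complex) \<Rightarrow> real^'d \<Rightarrow> complex" where
  "Pi_ge r f = (SOME h. h \<in> L2_torus \<and>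
     ((\<lambda>K. L2_norm (\<lambda>x. h x - (\<Sum>k\<in>K. fourier f k * character k x))) \<longlongrightarrow> 0)
       (finite_subsets_at_top {k. r \<le> norm (freq k)}))"


subsection \<open>Velocity fields and the advection-diffusion equation\<close>

text \<open>
  One realisation of the velocity: divergence free and in \<open>L\<^sup>1\<^sub>l\<^sub>o\<^sub>c([0,\<infinity>); W\<^sup>1\<^sup>,\<^sup>\<infinity>)\<close>. Membership in
  this space, hence the constraint, concerns almost every time only.
\<close>

definition admissible_velocity :: "(real \<Rightarrow> real^'d::finite \<Rightarrow> real^'d) \<Rightarrow> bool" where
  "admissible_velocity v \<longleftrightarrow>
     (\<lambda>(t, x). v t x) \<in> borel_measurable (restrict_space borel {0..} \<Otimes>\<^sub>M borel) \<and>
     (AE t in lebesgue. 0 \<le> t \<longrightarrow> v t \<in> W1inf_torus \<and> divergence_free (v t)) \<and>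
     (\<forall>T\<ge>0. (\<integral>\<^sup>+t\<in>{0..T}. W1inf_norm (v t) \<partial>lebesgue) < \<infinity>)"

definition advection ::
    "(real^'d::finite \<Rightarrow> real^'d) \<Rightarrow> (real^'d \<Rightarrow> complex) \<Rightarrow> real^'d \<Rightarrow> complex" where
  "advection v f x = (\<Sum>j\<in>UNIV. complex_of_real (v x $ j) * weak_deriv j f x)"

text \<open>
  \<open>\<partial>\<^sub>t f + v \<cdot> \<nabla>f - \<nu> \<Delta>f = 0\<close>, \<open>f\<^sub>0 = g\<close>, in the weak sense and in the energy class
  \<open>C([0,\<infinity>); L\<^sup>2) \<inter> L\<^sup>2\<^sub>l\<^sub>o\<^sub>c([0,\<infinity>); H\<^sup>1)\<close>: the equation is integrated in time and tested in space
  against the exponentials; \<open>- \<Delta>\<close> acts on frequency \<open>k\<close> as multiplication by \<open>(2\<pi>|k|)\<^sup>2\<close>.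
\<close>

definition advection_diffusion_solution ::
    "real \<Rightarrow> (real \<Rightarrow> real^'d::finite \<Rightarrow> real^'d) \<Rightarrow> (real^'d \<Rightarrow> complex) \<Rightarrow>
     (real \<Rightarrow> real^'d \<Rightarrow> complex) \<Rightarrow> bool" where
  "advection_diffusion_solution \<nu> v g f \<longleftrightarrow>
     (\<forall>t\<ge>0. f t \<in> L2_torus) \<and>
     (\<forall>t\<ge>0. ((\<lambda>s. L2_norm (\<lambda>x. f s x - f t x)) \<longlongrightarrow> 0) (at t within {0..})) \<and>
     (AE t in lebesgue. 0 \<le> t \<longrightarrow> f t \<in> H1_torus) \<and>
     (\<forall>T\<ge>0. (\<integral>\<^sup>+t\<in>{0..T}. (\<Sum>j\<in>UNIV. ennreal ((L2_norm (weak_deriv j (f t)))\<^sup>2)) \<partial>lebesgue) < \<infinity>) \<and>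
     (AE x in torus. f 0 x = g x) \<and>
     (\<forall>k. \<forall>t\<ge>0.
        let F = (\<lambda>s. fourier (advection (v s) (f s)) k
                  + of_real (\<nu> * (2 * pi * norm (freq k))\<^sup>2) * fourier (f s) k)
        in F absolutely_integrable_on {0..t} \<and>
           fourier (f t) k = fourier g k - integral {0..t} F)"


subsection \<open>Random velocity\<close>

text \<open>
  Equality in law of the processes \<open>t \<mapsto> u\<^bsub>t+s\<^esub>\<close> and \<open>t \<mapsto> u\<^sub>t\<close>: the process is viewed as the random
  family of its values at all \<open>(t, x)\<close>, with the product \<open>\<sigma>\<close>-algebra, that is, the
  finite-dimensional distributions agree.
\<close>

definition stationary_process ::
    "'w measure \<Rightarrow> ('w \<Rightarrow> real \<Rightarrow> real^'d::finite \<Rightarrow> real^'d) \<Rightarrow> bool" where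
  "stationary_process M u \<longleftrightarrow>
     (\<forall>s\<ge>0. distr M (\<Pi>\<^sub>M p\<in>{0..} \<times> UNIV. borel)
               (\<lambda>\<omega>. \<lambda>p\<in>{0..} \<times> UNIV. u \<omega> (fst p + s) (snd p)) =
            distr M (\<Pi>\<^sub>M p\<in>{0..} \<times> UNIV. borel)
               (\<lambda>\<omega>. \<lambda>p\<in>{0..} \<times> UNIV. u \<omega> (fst p) (snd p)))"


subsection \<open>The mass measure and the weighted quantities\<close>

definition mass_measure :: "(real^'d::finite \<Rightarrow> complex) \<Rightarrow> real measure" where
  "mass_measure f = distr (density (count_space UNIV) (\<lambda>k. ennreal ((cmod (fourier f k))\<^sup>2)))
     (count_space {0..}) (\<lambda>k. norm (freq k))"

lemma emeasure_mass_measure: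
  fixes f :: "real^'d::finite \<Rightarrow> complex"
  assumes "E \<subseteq> {0..}"
  shows "emeasure (mass_measure f) E =
    (\<integral>\<^sup>+k. ennreal ((cmod (fourier f k))\<^sup>2) \<partial>count_space {k. norm (freq k) \<in> E})"
proof -
  have "(\<lambda>k. norm (freq k :: real^'d)) -` E = {k. norm (freq k) \<in> E}"
    by auto
  then show ?thesis
    unfolding mass_measure_def using assms
    by (subst emeasure_distr)
      (auto simp: emeasure_density nn_integral_count_space_indicator)
qed

definition weight_conv :: "(real \<Rightarrow> ennreal) \<Rightarrow> (real^'d::finite \<Rightarrow> complex) \<Rightarrow> real \<Rightarrow> ennreal" where
  "weight_conv w f r = (\<integral>\<^sup>+z. inverse (w \<bar>r - z\<bar>) \<partial>mass_measure f)"

text \<open>In \<^typ>\<open>ennreal\<close>, \<open>\<infinity> * 0 = 0\<close>, so terms with vanishing coefficient do not contribute.\<close>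

definition weighted_l1_norm :: "(real \<Rightarrow> ennreal) \<Rightarrow> (real^'d::finite \<Rightarrow> real^'d) \<Rightarrow> ennreal" where
  "weighted_l1_norm w v =
    (\<integral>\<^sup>+k. w (norm (freq k)) * ennreal (norm (fourier_vec v k)) \<partial>count_space UNIV)"

text \<open>
  The bound asserts nothing for \<open>r > 0\<close> if the weighted norm of the velocity is infinite, also when
  the weights vanish on all of the mass (for instance \<open>w = \<infinity>\<close>); hence \<open>\<infinity>\<close> times \<open>0\<close> is read
  as \<open>\<infinity>\<close> in this product, against the \<^typ>\<open>ennreal\<close> convention.
\<close>

definition flux_product :: "ennreal \<Rightarrow> ennreal \<Rightarrow> ennreal" where
  "flux_product a b = (if a = \<infinity> then \<infinity> else a * b)"

text \<open>Absolutely continuous on every \<open>[0,T]\<close>, i.e. an indefinite Lebesgue integral.\<close>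

definition locally_absolutely_continuous :: "(real \<Rightarrow> real) \<Rightarrow> bool" where
  "locally_absolutely_continuous F \<longleftrightarrow>
     (\<exists>f. \<forall>t\<ge>0. f absolutely_integrable_on {0..t} \<and> F t = F 0 + integral {0..t} f)"

end

theory Submission
  imports Defs
begin

text \<open>
  Since \<open>\<parallel>\<Pi>\<^bsub>\<ge>r\<^esub> \<phi>\<parallel>\<^sup>2 = \<parallel>\<phi>\<parallel>\<^sup>2 - \<Sum>\<^bsub>|k|<r\<^esub> |c\<^sub>k|\<^sup>2\<close> with \<open>c\<^sub>k\<close> the Fourier coefficients of \<open>\<phi>\<close>, it
  suffices to differentiate the finitely many \<open>|c\<^sub>k|\<^sup>2\<close>, for which the equation is given, and the full
  energy. What remains of the derivative is the flux through the shell \<open>|k| = r\<close>,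
  \<open>2 Re \<Sum>\<^bsub>|k|<r\<^esub> \<Sum>\<^sub>l 2\<pi>\<i> (k \<cdot> u\<^bsub>k-l\<^esub>) c\<^sub>l cnj c\<^sub>k\<close>. By incompressibility the triads with \<open>|l| < r\<close> cancel in
  pairs. In the others \<open>|k-l|\<close> is at least the distance of \<open>|k|\<close> and of \<open>|l|\<close> to \<open>r\<close>, so the weight
  \<open>w(|k-l|)\<close> pays for both factors \<open>1/w\<close> in Young's inequality.

  The energy identity \<open>d/dt \<parallel>\<phi>\<parallel>\<^sup>2 = - 2\<nu> \<parallel>\<nabla>\<phi>\<parallel>\<^sup>2\<close> is not immediate, because \<open>\<parallel>u\<parallel>\<^bsub>L^\<infinity>\<^esub> \<parallel>\<nabla>\<phi>\<parallel>\<close> need not be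
  integrable in time. It is obtained as in DiPerna--Lions: with the Gaussian multiplier \<open>m\<^sub>\<sigma>\<close> the
  commutator of the mollifier and \<open>u \<cdot> \<nabla>\<close> is bounded by \<open>\<parallel>\<nabla>u\<parallel>\<^bsub>L^\<infinity>\<^esub> \<parallel>\<phi>\<parallel>\<^sup>2\<close> uniformly in \<open>\<sigma>\<close>, which
  dominates the limit \<open>\<sigma> \<rightarrow> 0\<close>.
\<close>

subsection \<open>The torus\<close>

text \<open>The equation is tested against exponentials only, so every statement in time starts from
  a single mode, and the difficulty is to exchange the time integral with the sum over modes. Two
  successive limits do this. The Fourier truncation is removed first, at fixed \<sigma>, with a
  dominating constant that may grow like 1/\<sigma>; only then does \<sigma> tend to 0, under a
  bound free of \<sigma>. Writing 2 pi i k_j times the Gaussian multiplier as an average of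
  differences of translations lets v enter through its increments only, and nothing but v is
  differentiated in the estimate.

  The constant 4 pi r: a factor 2 comes from differentiating a square, and 2 pi r from the
  derivative, which incompressibility allows to be placed on the low frequency k with |k| < r. The
  two halves of Young's inequality, summed over all pairs of frequencies, each give half of the
  product of the two weighted sums.

  The exceptional null set of times has to serve every r at once. It can, because it is made from
  countably many modes, the total dissipation and the regularity of v and \<phi>.\<close>

definition cell :: "(real^'d::finite) set" where
  "cell = {x. \<forall>i. 0 \<le> x $ i \<and> x $ i < 1}"

definition wrap :: "real^'d::finite \<Rightarrow> real^'d" where
  "wrap x = (\<chi> i. frac (x $ i))"

lemma freq_nth [simp]: "freq k $ i = real_of_int (k $ i)"
  by (simp add: freq_def)

lemma freq_0 [simp]: "freq 0 = 0"
  by (simp add: vec_eq_iff)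

lemma freq_add: "freq (k + l) = freq k + freq l"
  by (simp add: vec_eq_iff)

lemma freq_minus [simp]: "freq (- k) = - freq k"
  by (simp add: vec_eq_iff)

lemma freq_diff: "freq (k - l) = freq k - freq l"
  by (simp add: vec_eq_iff)

lemma finite_freq_ball: "finite {k :: int^'d::finite. norm (freq k) < r}"
proof -
  let ?A = "{- \<lceil>r\<rceil>..\<lceil>r\<rceil>}"
  have "{k :: int^'d. norm (freq k) < r} \<subseteq> vec_lambda ` (UNIV \<rightarrow> ?A)"
  proof
    fix k :: "int^'d" assume "k \<in> {k. norm (freq k) < r}"
    then have "\<bar>real_of_int (k $ i)\<bar> < r" for i
      using component_le_norm_cart[of "freq k" i] by simp
    then have "k $ i \<in> ?A" for i
    proof -
      have "\<bar>real_of_int (k $ i)\<bar> < real_of_int \<lceil>r\<rceil>"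
        using \<open>\<And>i. \<bar>real_of_int (k $ i)\<bar> < r\<close>[of i] le_of_int_ceiling[of r] by linarith
      then show ?thesis by simp linarith
    qed
    then show "k \<in> vec_lambda ` (UNIV \<rightarrow> ?A)"
      by (intro image_eqI[of _ _ "vec_nth k"]) auto
  qed
  moreover have "finite (UNIV \<rightarrow> ?A :: ('d \<Rightarrow> int) set)"
    using finite_PiE[of "UNIV :: 'd set" "\<lambda>_. ?A"] by (simp add: PiE_UNIV_domain)
  ultimately show ?thesis
    by (meson finite_imageI finite_subset)
qed

lemma cell_borel [measurable]: "cell \<in> sets borel"
proof -
  have "cell = (\<Inter>i. {x :: real^'d::finite. 0 \<le> x $ i} \<inter> {x. x $ i < 1})"
    by (auto simp: cell_def)
  also have "\<dots> \<in> sets borel"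
    by (intro sets.finite_INT) auto
  finally show ?thesis .
qed

lemma torus_eq: "torus = restrict_space lborel cell"
  by (simp add: torus_def cell_def)

lemma space_torus [simp]: "space torus = cell"
  by (simp add: torus_eq space_restrict_space)

lemma sets_torus: "sets torus = sets (restrict_space borel cell)"
  by (simp add: torus_eq sets_restrict_space)

lemma measurable_torus_borel [measurable (raw)]:
  "f \<in> measurable borel N \<Longrightarrow> f \<in> measurable torus N"
  unfolding torus_eq by (intro measurable_restrict_space1) simp

lemma emeasure_torus_space: "emeasure (torus :: (real^'d::finite) measure) (space torus) = 1"
proof -
  have "box 0 1 \<subseteq> (cell :: (real^'d::finite) set)" "(cell :: (real^'d) set) \<subseteq> cbox 0 1"
    by (auto simp: cell_def mem_box_cart less_eq_real_def)
  then have "emeasure lborel (box 0 (1::real^'d)) \<le> emeasure lborel (cell :: (real^'d) set)"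
    "emeasure lborel (cell :: (real^'d) set) \<le> emeasure lborel (cbox 0 (1::real^'d))"
    by (auto intro!: emeasure_mono)
  moreover have "emeasure lborel (box 0 (1::real^'d)) = 1"
    "emeasure lborel (cbox 0 (1::real^'d)) = 1"
    by (simp_all add: emeasure_lborel_box_eq emeasure_lborel_cbox_eq Basis_vec_def inner_axis
        prod.neutral axis_eq_axis)
  ultimately show ?thesis
    by (simp add: torus_eq emeasure_restrict_space space_restrict_space order_antisym_conv)
qed

interpretation torus: prob_space "torus :: (real^'d::finite) measure"
  by (rule prob_spaceI) (rule emeasure_torus_space)

lemma measure_torus_cell [simp]: "measure torus cell = 1"
  using torus.prob_space by simp

lemma wrap_nth [simp]: "wrap x $ i = frac (x $ i)"
  by (simp add: wrap_def)

lemma wrap_in_cell [simp]: "wrap x \<in> cell"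
  by (simp add: cell_def frac_lt_1)

lemma wrap_cell: "x \<in> cell \<Longrightarrow> wrap x = x"
  by (simp add: cell_def vec_eq_iff frac_eq)

lemma wrap_eq: "\<exists>k. wrap x = x + freq k"
  by (rule exI[of _ "\<chi> i. - \<lfloor>x $ i\<rfloor>"]) (simp add: vec_eq_iff frac_def)

lemma periodic_wrap: "periodic f \<Longrightarrow> f (wrap x) = f x"
  using wrap_eq[of x] by (auto simp: periodic_def)

lemma borel_measurable_vecI:
  fixes f :: "'a \<Rightarrow> real^'d::finite"
  assumes "\<And>i. (\<lambda>x. f x $ i) \<in> borel_measurable M"
  shows "f \<in> borel_measurable M"
  by (subst borel_measurable_euclidean_space)
    (auto simp: Basis_vec_def inner_axis assms)

lemma wrap_borel [measurable]: "wrap \<in> borel_measurable borel"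
  by (rule borel_measurable_vecI) (simp add: frac_def)

lemma wrap_measurable_torus [measurable]: "wrap \<in> measurable borel torus"
  unfolding torus_eq by (intro measurable_restrict_space2) (auto simp: measurable_lborel1)

text \<open>\<open>f\<close> equals its composition with \<open>wrap\<close>, which maps into the
  cell, so what is known on the cell extends to the whole space. Weak derivatives need this:
  \<open>has_weak_deriv\<close> only makes them integrable on \<open>torus\<close>.\<close>

lemma periodic_borel_measurable:
  assumes "periodic f" "f \<in> measurable torus N"
  shows "f \<in> measurable borel N"
proof -
  have "(\<lambda>x. f (wrap x)) \<in> measurable borel N"
    using assms(2) by measurable
  then show ?thesis by (simp add: periodic_wrap[OF assms(1)])
qed

section \<open>Translation invariance\<close>

lemma cell_shift_unique:
  "x + freq k \<in> cell \<longleftrightarrow> k = (\<chi> i. - \<lfloor>x $ i\<rfloor>)"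
proof
  assume "x + freq k \<in> cell"
  then have "0 \<le> x $ i + real_of_int (k $ i)" "x $ i + real_of_int (k $ i) < 1" for i
    by (auto simp: cell_def)
  then have "- real_of_int (k $ i) \<le> x $ i" "x $ i < - real_of_int (k $ i) + 1" for i
    by (smt (verit, best))+
  then have "\<lfloor>x $ i\<rfloor> = - (k $ i)" for i
    by (intro floor_unique) auto
  then show "k = (\<chi> i. - \<lfloor>x $ i\<rfloor>)"
    by (simp add: vec_eq_iff)
next
  assume "k = (\<chi> i. - \<lfloor>x $ i\<rfloor>)"
  then have "x + freq k = wrap x" by (simp add: vec_eq_iff frac_def)
  then show "x + freq k \<in> cell" by simp
qed

text \<open>The integer translates of the cell tile the space, so these indicators form a partition
  of unity; inserting it cuts a displaced cell along the lattice.\<close>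

lemma nn_integral_indicator_cell_shift:
  "(\<integral>\<^sup>+k. indicator cell (x + freq k) \<partial>count_space UNIV) = (1 :: ennreal)"
proof -
  have "(\<integral>\<^sup>+k. indicator cell (x + freq k) \<partial>count_space UNIV)
    = (\<integral>\<^sup>+k. indicator {\<chi> i. - \<lfloor>x $ i\<rfloor>} k \<partial>count_space UNIV)"
    by (intro nn_integral_cong) (simp add: indicator_def cell_shift_unique)
  also have "\<dots> = 1" by (simp add: nn_integral_count_space_indicator[symmetric])
  finally show ?thesis .
qed

lemma nn_integral_lborel_shift:
  fixes f :: "real^'d::finite \<Rightarrow> ennreal"
  assumes [measurable]: "f \<in> borel_measurable borel"
  shows "(\<integral>\<^sup>+x. f (x + h) \<partial>lborel) = (\<integral>\<^sup>+x. f x \<partial>lborel)"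
proof -
  have "(\<integral>\<^sup>+x. f x \<partial>lborel) = (\<integral>\<^sup>+x. f x \<partial>distr lborel borel ((+) h))"
    by (simp add: lborel_distr_plus)
  also have "\<dots> = (\<integral>\<^sup>+x. f (x + h) \<partial>lborel)"
    by (subst nn_integral_distr) (auto simp: add.commute)
  finally show ?thesis ..
qed

text \<open>The displaced cell is cut by the lattice translates of the cell. Each piece is moved
  back by its lattice vector, which a periodic \<open>f\<close> does not notice, and the moved
  pieces fill the cell. For nonnegative functions the sum over translates passes through the
  integral freely.\<close>

lemma nn_integral_torus_shift:
  fixes f :: "real^'d::finite \<Rightarrow> ennreal"
  assumes [measurable]: "f \<in> borel_measurable borel" and "periodic f"
  shows "(\<integral>\<^sup>+x. f (x + h) \<partial>torus) = (\<integral>\<^sup>+x. f x \<partial>torus)"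
proof -
  have per: "f (x + freq k) = f x" for x k
    using \<open>periodic f\<close> by (simp add: periodic_def)
  have "(\<integral>\<^sup>+x. f (x + h) \<partial>torus) = (\<integral>\<^sup>+x. f (x + h) * indicator cell x \<partial>lborel)"
    unfolding torus_eq by (subst nn_integral_restrict_space) auto
  also have "\<dots> = (\<integral>\<^sup>+x. f x * indicator cell (x - h) \<partial>lborel)"
    using nn_integral_lborel_shift[of "\<lambda>x. f x * indicator cell (x - h)" h] by simp
  also have "\<dots> = (\<integral>\<^sup>+x. (\<integral>\<^sup>+k. f x * indicator cell (x - h) * indicator cell (x + freq k)
      \<partial>count_space UNIV) \<partial>lborel)"
    by (intro nn_integral_cong) (simp add: nn_integral_cmult nn_integral_indicator_cell_shift)
  also have "\<dots> = (\<integral>\<^sup>+k. (\<integral>\<^sup>+x. f x * indicator cell (x - h) * indicator cell (x + freq k)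
      \<partial>lborel) \<partial>count_space UNIV)"
    by (rule nn_integral_count_space_nn_integral) auto
  also have "\<dots> = (\<integral>\<^sup>+k. (\<integral>\<^sup>+x. f x * indicator cell x * indicator cell ((x - h) + freq (-k))
      \<partial>lborel) \<partial>count_space UNIV)"
  proof (rule nn_integral_cong)
    fix k :: "int^'d"
    have "(\<integral>\<^sup>+x. f x * indicator cell (x - h) * indicator cell (x + freq k) \<partial>lborel)
      = (\<integral>\<^sup>+x. f (x + freq (-k)) * indicator cell (x + freq (-k) - h)
            * indicator cell (x + freq (-k) + freq k) \<partial>lborel)"
      by (rule nn_integral_lborel_shift[symmetric, where f="\<lambda>x. f x * indicator cell (x - h) * indicator cell (x + freq k)"]) simp
    also have "\<dots> = (\<integral>\<^sup>+x. f x * indicator cell x * indicator cell ((x - h) + freq (-k)) \<partial>lborel)"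
      by (intro nn_integral_cong, subst per) (simp add: algebra_simps)
    finally show "(\<integral>\<^sup>+x. f x * indicator cell (x - h) * indicator cell (x + freq k) \<partial>lborel)
      = (\<integral>\<^sup>+x. f x * indicator cell x * indicator cell ((x - h) + freq (-k)) \<partial>lborel)" .
  qed
  also have "\<dots> = (\<integral>\<^sup>+x. (\<integral>\<^sup>+k. f x * indicator cell x * indicator cell ((x - h) + freq (-k))
      \<partial>count_space UNIV) \<partial>lborel)"
    by (rule nn_integral_count_space_nn_integral[symmetric]) auto
  also have "\<dots> = (\<integral>\<^sup>+x. f x * indicator cell x \<partial>lborel)"
  proof (rule nn_integral_cong)
    fix x :: "real^'d"
    have "(\<integral>\<^sup>+k. indicator cell ((x - h) + freq (-k)) \<partial>count_space UNIV)
      = (\<integral>\<^sup>+k. indicator cell ((x - h) + freq k) \<partial>count_space UNIV)"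
      by (rule nn_integral_bij_count_space[where g=uminus]) (auto simp: bij_uminus)
    then show "(\<integral>\<^sup>+k. f x * indicator cell x * indicator cell ((x - h) + freq (-k))
      \<partial>count_space UNIV) = f x * indicator cell x"
      by (simp add: nn_integral_cmult nn_integral_indicator_cell_shift)
  qed
  also have "\<dots> = (\<integral>\<^sup>+x. f x \<partial>torus)"
    unfolding torus_eq by (subst nn_integral_restrict_space) auto
  finally show ?thesis .
qed

text \<open>In the form of an invariant measure, the previous lemma transfers integrability, Bochner
  integrals and almost-everywhere statements by change of variables. \<open>wrap\<close> keeps the
  translation inside the cell.\<close>

lemma distr_torus_shift:
  fixes h :: "real^'d::finite"
  shows "distr torus torus (\<lambda>x. wrap (x + h)) = torus"
proof (rule measure_eqI)
  fix A assume A: "A \<in> sets (distr torus torus (\<lambda>x. wrap (x + h)))"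
  then have A': "A \<in> sets torus" by simp
  have per: "periodic (\<lambda>x. indicator A (wrap x) :: ennreal)"
    unfolding periodic_def
  proof (intro allI)
    fix x :: "real^'d" and k
    have "wrap (x + freq k) = wrap x" by (simp add: vec_eq_iff frac_def)
    then show "indicator A (wrap (x + freq k)) = (indicator A (wrap x) :: ennreal)" by simp
  qed
  have m: "(\<lambda>x. indicator A (wrap x) :: ennreal) \<in> borel_measurable borel"
    using A' by measurable
  have "emeasure (distr torus torus (\<lambda>x. wrap (x + h))) A
    = (\<integral>\<^sup>+x. indicator A x \<partial>distr torus torus (\<lambda>x. wrap (x + h)))"
    using A by simp
  also have "\<dots> = (\<integral>\<^sup>+x. indicator A (wrap (x + h)) \<partial>torus)"
    using A' by (subst nn_integral_distr) auto
  also have "\<dots> = (\<integral>\<^sup>+x. indicator A (wrap x) \<partial>torus)"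
    by (rule nn_integral_torus_shift[OF m per])
  also have "\<dots> = (\<integral>\<^sup>+x. indicator A x \<partial>torus)"
    by (intro nn_integral_cong) (simp add: wrap_cell)
  also have "\<dots> = emeasure torus A" using A' by simp
  finally show "emeasure (distr torus torus (\<lambda>x. wrap (x + h))) A = emeasure torus A" .
qed simp

lemma
  fixes f :: "real^'d::finite \<Rightarrow> 'b::{banach, second_countable_topology}"
  assumes "periodic f" and [measurable]: "f \<in> borel_measurable torus"
  shows integrable_torus_shift: "integrable torus (\<lambda>x. f (x + h)) \<longleftrightarrow> integrable torus f"
    and integral_torus_shift: "(\<integral>x. f (x + h) \<partial>torus) = (\<integral>x. f x \<partial>torus)"
proof -
  have "integrable torus (\<lambda>x. f (x + h)) \<longleftrightarrow> integrable torus (\<lambda>x. f (wrap (x + h)))"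
    by (simp add: periodic_wrap[OF assms(1)])
  also have "\<dots> \<longleftrightarrow> integrable (distr torus torus (\<lambda>x. wrap (x + h))) f"
    by (rule integrable_distr_eq[symmetric]) auto
  finally show "integrable torus (\<lambda>x. f (x + h)) \<longleftrightarrow> integrable torus f"
    by (simp add: distr_torus_shift)
  have "(\<integral>x. f (x + h) \<partial>torus) = (\<integral>x. f (wrap (x + h)) \<partial>torus)"
    by (simp add: periodic_wrap[OF assms(1)])
  also have "\<dots> = (\<integral>x. f x \<partial>distr torus torus (\<lambda>x. wrap (x + h)))"
    by (rule integral_distr[symmetric]) auto
  finally show "(\<integral>x. f (x + h) \<partial>torus) = (\<integral>x. f x \<partial>torus)"
    by (simp add: distr_torus_shift)
qed

lemma AE_torus_shift:
  assumes "periodic P" "AE x in torus. P x"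
  shows "AE x in torus. P (x + h)"
proof -
  have "AE x in distr torus torus (\<lambda>x. wrap (x + h)). P x"
    using assms(2) by (subst distr_torus_shift)
  then have "AE x in torus. P (wrap (x + h))"
    by (rule AE_distrD[rotated]) simp
  then show ?thesis by (simp add: periodic_wrap[OF assms(1)])
qed

section \<open>Characters and their orthogonality\<close>

lemma character_borel [measurable]: "character k \<in> borel_measurable borel"
  unfolding character_def[abs_def] cis_conv_exp by measurable

lemma norm_character [simp]: "cmod (character k x) = 1"
  by (simp add: character_def)

lemma character_0 [simp]: "character 0 x = 1"
  by (simp add: character_def)

lemma character_add: "character (k + l) x = character k x * character l x"
  by (simp add: character_def freq_add inner_add_left distrib_left cis_mult)

lemma character_minus: "character (- k) x = cnj (character k x)"
  by (simp add: character_def cis_cnj)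

lemma character_shift: "character k (x + h) = character k x * character k h"
  by (simp add: character_def inner_add_right distrib_left cis_mult)

lemma character_mult_cnj [simp]: "character k x * cnj (character k x) = 1"
  by (simp add: complex_norm_square[symmetric])

lemma character_freq [simp]: "character k (freq l) = 1"
proof -
  have "freq k \<bullet> freq l = real_of_int (\<Sum>i\<in>UNIV. k $ i * l $ i)"
    by (simp add: inner_vec_def)
  moreover have "real_of_int (\<Sum>i\<in>UNIV. k $ i * l $ i) \<in> \<int>" by (rule Ints_of_int)
  ultimately show ?thesis
    unfolding character_def by (metis cis_multiple_2pi)
qed

lemma periodic_character: "periodic (character k)"
  by (simp add: periodic_def character_shift)

lemma integrable_torus_bounded:
  fixes f :: "real^'d::finite \<Rightarrow> 'b::{banach, second_countable_topology}"
  assumes "f \<in> borel_measurable torus" "\<And>x. norm (f x) \<le> B"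
  shows "integrable torus f"
  by (rule torus.integrable_const_bound[of _ B]) (use assms in auto)

lemma integral_character: "(\<integral>x. character k x \<partial>torus) = (if k = 0 then 1 else 0)"
proof (cases "k = 0")
  case True
  then show ?thesis by simp
next
  case False
  then obtain i where i: "k $ i \<noteq> 0" by (auto simp: vec_eq_iff)
  \<comment> \<open>Translation by half a period in direction \<open>i\<close> multiplies the
    character by -1, so the integral equals its own negative.\<close>
  define h :: "real^'a" where "h = axis i (1 / (2 * real_of_int (k $ i)))"
  have "freq k \<bullet> h = 1 / 2"
    using i by (simp add: h_def inner_axis)
  then have "2 * pi * (freq k \<bullet> h) = pi"
    by (metis mult.commute mult.left_neutral nonzero_mult_div_cancel_left times_divide_eq_right zero_neq_numeral)
  then have "character k h = -1"
    by (simp only: character_def cis_pi)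
  then have "(\<integral>x. character k (x + h) \<partial>torus) = - (\<integral>x. character k x \<partial>torus)"
    by (simp add: character_shift)
  moreover have "(\<integral>x. character k (x + h) \<partial>torus) = (\<integral>x. character k x \<partial>torus)"
    by (rule integral_torus_shift) (auto simp: periodic_character)
  ultimately show ?thesis using False by simp
qed

subsection \<open>Density of trigonometric polynomials\<close>

definition trig_poly :: "(real^'d::finite \<Rightarrow> complex) \<Rightarrow> bool" where
  "trig_poly p \<longleftrightarrow> (\<exists>K a. finite K \<and> p = (\<lambda>x. \<Sum>k\<in>K. a k * character k x))"

lemma trig_polyE:
  assumes "trig_poly p"
  obtains K a where "finite K" "p = (\<lambda>x. \<Sum>k\<in>K. a k * character k x)"
  using assms unfolding trig_poly_def by blast

lemma trig_poly_character: "trig_poly (\<lambda>x. c * character k x)"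
  unfolding trig_poly_def by (rule exI[of _ "{k}"], rule exI[of _ "\<lambda>_. c"]) simp

lemma trig_poly_const: "trig_poly (\<lambda>x. c)"
  using trig_poly_character[of c 0] by simp

lemma trig_poly_add:
  assumes "trig_poly p" "trig_poly q"
  shows "trig_poly (\<lambda>x. p x + q x)"
proof -
  obtain K a where K: "finite K" "p = (\<lambda>x. \<Sum>k\<in>K. a k * character k x)"
    using assms(1) by (rule trig_polyE)
  obtain L b where L: "finite L" "q = (\<lambda>x. \<Sum>k\<in>L. b k * character k x)"
    using assms(2) by (rule trig_polyE)
  have "p x + q x = (\<Sum>k\<in>K \<union> L. ((if k \<in> K then a k else 0) + (if k \<in> L then b k else 0))
      * character k x)" for x
  proof -
    have "p x = (\<Sum>k\<in>K \<union> L. (if k \<in> K then a k else 0) * character k x)"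
      unfolding K(2) using K(1) L(1) by (intro sum.mono_neutral_cong_left) auto
    moreover have "q x = (\<Sum>k\<in>K \<union> L. (if k \<in> L then b k else 0) * character k x)"
      unfolding L(2) using K(1) L(1) by (intro sum.mono_neutral_cong_left) auto
    ultimately show ?thesis by (simp add: sum.distrib distrib_right)
  qed
  then show ?thesis
    unfolding trig_poly_def using K(1) L(1)
    by (intro exI[of _ "K \<union> L"] exI[of _ "\<lambda>k. (if k \<in> K then a k else 0) + (if k \<in> L then b k else 0)"])
       auto
qed

lemma trig_poly_sum:
  assumes "\<And>i. i \<in> I \<Longrightarrow> trig_poly (p i)"
  shows "trig_poly (\<lambda>x. \<Sum>i\<in>I. p i x)"
  using assms
  by (induction I rule: infinite_finite_induct) (auto intro: trig_poly_const trig_poly_add)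

lemma trig_poly_mult:
  assumes "trig_poly p" "trig_poly q"
  shows "trig_poly (\<lambda>x. p x * q x)"
proof -
  obtain K a where K: "finite K" "p = (\<lambda>x. \<Sum>k\<in>K. a k * character k x)"
    using assms(1) by (rule trig_polyE)
  obtain L b where L: "finite L" "q = (\<lambda>x. \<Sum>k\<in>L. b k * character k x)"
    using assms(2) by (rule trig_polyE)
  have "(\<lambda>x. p x * q x) = (\<lambda>x. \<Sum>k\<in>K. \<Sum>l\<in>L. (a k * b l) * character (k + l) x)"
    by (simp add: K L sum_product character_add mult_ac)
  then show ?thesis
    by (auto intro!: trig_poly_sum trig_poly_character)
qed

lemma trig_poly_cmult: "trig_poly p \<Longrightarrow> trig_poly (\<lambda>x. c * p x)"
  by (intro trig_poly_mult trig_poly_const)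

lemma trig_poly_borel: "trig_poly p \<Longrightarrow> p \<in> borel_measurable borel"
  unfolding trig_poly_def by auto

lemma trig_poly_periodic: "trig_poly p \<Longrightarrow> periodic p"
  unfolding trig_poly_def periodic_def by (auto simp: character_shift)

lemma trig_poly_bounded:
  assumes "trig_poly p" obtains B where "\<And>x. cmod (p x) \<le> B"
proof -
  obtain K a where K: "finite K" "p = (\<lambda>x. \<Sum>k\<in>K. a k * character k x)"
    using assms by (rule trig_polyE)
  have "cmod (p x) \<le> (\<Sum>k\<in>K. cmod (a k))" for x
    unfolding K(2) by (rule order_trans[OF norm_sum]) (simp add: norm_mult)
  then show thesis using that by blast
qed

section \<open>The torus as a product of unit circles\<close>

definition circ :: "real^'d::finite \<Rightarrow> complex^'d" where
  "circ x = (\<chi> i. cis (2 * pi * (x $ i)))"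

lemma circ_nth: "circ x $ i = cis (2 * pi * (x $ i))"
  by (simp add: circ_def)

lemma circ_nth_character: "circ x $ i = character (axis i 1) x"
proof -
  have "freq (axis i 1) = axis i 1"
    by (simp add: vec_eq_iff axis_def)
  then show ?thesis by (simp add: circ_nth character_def inner_axis')
qed

lemma continuous_circ: "continuous_on UNIV circ"
  unfolding circ_def cis_conv_exp by (intro continuous_intros)

lemma circ_borel [measurable]: "circ \<in> borel_measurable borel"
  by (intro borel_measurable_continuous_onI continuous_circ)

text \<open>Makes Stone-Weierstrass on a compact ball of \<open>complex^'d\<close> available for
  trigonometric polynomials. The generators of \<open>real_polynomial_function\<close> are
  real-linear forms, hence combinations of the real and imaginary parts of the coordinates, and
  these are combinations of a character and its conjugate.\<close>

lemma trig_poly_polynomial_circ: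
  fixes g :: "complex^'d::finite \<Rightarrow> real"
  assumes "real_polynomial_function g"
  shows "trig_poly (\<lambda>x. complex_of_real (g (circ x)))"
  using assms
proof (induction g rule: real_polynomial_function.induct)
  case (linear f)
  interpret f: bounded_linear f by fact
  have eq: "f z = (\<Sum>i\<in>UNIV. Re (z $ i) * f (axis i 1) + Im (z $ i) * f (axis i \<i>))" for z
  proof -
    have "z = (\<Sum>i\<in>UNIV. Re (z $ i) *\<^sub>R axis i 1 + Im (z $ i) *\<^sub>R axis i \<i>)"
      by (simp add: vec_eq_iff axis_def if_distrib complex_eq_iff cong: if_cong)
    then have "f z = f (\<Sum>i\<in>UNIV. Re (z $ i) *\<^sub>R axis i 1 + Im (z $ i) *\<^sub>R axis i \<i>)" by simp
    also have "\<dots> = (\<Sum>i\<in>UNIV. Re (z $ i) * f (axis i 1) + Im (z $ i) * f (axis i \<i>))"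
      by (simp add: f.sum f.add f.scaleR)
    finally show ?thesis .
  qed
  have re': "complex_of_real (Re z) = (1/2) * z + (1/2) * cnj z"
    and im': "complex_of_real (Im z) = (-\<i>/2) * z + (\<i>/2) * cnj z" for z
    by (simp_all add: complex_eq_iff)
  have re: "complex_of_real (Re (circ x $ i)) = (1/2) * character (axis i 1) x + (1/2) * character (- axis i 1) x"
    and im: "complex_of_real (Im (circ x $ i)) = (-\<i>/2) * character (axis i 1) x + (\<i>/2) * character (- axis i 1) x"
    for x :: "real^'d" and i
    unfolding character_minus circ_nth_character[symmetric] by (rule re' im')+
  have "complex_of_real (f (circ x)) = (\<Sum>i\<in>UNIV.
      ((1/2) * character (axis i 1) x + (1/2) * character (- axis i 1) x) * of_real (f (axis i 1))
      + ((-\<i>/2) * character (axis i 1) x + (\<i>/2) * character (- axis i 1) x) * of_real (f (axis i \<i>)))"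
    for x :: "real^'d"
    by (subst eq) (simp only: of_real_sum of_real_add of_real_mult re im)
  then show ?case
    by (simp only:) (intro trig_poly_sum trig_poly_add trig_poly_mult trig_poly_const trig_poly_character)
next
  case (const c)
  show ?case by (rule trig_poly_const)
next
  case (add f g)
  then show ?case by (simp add: trig_poly_add)
next
  case (mult f g)
  then show ?case by (simp add: trig_poly_mult)
qed

lemma circ_inj:
  assumes "0 \<le> s" "s < 1" "0 \<le> t" "t < 1" "cis (2 * pi * s) = cis (2 * pi * t)"
  shows "s = t"
proof -
  have "cis (2 * pi * s - 2 * pi * t) = 1"
    using assms(5) by (simp add: cis_divide[symmetric])
  then have "cos (2 * pi * s - 2 * pi * t) = 1"
    by (simp add: complex_eq_iff)
  then obtain n :: int where "2 * pi * s - 2 * pi * t = real_of_int n * 2 * pi"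
    using cos_one_2pi_int[THEN iffD1] by blast
  then have "2 * pi * (s - t) = 2 * pi * n" by (simp add: algebra_simps)
  then have st: "s - t = n" by simp
  then have "real_of_int n < 1" "- 1 < real_of_int n"
    using assms by linarith+
  then have "n = 0" by linarith
  then show ?thesis using st by simp
qed

text \<open>\<open>circ\<close> is injective on the cell, but its inverse jumps where the cell is
  glued together, so measurability is tested on half-spaces: inside the cell,
  \<open>w $ i \<le> a\<close> with \<open>a < 1\<close> says that one coordinate lies on a closed
  arc.\<close>

lemma sets_torus_circ:
  assumes "A \<in> sets torus"
  shows "\<exists>B\<in>sets borel. A = circ -` B \<inter> cell"
proof -
  obtain A' where A': "A' \<in> sets borel" "A = A' \<inter> cell"
    using assms by (auto simp: sets_torus sets_restrict_space)
  let ?V = "vimage_algebra cell circ (borel :: (complex^'a) measure)"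
  have V: "sets ?V = {circ -` B \<inter> cell | B. B \<in> sets borel}"
    by (rule sets_vimage_algebra2) simp
  have "(\<lambda>x. x) \<in> measurable ?V borel"
  proof (rule borel_measurable_vecI, subst borel_measurable_iff_le, intro allI)
    fix i a
    show "{w \<in> space ?V. w $ i \<le> a} \<in> sets ?V"
    proof -
      \<comment> \<open>For negative \<open>a\<close> the arc is empty, in agreement with the
        half-space, which then misses the cell.\<close>
      let ?I = "(\<lambda>s. cis (2 * pi * s)) ` {0..a}"
      have le: "circ -` {z. z $ i \<in> ?I} \<inter> cell = {w \<in> space ?V. w $ i \<le> a}" if "a < 1"
      proof (intro equalityI subsetI)
        fix x assume x: "x \<in> circ -` {z. z $ i \<in> ?I} \<inter> cell"
        then obtain s where s: "0 \<le> s" "s \<le> a" "cis (2 * pi * (x $ i)) = cis (2 * pi * s)"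
          by (auto simp: circ_nth)
        have "x $ i = s"
          by (rule circ_inj) (use x s that in \<open>auto simp: cell_def\<close>)
        then show "x \<in> {w \<in> space ?V. w $ i \<le> a}"
          using x s by simp
      next
        fix x assume x: "x \<in> {w \<in> space ?V. w $ i \<le> a}"
        then have "x $ i \<in> {0..a}"
          using that by (auto simp: cell_def)
        then show "x \<in> circ -` {z. z $ i \<in> ?I} \<inter> cell"
          using x by (auto simp: circ_nth)
      qed
      have bor: "{z :: complex^'a. z $ i \<in> ?I} \<in> sets borel"
      proof -
        have "compact ?I"
          by (intro compact_continuous_image) (auto intro!: continuous_intros simp: cis_conv_exp)
        then have "closed ?I" by (rule compact_imp_closed)
        then have "closed ((\<lambda>z :: complex^'a. z $ i) -` ?I)"
          by (intro closed_vimage continuous_on_component continuous_on_id)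
        then show ?thesis by (simp add: vimage_def)
      qed
      have gt: "{w \<in> space ?V. w $ i \<le> a} = space ?V" if "\<not> a < 1"
        using that by (auto simp: cell_def) (metis less_eq_real_def not_less order_trans)
      show ?thesis
      proof (cases "a < 1")
        case True
        show ?thesis
          unfolding V le[OF True, symmetric] using bor by blast
      next
        case False
        show ?thesis unfolding gt[OF False] by (rule sets.top)
      qed
    qed
  qed
  then have "(\<lambda>x. x) -` A' \<inter> space ?V \<in> sets ?V"
    using A'(1) by (rule measurable_sets)
  then have "A' \<inter> cell \<in> sets ?V" by simp
  then show ?thesis unfolding V using A'(2) by auto
qed

section \<open>Trigonometric approximation in L2 of a finite measure\<close>

lemma norm_add_square_le:
  fixes a b :: complex
  shows "(cmod (a + b))\<^sup>2 \<le> 2 * (cmod a)\<^sup>2 + 2 * (cmod b)\<^sup>2"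
proof -
  have "(cmod (a + b))\<^sup>2 \<le> (cmod a + cmod b)\<^sup>2"
    by (intro power_mono norm_triangle_ineq) auto
  also have "\<dots> \<le> 2 * (cmod a)\<^sup>2 + 2 * (cmod b)\<^sup>2"
    using sum_squares_bound[of "cmod a" "cmod b"] by (simp add: power2_sum)
  finally show ?thesis .
qed

text \<open>Kept general because two measures occur: Lebesgue measure on the torus, for Parseval's
  identity, and the measure with density |f|, for the uniqueness of Fourier coefficients.\<close>

locale torus_finite_measure = finite_measure \<mu> for \<mu> :: "(real^'d::finite) measure" +
  assumes sets_eq: "sets \<mu> = sets torus"
begin

lemma space_eq: "space \<mu> = cell"
  using sets_eq_imp_space_eq[OF sets_eq] by simp

lemma measurable_eq: "measurable \<mu> N = measurable torus N"
  by (rule measurable_cong_sets) (simp_all add: sets_eq)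

lemma borel_measurable_mu [measurable (raw)]: "f \<in> measurable borel N \<Longrightarrow> f \<in> measurable \<mu> N"
  unfolding measurable_eq by (rule measurable_torus_borel)

abbreviation sqdist :: "(real^'d \<Rightarrow> complex) \<Rightarrow> (real^'d \<Rightarrow> complex) \<Rightarrow> ennreal" where
  "sqdist f g \<equiv> \<integral>\<^sup>+x. ennreal ((cmod (f x - g x))\<^sup>2) \<partial>\<mu>"

definition approx :: "(real^'d \<Rightarrow> complex) \<Rightarrow> bool" where
  "approx f \<longleftrightarrow> f \<in> borel_measurable \<mu> \<and>
     (\<forall>e>0. \<exists>p. trig_poly p \<and> sqdist f p < ennreal e)"

lemma approxD1: "approx f \<Longrightarrow> f \<in> borel_measurable \<mu>"
  by (simp add: approx_def)

lemma approxE: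
  assumes "approx f" "0 < e"
  obtains p where "trig_poly p" "p \<in> borel_measurable \<mu>" "sqdist f p < ennreal e"
  using assms unfolding approx_def by (meson borel_measurable_mu trig_poly_borel)

text \<open>Squared distances obey the triangle inequality up to a factor 2, whence the
  quarters.\<close>

lemma nn_integral_square_triangle:
  assumes [measurable]: "f \<in> borel_measurable \<mu>" "g \<in> borel_measurable \<mu>"
    and "(\<integral>\<^sup>+x. ennreal ((cmod (f x))\<^sup>2) \<partial>\<mu>) < ennreal (e / 4)"
    and "(\<integral>\<^sup>+x. ennreal ((cmod (g x))\<^sup>2) \<partial>\<mu>) < ennreal (e / 4)" and e: "0 < e"
  shows "(\<integral>\<^sup>+x. ennreal ((cmod (f x + g x))\<^sup>2) \<partial>\<mu>) < ennreal e"
proof -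
  have "(\<integral>\<^sup>+x. ennreal ((cmod (f x + g x))\<^sup>2) \<partial>\<mu>)
    \<le> (\<integral>\<^sup>+x. 2 * ennreal ((cmod (f x))\<^sup>2) + 2 * ennreal ((cmod (g x))\<^sup>2) \<partial>\<mu>)"
    by (intro nn_integral_mono)
      (auto simp: ennreal_mult[symmetric] ennreal_plus[symmetric] ennreal_numeral[symmetric] simp del: ennreal_plus ennreal_numeral intro!: ennreal_leI norm_add_square_le)
  also have "\<dots> = 2 * (\<integral>\<^sup>+x. ennreal ((cmod (f x))\<^sup>2) \<partial>\<mu>) + 2 * (\<integral>\<^sup>+x. ennreal ((cmod (g x))\<^sup>2) \<partial>\<mu>)"
    by (simp add: nn_integral_add nn_integral_cmult)
  also have "\<dots> < 2 * ennreal (e / 4) + 2 * ennreal (e / 4)"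
    using assms(3,4) by (intro add_strict_mono ennreal_mult_strict_left_mono) auto
  also have "\<dots> = ennreal e"
    using e by (simp add: ennreal_mult[symmetric] ennreal_plus[symmetric] ennreal_numeral[symmetric] del: ennreal_plus ennreal_numeral)
  finally show ?thesis .
qed

lemma approx_close:
  assumes [measurable]: "f \<in> borel_measurable \<mu>"
    and "\<And>e. 0 < e \<Longrightarrow> \<exists>g. approx g \<and> sqdist f g < ennreal e"
  shows "approx f"
  unfolding approx_def
proof (intro conjI allI impI)
  fix e :: real assume e: "0 < e"
  obtain g where g: "approx g" "sqdist f g < ennreal (e / 4)"
    using assms(2)[of "e / 4"] e by auto
  note [measurable] = approxD1[OF g(1)]
  obtain p where p: "trig_poly p" "p \<in> borel_measurable \<mu>" "sqdist g p < ennreal (e / 4)"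
    using approxE[OF g(1), of "e / 4"] e by auto
  note [measurable] = p(2)
  have "(\<integral>\<^sup>+x. ennreal ((cmod ((f x - g x) + (g x - p x)))\<^sup>2) \<partial>\<mu>) < ennreal e"
    by (rule nn_integral_square_triangle) (use g p e in auto)
  then show "\<exists>p. trig_poly p \<and> sqdist f p < ennreal e"
    using p(1) by auto
qed fact

lemma approx_trig_poly: "trig_poly p \<Longrightarrow> approx p"
  unfolding approx_def using trig_poly_borel[of p] by (auto intro!: exI[of _ p] borel_measurable_mu)

lemma approx_add:
  assumes "approx f" "approx g"
  shows "approx (\<lambda>x. f x + g x)"
  unfolding approx_def
proof (intro conjI allI impI)
  note [measurable] = approxD1[OF assms(1)] approxD1[OF assms(2)]
  show "(\<lambda>x. f x + g x) \<in> borel_measurable \<mu>" by simp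
  fix e :: real assume e: "0 < e"
  obtain p where p: "trig_poly p" "p \<in> borel_measurable \<mu>" "sqdist f p < ennreal (e / 4)"
    using approxE[OF assms(1), of "e / 4"] e by auto
  obtain q where q: "trig_poly q" "q \<in> borel_measurable \<mu>" "sqdist g q < ennreal (e / 4)"
    using approxE[OF assms(2), of "e / 4"] e by auto
  note [measurable] = p(2) q(2)
  have "(\<integral>\<^sup>+x. ennreal ((cmod ((f x - p x) + (g x - q x)))\<^sup>2) \<partial>\<mu>) < ennreal e"
    by (rule nn_integral_square_triangle) (use p q e in auto)
  then show "\<exists>p. trig_poly p \<and> (\<integral>\<^sup>+x. ennreal ((cmod (f x + g x - p x))\<^sup>2) \<partial>\<mu>) < ennreal e"
    using p(1) q(1) by (intro exI[of _ "\<lambda>x. p x + q x"]) (auto simp: trig_poly_add algebra_simps)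
qed

lemma approx_cmult:
  assumes "approx f"
  shows "approx (\<lambda>x. c * f x)"
  unfolding approx_def
proof (intro conjI allI impI)
  note [measurable] = approxD1[OF assms(1)]
  show "(\<lambda>x. c * f x) \<in> borel_measurable \<mu>" by simp
  fix e :: real assume e: "0 < e"
  \<comment> \<open>The summand 1 keeps the division legitimate for \<open>c = 0\<close>.\<close>
  define C where "C = 1 + (cmod c)\<^sup>2"
  have pos: "0 < C" and cC: "(cmod c)\<^sup>2 \<le> C" by (simp_all add: C_def add_pos_nonneg)
  obtain p where p: "trig_poly p" "p \<in> borel_measurable \<mu>"
    "sqdist f p < ennreal (e / C)"
    using approxE[OF assms(1), of "e / C"] e pos by auto
  note [measurable] = p(2)
  have "(\<integral>\<^sup>+x. ennreal ((cmod (c * f x - c * p x))\<^sup>2) \<partial>\<mu>)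
    \<le> (\<integral>\<^sup>+x. ennreal C * ennreal ((cmod (f x - p x))\<^sup>2) \<partial>\<mu>)"
    by (intro nn_integral_mono) (auto simp: ennreal_mult[symmetric] right_diff_distrib[symmetric] norm_mult power_mult_distrib
        less_imp_le[OF pos] intro!: ennreal_leI mult_right_mono cC less_imp_le[OF pos])
  also have "\<dots> = ennreal C * sqdist f p"
    by (simp add: nn_integral_cmult)
  also have "\<dots> < ennreal C * ennreal (e / C)"
    using p(3) pos by (intro ennreal_mult_strict_left_mono) (auto simp: ennreal_eq_0_iff)
  also have "\<dots> = ennreal e"
    using pos e by (simp add: ennreal_mult[symmetric])
  finally show "\<exists>p. trig_poly p \<and> (\<integral>\<^sup>+x. ennreal ((cmod (c * f x - p x))\<^sup>2) \<partial>\<mu>) < ennreal e"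
    using p(1) trig_poly_cmult by (intro exI[of _ "\<lambda>x. c * p x"]) auto
qed

lemma approx_sum:
  assumes "\<And>i. i \<in> I \<Longrightarrow> approx (f i)"
  shows "approx (\<lambda>x. \<Sum>i\<in>I. f i x)"
  using assms
  by (induction I rule: infinite_finite_induct) (auto intro: approx_add approx_trig_poly trig_poly_const)

text \<open>Dominated convergence. By this closure property the approximable functions grow from
  trigonometric polynomials to continuous functions, indicators of closed and of Borel sets, and
  finally all of L2.\<close>

lemma approx_lim:
  assumes f: "\<And>n. approx (f n)" and g [measurable]: "g \<in> borel_measurable \<mu>"
    and lim: "\<And>x. x \<in> cell \<Longrightarrow> (\<lambda>n. f n x) \<longlonglongrightarrow> g x"
    and w [measurable]: "w \<in> borel_measurable \<mu>" "\<And>n x. x \<in> cell \<Longrightarrow> (cmod (g x - f n x))\<^sup>2 \<le> w x"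
    and fin: "(\<integral>\<^sup>+x. ennreal (w x) \<partial>\<mu>) < \<infinity>"
  shows "approx g"
proof (rule approx_close)
  note [measurable] = approxD1[OF f]
  have "(\<lambda>n. \<integral>\<^sup>+x. ennreal ((cmod (g x - f n x))\<^sup>2) \<partial>\<mu>) \<longlonglongrightarrow> (\<integral>\<^sup>+x. 0 \<partial>\<mu>)"
  proof (rule nn_integral_dominated_convergence[where w="\<lambda>x. ennreal (w x)"])
    show "AE x in \<mu>. ennreal ((cmod (g x - f j x))\<^sup>2) \<le> ennreal (w x)" for j
      using w(2) by (intro AE_I2) (auto simp: space_eq intro!: ennreal_leI)
    show "AE x in \<mu>. (\<lambda>n. ennreal ((cmod (g x - f n x))\<^sup>2)) \<longlonglongrightarrow> 0"
    proof (rule AE_I2)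
      fix x assume "x \<in> space \<mu>"
      then have "(\<lambda>n. (cmod (g x - f n x))\<^sup>2) \<longlonglongrightarrow> (cmod (g x - g x))\<^sup>2"
        using lim[of x] by (intro tendsto_intros) (simp add: space_eq)
      then show "(\<lambda>n. ennreal ((cmod (g x - f n x))\<^sup>2)) \<longlonglongrightarrow> 0"
        using tendsto_ennrealI[of "\<lambda>n. (cmod (g x - f n x))\<^sup>2" 0] by simp
    qed
  qed (use fin in auto)
  then have l: "(\<lambda>n. \<integral>\<^sup>+x. ennreal ((cmod (g x - f n x))\<^sup>2) \<partial>\<mu>) \<longlonglongrightarrow> 0" by simp
  fix e :: real assume "0 < e"
  then have "\<forall>\<^sub>F n in sequentially. (\<integral>\<^sup>+x. ennreal ((cmod (g x - f n x))\<^sup>2) \<partial>\<mu>) < ennreal e"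
    by (intro order_tendstoD(2)[OF l]) auto
  then obtain n where "(\<integral>\<^sup>+x. ennreal ((cmod (g x - f n x))\<^sup>2) \<partial>\<mu>) < ennreal e"
    using eventually_happens'[OF sequentially_bot] by blast
  then show "\<exists>h. approx h \<and> sqdist g h < ennreal e"
    using f by blast
qed fact

lemma finite_bound: "(\<integral>\<^sup>+x. ennreal c \<partial>\<mu>) < \<infinity>"
  using emeasure_finite[of "space \<mu>"] by (simp add: ennreal_mult_eq_top_iff less_top[symmetric] del: emeasure_finite)

lemma approx_continuous:
  fixes \<psi> :: "complex^'d \<Rightarrow> real"
  assumes "continuous_on UNIV \<psi>"
  shows "approx (\<lambda>x. complex_of_real (\<psi> (circ x)))"
proof -
  \<comment> \<open>All coordinates of \<open>circ x\<close> have modulus 1, so the image of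
    \<open>circ\<close> lies in the ball whose radius is the dimension.\<close>
  have comp: "compact (cball 0 (real CARD('d)) :: (complex^'d) set)" by simp
  have "\<exists>g. real_polynomial_function g \<and> (\<forall>z\<in>cball 0 (real CARD('d)). \<bar>\<psi> z - g z\<bar> < 1 / real (Suc n))" for n
    using Stone_Weierstrass_real_polynomial_function[OF comp continuous_on_subset[OF assms subset_UNIV], of "1 / real (Suc n)"]
    by (metis of_nat_0_less_iff zero_less_Suc zero_less_divide_1_iff)
  then obtain g where g: "\<And>n. real_polynomial_function (g n)"
    "\<And>n z. z \<in> cball 0 (real CARD('d)) \<Longrightarrow> \<bar>\<psi> z - g n z\<bar> < 1 / real (Suc n)"
    by metis
  have mem: "circ x \<in> cball 0 (real CARD('d))" for x :: "real^'d"
  proof -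
    have "norm (circ x) \<le> (\<Sum>i\<in>(UNIV :: 'd set). norm (circ x $ i))"
      unfolding norm_vec_def by (rule L2_set_le_sum) simp
    also have "\<dots> = real CARD('d)" by (simp add: circ_nth)
    finally show ?thesis by simp
  qed
  have psi [measurable]: "\<psi> \<in> borel_measurable borel"
    using assms by (rule borel_measurable_continuous_onI)
  have b: "\<bar>\<psi> (circ x) - g n (circ x)\<bar> \<le> 1 / real (Suc n)" for n x
    using g(2)[OF mem] by (simp add: less_imp_le)
  show ?thesis
  proof (rule approx_lim[where f="\<lambda>n x. complex_of_real (g n (circ x))" and w="\<lambda>_. 1"])
    show "approx (\<lambda>x. complex_of_real (g n (circ x)))" for n
      by (intro approx_trig_poly trig_poly_polynomial_circ g)
    show "(\<lambda>n. complex_of_real (g n (circ x))) \<longlonglongrightarrow> complex_of_real (\<psi> (circ x))" for x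
    proof (rule tendsto_of_real)
      show "(\<lambda>n. g n (circ x)) \<longlonglongrightarrow> \<psi> (circ x)"
      proof (rule LIM_zero_cancel, rule Lim_null_comparison)
        show "\<forall>\<^sub>F n in sequentially. norm (g n (circ x) - \<psi> (circ x)) \<le> 1 / real (Suc n)"
          using b by (simp add: abs_minus_commute)
        show "(\<lambda>n. 1 / real (Suc n)) \<longlonglongrightarrow> 0"
          using LIMSEQ_inverse_real_of_nat by (simp add: inverse_eq_divide)
      qed
    qed
    show "(cmod (complex_of_real (\<psi> (circ x)) - complex_of_real (g n (circ x))))\<^sup>2 \<le> 1" for n x
    proof -
      have "\<bar>\<psi> (circ x) - g n (circ x)\<bar> \<le> 1"
        using b[of x n] by (smt (verit) divide_le_eq_1 of_nat_Suc of_nat_0_le_iff)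
      then show ?thesis
        by (simp add: of_real_diff[symmetric] abs_square_le_1 del: of_real_diff)
    qed
  qed (use finite_bound[of 1] in auto)
qed

lemma approx_closed:
  assumes "closed C"
  shows "approx (\<lambda>x. indicator C (circ x))"
proof (cases "C = {}")
  case True
  then show ?thesis by (simp add: approx_trig_poly trig_poly_const)
next
  case False
  have [measurable]: "C \<in> sets borel" using assms by simp
  \<comment> \<open>Continuous ramps decreasing to the indicator of \<open>C\<close>. For empty
    \<open>C\<close>, \<open>infdist\<close> is 0 by convention and they would be constantly 1;
    hence the case distinction.\<close>
  define \<psi> where "\<psi> n z = max 0 (1 - real n * infdist z C)" for n and z :: "complex^'d"
  have r: "0 \<le> \<psi> n z" "\<psi> n z \<le> 1" for n z
    by (auto simp: \<psi>_def infdist_nonneg)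
  show ?thesis
  proof (rule approx_lim[where f="\<lambda>n x. complex_of_real (\<psi> n (circ x))" and w="\<lambda>_. 1"])
    show "approx (\<lambda>x. complex_of_real (\<psi> n (circ x)))" for n
      unfolding \<psi>_def by (intro approx_continuous continuous_intros)
    show "(\<lambda>n. complex_of_real (\<psi> n (circ x))) \<longlonglongrightarrow> indicator C (circ x)" for x
    proof (cases "circ x \<in> C")
      case True
      then show ?thesis by (simp add: \<psi>_def)
    next
      case nC: False
      then have pos: "0 < infdist (circ x) C"
        using assms False by (simp add: infdist_pos_not_in_closed)
      obtain N where N: "1 / infdist (circ x) C < real N"
        using reals_Archimedean2 by blast
      have "\<psi> n (circ x) = 0" if "N \<le> n" for n
      proof -
        have "1 / infdist (circ x) C < real n" using N that by linarith
        then show ?thesis using pos by (simp add: \<psi>_def field_simps)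
      qed
      then have "\<forall>\<^sub>F n in sequentially. complex_of_real (\<psi> n (circ x)) = indicator C (circ x)"
        using nC by (intro eventually_sequentiallyI[of N]) simp
      then show ?thesis by (rule tendsto_eventually)
    qed
    show "(cmod (indicator C (circ x) - complex_of_real (\<psi> n (circ x))))\<^sup>2 \<le> 1" for n x
    proof -
      have "cmod (indicator C (circ x) - complex_of_real (\<psi> n (circ x))) = \<bar>indicator C (circ x) - \<psi> n (circ x)\<bar>"
        by (metis norm_of_real of_real_diff of_real_indicator)
      also have "\<dots> \<le> 1" using r[of n "circ x"] by (auto simp: indicator_def)
      finally show ?thesis by (simp add: abs_square_le_1)
    qed
  qed (use finite_bound[of 1] in auto)
qed

text \<open>Dynkin's argument: closed sets are stable under intersection, and approximability passes
  to complements and to countable disjoint unions.\<close>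

lemma approx_borel_circ:
  assumes "B \<in> sets borel"
  shows "approx (\<lambda>x. indicator B (circ x))"
proof -
  have "Int_stable (Collect closed :: (complex^'d) set set)"
    by (auto simp: Int_stable_def)
  moreover have "Collect closed \<subseteq> Pow (UNIV :: (complex^'d) set)" by auto
  moreover have "B \<in> sigma_sets UNIV (Collect closed)"
    using assms by (simp add: borel_eq_closed)
  ultimately show ?thesis
  proof (induction rule: sigma_sets_induct_disjoint)
    case (basic A)
    then show ?case by (simp add: approx_closed)
  next
    case empty
    then show ?case by (simp add: approx_trig_poly trig_poly_const)
  next
    case (compl A)
    have "(\<lambda>x. indicator (UNIV - A) (circ x)) = (\<lambda>x. 1 + (-1) * indicator A (circ x) :: complex)"
      by (auto simp: indicator_def)
    moreover have "approx (\<lambda>x. 1 + (-1) * indicator A (circ x))"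
      using compl by (intro approx_add approx_cmult approx_trig_poly[OF trig_poly_const])
    ultimately show ?case by simp
  next
    case (union A)
    then have m: "\<And>i. A i \<in> sets borel"
      using range_subsetD[OF union(2)] by (simp add: borel_eq_closed)
    have [measurable]: "(\<Union>i. A i) \<in> sets borel" using m by auto
    have eq: "(\<Sum>i<n. indicator (A i) z) = (indicator (\<Union>i<n. A i) z :: complex)" for n z
      by (rule indicator_UN_disjoint[symmetric])
        (use union(1) in \<open>auto simp: disjoint_family_on_def\<close>)
    show ?case
    proof (rule approx_lim[where f="\<lambda>n x. \<Sum>i<n. indicator (A i) (circ x)" and w="\<lambda>_. 1"])
      show "approx (\<lambda>x. \<Sum>i<n. indicator (A i) (circ x))" for n
        using union by (intro approx_sum) auto
      show "(\<lambda>n. \<Sum>i<n. indicator (A i) (circ x)) \<longlonglongrightarrow> (indicator (\<Union> (range A)) (circ x) :: complex)" for x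
        unfolding eq by (rule LIMSEQ_indicator_UN)
      show "(cmod (indicator (\<Union> (range A)) (circ x) - (\<Sum>i<n. indicator (A i) (circ x))))\<^sup>2 \<le> 1" for n x
        unfolding eq by (auto simp: indicator_def)
    qed (use finite_bound[of 1] in auto)
  qed
qed

lemma approx_indicator:
  assumes "A \<in> sets \<mu>"
  shows "approx (indicator A)"
proof -
  obtain B where B: "B \<in> sets borel" "A = circ -` B \<inter> cell"
    using sets_torus_circ[of A] assms by (auto simp: sets_eq)
  have [measurable]: "A \<in> sets \<mu>" by fact
  show ?thesis
  proof (rule approx_close)
    fix e :: real assume "0 < e"
    have "(\<integral>\<^sup>+x. ennreal ((cmod (indicator A x - indicator B (circ x)))\<^sup>2) \<partial>\<mu>) = (\<integral>\<^sup>+x. 0 \<partial>\<mu>)"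
      by (intro nn_integral_cong) (auto simp: space_eq B(2) indicator_def)
    then have "(\<integral>\<^sup>+x. ennreal ((cmod (indicator A x - indicator B (circ x)))\<^sup>2) \<partial>\<mu>) < ennreal e"
      using \<open>0 < e\<close> by simp
    then show "\<exists>g. approx g \<and> (\<integral>\<^sup>+x. ennreal ((cmod (indicator A x - g x))\<^sup>2) \<partial>\<mu>) < ennreal e"
      using approx_borel_circ[OF B(1)] by blast
  qed simp
qed

lemma approx_simple:
  assumes "simple_function \<mu> f"
  shows "approx f"
proof -
  define g where "g x = (\<Sum>y\<in>f ` space \<mu>. y * indicator (f -` {y} \<inter> space \<mu>) x)" for x
  have g: "approx g"
    unfolding g_def by (intro approx_sum approx_cmult approx_indicator simple_functionD(2)[OF assms])
  have eq: "g x = f x" if "x \<in> cell" for x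
  proof -
    have "g x = (\<Sum>y\<in>f ` space \<mu>. if y = f x then y else 0)"
      unfolding g_def using that by (intro sum.cong) (auto simp: indicator_def space_eq)
    also have "\<dots> = f x"
      using simple_functionD(1)[OF assms] that by (simp add: space_eq)
    finally show ?thesis .
  qed
  show ?thesis
    by (rule approx_lim[where f="\<lambda>_. g" and w="\<lambda>_. 0"])
      (use g eq borel_measurable_simple_function[OF assms] in simp_all)
qed

theorem trig_poly_dense:
  assumes f [measurable]: "f \<in> borel_measurable \<mu>" and fin: "integrable \<mu> (\<lambda>x. (cmod (f x))\<^sup>2)"
  shows "approx f"
proof -
  obtain F where F: "\<And>i. simple_function \<mu> (F i)" "\<And>x. x \<in> space \<mu> \<Longrightarrow> (\<lambda>i. F i x) \<longlonglongrightarrow> f x"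
    "\<And>i x. x \<in> space \<mu> \<Longrightarrow> dist (F i x) 0 \<le> 2 * dist (f x) 0"
    using borel_measurable_implies_sequence_metric[OF f, of 0] by blast
  show ?thesis
  proof (rule approx_lim[where f=F and w="\<lambda>x. 9 * (cmod (f x))\<^sup>2"])
    show "approx (F n)" for n by (rule approx_simple) (rule F)
    show "(\<lambda>n. F n x) \<longlonglongrightarrow> f x" if "x \<in> cell" for x
      using F(2) that by (simp add: space_eq)
    show "(cmod (f x - F n x))\<^sup>2 \<le> 9 * (cmod (f x))\<^sup>2" if "x \<in> cell" for n x
    proof -
      have "cmod (F n x) \<le> 2 * cmod (f x)" using F(3)[of x n] that by (simp add: space_eq)
      then have "cmod (f x - F n x) \<le> 3 * cmod (f x)"
        using norm_triangle_ineq4[of "f x" "F n x"] by linarith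
      then have "(cmod (f x - F n x))\<^sup>2 \<le> (3 * cmod (f x))\<^sup>2" by (intro power_mono) auto
      then show ?thesis by (simp add: power_mult_distrib)
    qed
    have "integrable \<mu> (\<lambda>x. 9 * (cmod (f x))\<^sup>2)" using fin by simp
    then show "(\<integral>\<^sup>+x. ennreal (9 * (cmod (f x))\<^sup>2) \<partial>\<mu>) < \<infinity>"
      by (subst nn_integral_eq_integral) auto
  qed auto
qed

end

subsection \<open>Square-integrable functions\<close>

lemma L2_torusI:
  assumes "periodic f" "f \<in> borel_measurable borel" "integrable torus (\<lambda>x. (cmod (f x))\<^sup>2)"
  shows "f \<in> L2_torus"
  using assms by (simp add: L2_torus_def)

lemma L2_periodic: "f \<in> L2_torus \<Longrightarrow> periodic f"
  by (simp add: L2_torus_def)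

lemma L2_borel [measurable_dest]: "f \<in> L2_torus \<Longrightarrow> f \<in> borel_measurable borel"
  by (simp add: L2_torus_def)

lemma L2_integrable_sq: "f \<in> L2_torus \<Longrightarrow> integrable torus (\<lambda>x. (cmod (f x))\<^sup>2)"
  by (simp add: L2_torus_def)

lemma L2_torus_bound:
  assumes "periodic f" "f \<in> borel_measurable borel"
    and "integrable torus u" "AE x in torus. (cmod (f x))\<^sup>2 \<le> u x"
  shows "f \<in> L2_torus"
proof (rule L2_torusI[OF assms(1,2)])
  show "integrable torus (\<lambda>x. (cmod (f x))\<^sup>2)"
    by (rule Bochner_Integration.integrable_bound[OF assms(3)])
      (use assms in \<open>auto elim!: eventually_mono\<close>)
qed

lemma L2_integrable_norm_mult:
  assumes "f \<in> L2_torus" "g \<in> L2_torus"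
  shows "integrable torus (\<lambda>x. cmod (f x) * cmod (g x))"
proof (rule Bochner_Integration.integrable_bound)
  show "integrable torus (\<lambda>x. (cmod (f x))\<^sup>2 + (cmod (g x))\<^sup>2)"
    using assms by (intro Bochner_Integration.integrable_add L2_integrable_sq)
  show "AE x in torus. norm (cmod (f x) * cmod (g x)) \<le> norm ((cmod (f x))\<^sup>2 + (cmod (g x))\<^sup>2)"
  proof (rule AE_I2)
    fix x
    have "2 * (cmod (f x) * cmod (g x)) \<le> (cmod (f x))\<^sup>2 + (cmod (g x))\<^sup>2"
      using sum_squares_bound[of "cmod (f x)" "cmod (g x)"] by simp
    moreover have "0 \<le> cmod (f x) * cmod (g x)" by simp
    ultimately have "cmod (f x) * cmod (g x) \<le> (cmod (f x))\<^sup>2 + (cmod (g x))\<^sup>2"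
      by linarith
    then show "norm (cmod (f x) * cmod (g x)) \<le> norm ((cmod (f x))\<^sup>2 + (cmod (g x))\<^sup>2)"
      by simp
  qed
qed (use assms in measurable)

lemma L2_add [intro]:
  assumes "f \<in> L2_torus" "g \<in> L2_torus"
  shows "(\<lambda>x. f x + g x) \<in> L2_torus"
proof (rule L2_torus_bound)
  show "periodic (\<lambda>x. f x + g x)"
    using assms[THEN L2_periodic] by (simp add: periodic_def)
  show "integrable torus (\<lambda>x. 2 * (cmod (f x))\<^sup>2 + 2 * (cmod (g x))\<^sup>2)"
    using assms by (intro Bochner_Integration.integrable_add integrable_mult_right L2_integrable_sq)
  show "AE x in torus. (cmod (f x + g x))\<^sup>2 \<le> 2 * (cmod (f x))\<^sup>2 + 2 * (cmod (g x))\<^sup>2"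
    by (intro AE_I2 norm_add_square_le)
qed (use assms in measurable)

lemma L2_trig_poly: "trig_poly p \<Longrightarrow> p \<in> L2_torus"
proof (rule L2_torusI)
  assume p: "trig_poly p"
  obtain B where B: "\<And>x. cmod (p x) \<le> B" using trig_poly_bounded[OF p] by blast
  show "periodic p" "p \<in> borel_measurable borel"
    using trig_poly_periodic[OF p] trig_poly_borel[OF p] by auto
  then show "integrable torus (\<lambda>x. (cmod (p x))\<^sup>2)"
    by (intro integrable_torus_bounded[of _ "B\<^sup>2"]) (auto intro!: power_mono B)
qed

lemma L2_character [intro, simp]: "character k \<in> L2_torus"
  using L2_trig_poly[OF trig_poly_character[of 1 k]] by simp

lemma L2_const [intro, simp]: "(\<lambda>x. c) \<in> L2_torus"
  using L2_trig_poly[OF trig_poly_const] .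

lemma L2_mult_bounded [intro]:
  assumes f: "f \<in> L2_torus" and a: "periodic a" "a \<in> borel_measurable borel"
    and b: "AE x in torus. cmod (a x) \<le> B"
  shows "(\<lambda>x. a x * f x) \<in> L2_torus"
proof (rule L2_torus_bound)
  show "periodic (\<lambda>x. a x * f x)" using a L2_periodic[OF f] by (simp add: periodic_def)
  show "(\<lambda>x. a x * f x) \<in> borel_measurable borel" using a(2) f by measurable
  show "integrable torus (\<lambda>x. B\<^sup>2 * (cmod (f x))\<^sup>2)"
    by (intro integrable_mult_right L2_integrable_sq f)
  show "AE x in torus. (cmod (a x * f x))\<^sup>2 \<le> B\<^sup>2 * (cmod (f x))\<^sup>2"
    using b by eventually_elim (auto simp: norm_mult power_mult_distrib intro!: mult_right_mono power_mono)
qed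

lemma L2_cmult [intro]: "f \<in> L2_torus \<Longrightarrow> (\<lambda>x. c * f x) \<in> L2_torus"
  by (rule L2_mult_bounded[of _ "\<lambda>_. c" "cmod c"]) (auto simp: periodic_def)

lemma L2_diff [intro]:
  assumes "f \<in> L2_torus" "g \<in> L2_torus"
  shows "(\<lambda>x. f x - g x) \<in> L2_torus"
  using L2_add[OF assms(1) L2_cmult[OF assms(2), of "-1"]] by simp

lemma L2_sum [intro]: "(\<And>i. i \<in> I \<Longrightarrow> f i \<in> L2_torus) \<Longrightarrow> (\<lambda>x. \<Sum>i\<in>I. f i x) \<in> L2_torus"
  by (induction I rule: infinite_finite_induct) auto

lemma L2_cnj [intro]:
  assumes "f \<in> L2_torus" shows "(\<lambda>x. cnj (f x)) \<in> L2_torus"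
proof -
  have "cnj \<in> borel_measurable borel"
    by (intro borel_measurable_continuous_onI continuous_intros)
  then have "(\<lambda>x. cnj (f x)) \<in> borel_measurable borel"
    using assms by (auto intro: measurable_compose)
  then show ?thesis using assms by (auto simp: L2_torus_def periodic_def)
qed

lemma L2_shift [intro]:
  assumes "f \<in> L2_torus" shows "(\<lambda>x. f (x + h)) \<in> L2_torus"
proof (rule L2_torusI)
  show "periodic (\<lambda>x. f (x + h))"
    using L2_periodic[OF assms] unfolding periodic_def
    by (metis add.assoc add.commute)
  have "periodic (\<lambda>x. (cmod (f x))\<^sup>2)" using L2_periodic[OF assms] by (simp add: periodic_def)
  then show "integrable torus (\<lambda>x. (cmod (f (x + h)))\<^sup>2)"
    using integrable_torus_shift[of "\<lambda>x. (cmod (f x))\<^sup>2" h] assms L2_integrable_sq[OF assms] by simp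
qed (rule measurable_compose[OF _ L2_borel[OF assms]], simp)

section \<open>The inner product of L2\<close>

definition ip :: "(real^'d::finite \<Rightarrow> complex) \<Rightarrow> (real^'d \<Rightarrow> complex) \<Rightarrow> complex" where
  "ip f g = (\<integral>x. f x * cnj (g x) \<partial>torus)"

lemma cnj_measurable [measurable]: "cnj \<in> borel_measurable borel"
  by (intro borel_measurable_continuous_onI continuous_intros)

lemma ip_integrable:
  assumes "f \<in> L2_torus" "g \<in> L2_torus"
  shows "integrable torus (\<lambda>x. f x * cnj (g x))"
  by (rule Bochner_Integration.integrable_bound[OF L2_integrable_norm_mult[OF assms]])
    (use assms in \<open>auto simp: norm_mult\<close>)

lemma L2_integrable: "f \<in> L2_torus \<Longrightarrow> integrable torus f"
  using ip_integrable[of f "\<lambda>_. 1"] by simp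

lemma L2_norm_nonneg [simp]: "0 \<le> L2_norm f"
  by (simp add: L2_norm_def)

lemma L2_norm_sq: "(L2_norm f)\<^sup>2 = (\<integral>x. (cmod (f x))\<^sup>2 \<partial>torus)"
  by (simp add: L2_norm_def)

lemma ip_self: "ip f f = of_real ((L2_norm f)\<^sup>2)"
proof -
  have "ip f f = (\<integral>x. of_real ((cmod (f x))\<^sup>2) \<partial>torus)"
    unfolding ip_def by (intro Bochner_Integration.integral_cong refl) (simp add: complex_norm_square[symmetric])
  then show ?thesis by (simp add: L2_norm_sq del: of_real_power)
qed

lemma L2_cauchy_schwarz:
  assumes f: "f \<in> L2_torus" and g: "g \<in> L2_torus"
  shows "(\<integral>x. cmod (f x) * cmod (g x) \<partial>torus) \<le> L2_norm f * L2_norm g"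
proof -
  let ?I = "\<integral>x. cmod (f x) * cmod (g x) \<partial>torus"
  have [measurable]: "f \<in> borel_measurable borel" "g \<in> borel_measurable borel"
    using f g by (auto dest: L2_borel)
  have nonneg: "0 \<le> ?I" by (intro integral_nonneg_AE) auto
  have sq: "(\<integral>\<^sup>+x. (ennreal (cmod (f x)))\<^sup>2 \<partial>torus) = ennreal ((L2_norm f)\<^sup>2)" if "f \<in> L2_torus" for f :: "real^'a \<Rightarrow> complex"
    unfolding L2_norm_sq
    by (subst nn_integral_eq_integral[symmetric]) (auto simp: ennreal_power L2_integrable_sq[OF that])
  have "(\<integral>\<^sup>+x. ennreal (cmod (f x)) * ennreal (cmod (g x)) \<partial>torus) = ennreal ?I"
    by (subst nn_integral_eq_integral[symmetric]) (auto simp: ennreal_mult L2_integrable_norm_mult f g)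
  with Cauchy_Schwarz_nn_integral[of "\<lambda>x. ennreal (cmod (f x))" torus "\<lambda>x. ennreal (cmod (g x))"]
  have "(ennreal ?I)\<^sup>2 \<le> ennreal ((L2_norm f)\<^sup>2) * ennreal ((L2_norm g)\<^sup>2)"
    by (simp add: sq f g)
  then have "ennreal (?I\<^sup>2) \<le> ennreal ((L2_norm f * L2_norm g)\<^sup>2)"
    using nonneg by (simp add: ennreal_power ennreal_mult[symmetric] power_mult_distrib)
  then have "?I\<^sup>2 \<le> (L2_norm f * L2_norm g)\<^sup>2"
    by (simp add: ennreal_le_iff)
  then show ?thesis by (rule power2_le_imp_le) simp
qed

lemma norm_ip_le:
  assumes "f \<in> L2_torus" "g \<in> L2_torus"
  shows "cmod (ip f g) \<le> L2_norm f * L2_norm g"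
proof -
  have "cmod (ip f g) \<le> (\<integral>x. cmod (f x * cnj (g x)) \<partial>torus)"
    unfolding ip_def by (rule integral_norm_bound)
  also have "\<dots> = (\<integral>x. cmod (f x) * cmod (g x) \<partial>torus)" by (simp add: norm_mult)
  also have "\<dots> \<le> L2_norm f * L2_norm g" by (rule L2_cauchy_schwarz[OF assms])
  finally show ?thesis .
qed

lemma ip_cnj: "ip g f = cnj (ip f g)"
  unfolding ip_def Bochner_Integration.integral_cnj[symmetric] by (simp add: mult.commute)

lemma ip_add_left:
  assumes "f \<in> L2_torus" "g \<in> L2_torus" "h \<in> L2_torus"
  shows "ip (\<lambda>x. f x + g x) h = ip f h + ip g h"
  unfolding ip_def using assms
  by (simp add: distrib_right ip_integrable)

lemma ip_diff_left:
  assumes "f \<in> L2_torus" "g \<in> L2_torus" "h \<in> L2_torus"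
  shows "ip (\<lambda>x. f x - g x) h = ip f h - ip g h"
  unfolding ip_def using assms
  by (simp add: left_diff_distrib ip_integrable)

lemma ip_cmult_left: "ip (\<lambda>x. c * f x) h = c * ip f h"
  unfolding ip_def by (simp add: mult.assoc)

lemma ip_add_right:
  assumes "f \<in> L2_torus" "g \<in> L2_torus" "h \<in> L2_torus"
  shows "ip h (\<lambda>x. f x + g x) = ip h f + ip h g"
  using assms by (simp add: ip_cnj[of h] ip_add_left)

lemma ip_diff_right:
  assumes "f \<in> L2_torus" "g \<in> L2_torus" "h \<in> L2_torus"
  shows "ip h (\<lambda>x. f x - g x) = ip h f - ip h g"
  using assms by (simp add: ip_cnj[of h] ip_diff_left)

lemma ip_sum_left:
  assumes "finite I" "\<And>i. i \<in> I \<Longrightarrow> f i \<in> L2_torus" "h \<in> L2_torus"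
  shows "ip (\<lambda>x. \<Sum>i\<in>I. f i x) h = (\<Sum>i\<in>I. ip (f i) h)"
  using assms by (induction I rule: finite_induct) (auto simp: ip_add_left L2_sum, simp add: ip_def)

lemma ip_sum_right:
  assumes "finite I" "\<And>i. i \<in> I \<Longrightarrow> f i \<in> L2_torus" "h \<in> L2_torus"
  shows "ip h (\<lambda>x. \<Sum>i\<in>I. f i x) = (\<Sum>i\<in>I. ip h (f i))"
  using assms by (simp add: ip_cnj[of h] ip_sum_left)

lemma L2_norm_sq_add:
  assumes "f \<in> L2_torus" "g \<in> L2_torus"
  shows "(L2_norm (\<lambda>x. f x + g x))\<^sup>2 = (L2_norm f)\<^sup>2 + 2 * Re (ip f g) + (L2_norm g)\<^sup>2"
proof -
  have "complex_of_real ((L2_norm (\<lambda>x. f x + g x))\<^sup>2)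
    = of_real ((L2_norm f)\<^sup>2) + (ip f g + cnj (ip f g)) + of_real ((L2_norm g)\<^sup>2)"
    unfolding ip_self[symmetric] using assms
    by (simp add: ip_add_left ip_add_right L2_add ip_cnj[of g f])
  also have "\<dots> = of_real ((L2_norm f)\<^sup>2 + 2 * Re (ip f g) + (L2_norm g)\<^sup>2)"
    by (simp add: complex_add_cnj)
  finally show ?thesis using of_real_eq_iff by blast
qed

lemma L2_norm_triangle:
  assumes "f \<in> L2_torus" "g \<in> L2_torus"
  shows "L2_norm (\<lambda>x. f x + g x) \<le> L2_norm f + L2_norm g"
proof (rule power2_le_imp_le)
  have "Re (ip f g) \<le> L2_norm f * L2_norm g"
    using norm_ip_le[OF assms] complex_Re_le_cmod order_trans by blast
  then show "(L2_norm (\<lambda>x. f x + g x))\<^sup>2 \<le> (L2_norm f + L2_norm g)\<^sup>2"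
    by (simp add: L2_norm_sq_add[OF assms] power2_sum)
qed simp

lemma L2_norm_minus_commute: "L2_norm (\<lambda>x. f x - g x) = L2_norm (\<lambda>x. g x - f x)"
  unfolding L2_norm_def by (simp add: norm_minus_commute)

lemma L2_norm_diff_le:
  assumes "f \<in> L2_torus" "g \<in> L2_torus"
  shows "\<bar>L2_norm f - L2_norm g\<bar> \<le> L2_norm (\<lambda>x. f x - g x)"
proof -
  have "L2_norm f \<le> L2_norm (\<lambda>x. f x - g x) + L2_norm g"
    using L2_norm_triangle[OF L2_diff[OF assms] assms(2)] by simp
  moreover have "L2_norm g \<le> L2_norm (\<lambda>x. g x - f x) + L2_norm f"
    using L2_norm_triangle[OF L2_diff[OF assms(2,1)] assms(1)] by simp
  ultimately show ?thesis using L2_norm_minus_commute[of f g] by linarith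
qed

lemma L2_norm_mult_bounded:
  assumes f: "f \<in> L2_torus" and a: "periodic a" "a \<in> borel_measurable borel"
    and b: "AE x in torus. cmod (a x) \<le> B" and "0 \<le> B"
  shows "L2_norm (\<lambda>x. a x * f x) \<le> B * L2_norm f"
proof (rule power2_le_imp_le)
  have "(L2_norm (\<lambda>x. a x * f x))\<^sup>2 \<le> (\<integral>x. B\<^sup>2 * (cmod (f x))\<^sup>2 \<partial>torus)"
    unfolding L2_norm_sq
  proof (rule integral_mono_AE)
    show "integrable torus (\<lambda>x. (cmod (a x * f x))\<^sup>2)"
      by (intro L2_integrable_sq L2_mult_bounded[OF f a b])
    show "integrable torus (\<lambda>x. B\<^sup>2 * (cmod (f x))\<^sup>2)"
      by (intro integrable_mult_right L2_integrable_sq f)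
    show "AE x in torus. (cmod (a x * f x))\<^sup>2 \<le> B\<^sup>2 * (cmod (f x))\<^sup>2"
      using b by eventually_elim (auto simp: norm_mult power_mult_distrib intro!: mult_right_mono power_mono)
  qed
  then show "(L2_norm (\<lambda>x. a x * f x))\<^sup>2 \<le> (B * L2_norm f)\<^sup>2"
    by (simp add: L2_norm_sq[symmetric] power_mult_distrib)
qed (use assms in simp)

lemma L2_norm_shift:
  assumes "f \<in> L2_torus" shows "L2_norm (\<lambda>x. f (x + h)) = L2_norm f"
proof -
  have "periodic (\<lambda>x. (cmod (f x))\<^sup>2)" using L2_periodic[OF assms] by (simp add: periodic_def)
  then show ?thesis
    unfolding L2_norm_def
    using integral_torus_shift[of "\<lambda>x. (cmod (f x))\<^sup>2" h] assms by simp
qed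

section \<open>Fourier coefficients\<close>

lemma fourier_eq_ip: "fourier f k = ip f (character k)"
  by (simp add: fourier_def ip_def character_minus)

lemma integrable_mult_character:
  fixes f :: "real^'d::finite \<Rightarrow> complex"
  assumes "integrable torus f"
  shows "integrable torus (\<lambda>x. f x * character k x)"
  by (rule Bochner_Integration.integrable_bound[OF assms])
    (use assms in \<open>auto simp: norm_mult\<close>)

lemma fourier_diff:
  "integrable torus f \<Longrightarrow> integrable torus g \<Longrightarrow> fourier (\<lambda>x. f x - g x) k = fourier f k - fourier g k"
  unfolding fourier_def by (simp add: left_diff_distrib integrable_mult_character)

lemma fourier_cmult: "fourier (\<lambda>x. c * f x) k = c * fourier f k"
  unfolding fourier_def by (simp add: mult.assoc)

lemma fourier_sum:
  "(\<And>i. i \<in> I \<Longrightarrow> integrable torus (f i)) \<Longrightarrow> fourier (\<lambda>x. \<Sum>i\<in>I. f i x) k = (\<Sum>i\<in>I. fourier (f i) k)"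
  unfolding fourier_def by (simp add: sum_distrib_right integrable_mult_character)

lemma fourier_mult_character: "fourier (\<lambda>x. character l x * f x) k = fourier f (k - l)"
proof -
  have "character (- (k - l)) x = character l x * character (- k) x" for x
    by (simp add: character_add[symmetric])
  then show ?thesis by (simp add: fourier_def mult_ac)
qed

lemma fourier_character: "fourier (character l) k = (if k = l then 1 else 0)"
proof -
  have "fourier (character l) k = (\<integral>x. character (l - k) x \<partial>torus)"
    unfolding fourier_def
    by (simp add: character_add[symmetric])
  then show ?thesis by (simp add: integral_character)
qed

lemma fourier_shift:
  assumes "periodic f" "f \<in> borel_measurable borel"
  shows "fourier (\<lambda>x. f (x + h)) k = character k h * fourier f k"
proof -
  have "fourier (\<lambda>x. f (x + h)) k
      = (\<integral>x. character k h * (f (x + h) * character (- k) (x + h)) \<partial>torus)"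
    unfolding fourier_def
    by (intro Bochner_Integration.integral_cong refl) (simp add: character_shift character_minus mult_ac)
  also have "\<dots> = character k h * (\<integral>x. f (x + h) * character (- k) (x + h) \<partial>torus)"
    by (rule integral_mult_right_zero)
  also have "(\<integral>x. f (x + h) * character (- k) (x + h) \<partial>torus) = (\<integral>x. f x * character (- k) x \<partial>torus)"
  proof (rule integral_torus_shift[where f="\<lambda>x. f x * character (- k) x"])
    show "periodic (\<lambda>x. f x * character (- k) x)"
      using assms(1) periodic_character[of "-k"] by (simp add: periodic_def)
    show "(\<lambda>x. f x * character (- k) x) \<in> borel_measurable torus"
      using assms(2) by measurable
  qed
  finally show ?thesis by (simp add: fourier_def)
qed

text \<open>Applied to the density \<open>|f|\<close>, the density theorem approximates the conjugate sign of \<open>f\<close>.\<close>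

lemma fourier_unique:
  assumes f: "integrable torus f" and zero: "\<And>k. fourier f k = 0"
  shows "AE x in torus. f x = 0"
proof -
  have m [measurable]: "f \<in> borel_measurable torus" using f by simp
  define \<mu> where "\<mu> = density torus (\<lambda>x. ennreal (cmod (f x)))"
  have fin: "(\<integral>\<^sup>+x. ennreal (cmod (f x)) \<partial>torus) < \<infinity>"
    using f by (simp add: integrable_iff_bounded)
  have "emeasure \<mu> (space \<mu>) = (\<integral>\<^sup>+x. ennreal (cmod (f x)) * indicator (space torus) x \<partial>torus)"
    unfolding \<mu>_def by (simp only: space_density) (rule emeasure_density, auto simp del: space_torus)
  also have "\<dots> = (\<integral>\<^sup>+x. ennreal (cmod (f x)) \<partial>torus)"
    by (rule nn_integral_cong) simp
  finally have "finite_measure \<mu>"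
    using fin by (intro finite_measureI) simp
  then interpret mu: torus_finite_measure \<mu>
    by (rule torus_finite_measure.intro) (unfold_locales, simp add: \<mu>_def)
  define s where "s x = cnj (sgn (f x))" for x
  have s [measurable]: "s \<in> borel_measurable torus" unfolding s_def by measurable
  have "mu.approx s"
  proof (rule mu.trig_poly_dense)
    show "s \<in> borel_measurable \<mu>" by (simp add: mu.measurable_eq s)
    show "integrable \<mu> (\<lambda>x. (cmod (s x))\<^sup>2)"
      by (rule mu.integrable_const_bound[of _ 1])
        (auto simp: s_def norm_sgn mu.measurable_eq)
  qed
  have orth: "(\<integral>x. f x * p x \<partial>torus) = 0" if "trig_poly p" for p
  proof -
    obtain K a where K: "finite K" "p = (\<lambda>x. \<Sum>k\<in>K. a k * character k x)"
      using \<open>trig_poly p\<close> by (rule trig_polyE)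
    have "(\<integral>x. f x * p x \<partial>torus) = (\<integral>x. (\<Sum>k\<in>K. a k * (f x * character k x)) \<partial>torus)"
      by (simp add: K(2) sum_distrib_left mult_ac)
    also have "\<dots> = (\<Sum>k\<in>K. a k * (\<integral>x. f x * character k x \<partial>torus))"
      by (subst Bochner_Integration.integral_sum) (auto intro!: integrable_mult_right integrable_mult_character f)
    also have "\<dots> = 0" using zero[of "- k" for k] by (simp add: fourier_def)
    finally show ?thesis .
  qed
  have small: "(\<integral>x. cmod (f x) \<partial>torus) \<le> e" if "0 < e" for e
  proof -
    let ?C = "\<integral>x. cmod (f x) \<partial>torus"
    have C: "0 \<le> ?C" by simp
    \<comment> \<open>Young's inequality bounds |f| |s - p| by \<delta>/2 |f| + |f| |s - p|^2 / (2
      \<delta>). With this \<delta>, and \<open>p\<close> chosen to precision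
      \<open>\<delta> * e\<close>, each of the two terms contributes at most e/2; the summand 1
      avoids a vanishing denominator.\<close>
    define \<delta> where "\<delta> = e / (1 + ?C)"
    have \<delta>: "0 < \<delta>" using that C by (simp add: \<delta>_def add_pos_nonneg)
    obtain p where p: "trig_poly p" "p \<in> borel_measurable \<mu>"
      "(\<integral>\<^sup>+x. ennreal ((cmod (s x - p x))\<^sup>2) \<partial>\<mu>) < ennreal (\<delta> * e)"
      by (rule mu.approxE[OF \<open>mu.approx s\<close>, of "\<delta> * e"]) (use \<delta> \<open>0 < e\<close> in simp)
    have [measurable]: "p \<in> borel_measurable borel" by (rule trig_poly_borel[OF p(1)])
    obtain B where B: "\<And>x. cmod (p x) \<le> B" using trig_poly_bounded[OF p(1)] by blast
    have B0: "0 \<le> B" using B[of 0] norm_ge_zero[of "p 0"] by linarith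
    have sb: "cmod (s x) \<le> 1" for x by (simp add: s_def norm_sgn)
    have spb: "cmod (s x - p x) \<le> 1 + B" for x
      using norm_triangle_ineq4[of "s x" "p x"] sb[of x] B[of x] by linarith
    have int1: "integrable torus (\<lambda>x. cmod (f x) * (cmod (s x - p x))\<^sup>2)"
      by (rule Bochner_Integration.integrable_bound[where f="\<lambda>x. (1 + B)\<^sup>2 *\<^sub>R f x"])
        (use f in \<open>auto simp: norm_mult mult.commute intro!: mult_left_mono power_mono spb\<close>)
    have int2: "integrable torus (\<lambda>x. f x * (s x - p x))"
      by (rule Bochner_Integration.integrable_bound[where f="\<lambda>x. (1 + B) *\<^sub>R f x"])
        (use f B0 spb in \<open>auto simp: norm_mult mult.commute[of _ "cmod (f _)"] intro!: mult_left_mono\<close>)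
    have int3: "integrable torus (\<lambda>x. f x * p x)"
      by (rule Bochner_Integration.integrable_bound[where f="\<lambda>x. B *\<^sub>R f x"])
        (use f B0 B in \<open>auto simp: norm_mult mult.commute[of _ "cmod (f _)"] intro!: mult_left_mono\<close>)
    have "(\<integral>\<^sup>+x. ennreal ((cmod (s x - p x))\<^sup>2) \<partial>\<mu>)
      = (\<integral>\<^sup>+x. ennreal (cmod (f x) * (cmod (s x - p x))\<^sup>2) \<partial>torus)"
      unfolding \<mu>_def by (subst nn_integral_density) (auto simp: ennreal_mult)
    also have "\<dots> = ennreal (\<integral>x. cmod (f x) * (cmod (s x - p x))\<^sup>2 \<partial>torus)"
      by (rule nn_integral_eq_integral[OF int1]) auto
    finally have "ennreal (\<integral>x. cmod (f x) * (cmod (s x - p x))\<^sup>2 \<partial>torus) < ennreal (\<delta> * e)"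
      using p(3) by simp
    then have le: "(\<integral>x. cmod (f x) * (cmod (s x - p x))\<^sup>2 \<partial>torus) \<le> \<delta> * e"
      using \<delta> that by (simp add: ennreal_less_iff)
    have eqs: "f x * s x = of_real (cmod (f x))" for x
      by (cases "f x = 0") (auto simp: s_def sgn_div_norm complex_norm_square[symmetric] scaleR_conv_of_real power2_eq_square field_simps)
    have "complex_of_real ?C = (\<integral>x. f x * s x \<partial>torus)"
      by (simp add: eqs)
    also have "\<dots> = (\<integral>x. f x * (s x - p x) + f x * p x \<partial>torus)"
      by (simp add: algebra_simps)
    also have "\<dots> = (\<integral>x. f x * (s x - p x) \<partial>torus)"
      using int2 int3 orth[OF p(1)] by simp
    finally have "?C = cmod (\<integral>x. f x * (s x - p x) \<partial>torus)"
      using C by (metis norm_of_real abs_of_nonneg)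
    also have "\<dots> \<le> (\<integral>x. cmod (f x * (s x - p x)) \<partial>torus)" by (rule integral_norm_bound)
    also have "\<dots> \<le> (\<integral>x. \<delta> / 2 * cmod (f x) + 1 / (2 * \<delta>) * (cmod (f x) * (cmod (s x - p x))\<^sup>2) \<partial>torus)"
    proof (rule integral_mono)
      fix x
      have "2 * cmod (s x - p x) * \<delta> \<le> \<delta>\<^sup>2 + (cmod (s x - p x))\<^sup>2"
        using sum_squares_bound[of "cmod (s x - p x)" \<delta>] by simp
      then have "cmod (s x - p x) \<le> \<delta> / 2 + 1 / (2 * \<delta>) * (cmod (s x - p x))\<^sup>2"
        using \<delta> by (simp add: field_simps power2_eq_square)
      then have "cmod (f x) * cmod (s x - p x) \<le> cmod (f x) * (\<delta> / 2 + 1 / (2 * \<delta>) * (cmod (s x - p x))\<^sup>2)"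
        by (intro mult_left_mono) auto
      then show "cmod (f x * (s x - p x)) \<le> \<delta> / 2 * cmod (f x) + 1 / (2 * \<delta>) * (cmod (f x) * (cmod (s x - p x))\<^sup>2)"
        unfolding norm_mult by (simp add: distrib_left mult.commute)
    qed (use int1 int2 f in auto)
    also have "\<dots> = \<delta> / 2 * ?C + 1 / (2 * \<delta>) * (\<integral>x. cmod (f x) * (cmod (s x - p x))\<^sup>2 \<partial>torus)"
      using int1 f by simp
    also have "\<dots> \<le> \<delta> / 2 * ?C + 1 / (2 * \<delta>) * (\<delta> * e)"
      using le \<delta> by (intro add_left_mono mult_left_mono) auto
    also have "\<dots> = \<delta> * ?C / 2 + e / 2" using \<delta> by simp
    also have "\<delta> * ?C \<le> \<delta> * (1 + ?C)" using \<delta> by simp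
    also have "\<delta> * (1 + ?C) = e"
    proof -
      have "1 + ?C \<noteq> 0" using C by linarith
      then show ?thesis unfolding \<delta>_def by simp
    qed
    finally show ?thesis by simp
  qed
  have "(\<integral>x. cmod (f x) \<partial>torus) = 0"
    using small field_le_epsilon[of "\<integral>x. cmod (f x) \<partial>torus" 0] by (simp add: antisym)
  then have "AE x in torus. cmod (f x) = 0"
    using f by (subst integral_nonneg_eq_0_iff_AE[symmetric]) auto
  then show ?thesis by simp
qed

subsection \<open>Parseval's identity and high-frequency projections\<close>

definition psum :: "(int^'d::finite) set \<Rightarrow> (real^'d \<Rightarrow> complex) \<Rightarrow> real^'d \<Rightarrow> complex" where
  "psum K f x = (\<Sum>k\<in>K. fourier f k * character k x)"

lemma trig_poly_psum: "finite K \<Longrightarrow> trig_poly (psum K f)"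
  unfolding psum_def[abs_def] trig_poly_def by blast

lemma L2_psum [intro]: "finite K \<Longrightarrow> psum K f \<in> L2_torus"
  by (intro L2_trig_poly trig_poly_psum)

lemma ip_character_left: "ip (character k) f = cnj (fourier f k)"
  by (simp add: fourier_eq_ip ip_cnj[of "character k"])

lemma ip_psum_left:
  assumes "finite K" "g \<in> L2_torus"
  shows "ip (psum K f) g = (\<Sum>k\<in>K. fourier f k * cnj (fourier g k))"
  unfolding psum_def[abs_def] using assms
  by (subst ip_sum_left) (auto simp: ip_cmult_left ip_character_left L2_cmult)

lemma fourier_psum:
  assumes "finite K"
  shows "fourier (psum K f) k = (if k \<in> K then fourier f k else 0)"
  unfolding psum_def[abs_def] using assms
  by (subst fourier_sum)
    (auto simp: fourier_cmult fourier_character L2_integrable if_distrib[of "(*) _"] cong: if_cong)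

lemma L2_norm_psum:
  assumes "finite K"
  shows "(L2_norm (psum K f))\<^sup>2 = (\<Sum>k\<in>K. (cmod (fourier f k))\<^sup>2)"
proof -
  have "complex_of_real ((L2_norm (psum K f))\<^sup>2) = (\<Sum>k\<in>K. fourier f k * cnj (fourier (psum K f) k))"
    unfolding ip_self[symmetric] using assms by (simp add: ip_psum_left L2_psum)
  also have "\<dots> = of_real (\<Sum>k\<in>K. (cmod (fourier f k))\<^sup>2)"
    using assms by (simp add: fourier_psum complex_norm_square[symmetric])
  finally show ?thesis using of_real_eq_iff by blast
qed

lemma ip_diff_psum:
  assumes "finite K" "f \<in> L2_torus" "g \<in> L2_torus"
  shows "ip (\<lambda>x. f x - psum K f x) (psum K g) = 0"
proof -
  have "ip (\<lambda>x. f x - psum K f x) (psum K g) = cnj (ip (psum K g) (\<lambda>x. f x - psum K f x))"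
    by (rule ip_cnj)
  also have "ip (psum K g) (\<lambda>x. f x - psum K f x)
    = (\<Sum>k\<in>K. fourier g k * cnj (fourier (\<lambda>x. f x - psum K f x) k))"
    using assms by (intro ip_psum_left) auto
  also have "\<dots> = 0"
    using assms by (intro sum.neutral) (auto simp: fourier_diff L2_integrable L2_psum fourier_psum)
  finally show ?thesis by simp
qed

lemma bessel_eq:
  assumes "finite K" "f \<in> L2_torus"
  shows "(L2_norm (\<lambda>x. f x - psum K f x))\<^sup>2 = (L2_norm f)\<^sup>2 - (\<Sum>k\<in>K. (cmod (fourier f k))\<^sup>2)"
proof -
  have "(L2_norm (\<lambda>x. (f x - psum K f x) + psum K f x))\<^sup>2
    = (L2_norm (\<lambda>x. f x - psum K f x))\<^sup>2 + (L2_norm (psum K f))\<^sup>2"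
    using assms by (subst L2_norm_sq_add) (auto simp: ip_diff_psum)
  then show ?thesis using assms by (simp add: L2_norm_psum)
qed

lemma bessel_le:
  assumes "finite K" "f \<in> L2_torus"
  shows "(\<Sum>k\<in>K. (cmod (fourier f k))\<^sup>2) \<le> (L2_norm f)\<^sup>2"
  using bessel_eq[OF assms] by (metis diff_ge_0_iff_ge zero_le_power2)

text \<open>Partial sums are best approximations. Once \<open>K\<close> contains the frequencies of
  a trigonometric polynomial \<open>p\<close> close to \<open>f\<close>, \<open>psum K\<close>
  reproduces \<open>p\<close>, and f - p splits orthogonally into the remainder f -
  \<open>psum K f\<close> and a partial sum; so the remainder is no larger than f - p.\<close>

lemma psum_tendsto:
  assumes f: "f \<in> L2_torus"
  shows "((\<lambda>K. L2_norm (\<lambda>x. f x - psum K f x)) \<longlongrightarrow> 0) (finite_subsets_at_top UNIV)"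
proof (rule tendstoI)
  fix e :: real assume e: "0 < e"
  interpret T: torus_finite_measure "torus :: (real^'a) measure"
    by unfold_locales simp
  have "T.approx f"
    using f by (intro T.trig_poly_dense) (auto simp: L2_integrable_sq dest: L2_borel)
  then obtain p where p: "trig_poly p" "(\<integral>\<^sup>+x. ennreal ((cmod (f x - p x))\<^sup>2) \<partial>torus) < ennreal (e\<^sup>2)"
    by (rule T.approxE[of _ "e\<^sup>2"]) (use e in auto)
  have pL: "p \<in> L2_torus" by (rule L2_trig_poly[OF p(1)])
  have "(\<integral>\<^sup>+x. ennreal ((cmod (f x - p x))\<^sup>2) \<partial>torus) = ennreal ((L2_norm (\<lambda>x. f x - p x))\<^sup>2)"
    unfolding L2_norm_sq by (rule nn_integral_eq_integral) (auto intro!: L2_integrable_sq L2_diff f pL)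
  then have lt: "(L2_norm (\<lambda>x. f x - p x))\<^sup>2 < e\<^sup>2"
    using p(2) by (simp add: ennreal_less_iff)
  obtain K0 a where K0: "finite K0" "p = (\<lambda>x. \<Sum>k\<in>K0. a k * character k x)"
    using p(1) by (rule trig_polyE)
  have "L2_norm (\<lambda>x. f x - psum K f x) < e" if K: "finite K" "K0 \<subseteq> K" for K
  proof -
    have fp: "fourier p k = (if k \<in> K0 then a k else 0)" for k
      unfolding K0(2) using K0(1)
      by (subst fourier_sum) (auto simp: fourier_cmult fourier_character L2_integrable if_distrib[of "(*) _"] L2_cmult cong: if_cong)
    have "p x = psum K p x" for x
      unfolding psum_def fp using K by (subst K0(2)) (auto intro!: sum.mono_neutral_cong_left)
    then have pp: "p = psum K p" by auto
    have "(\<lambda>x. f x - p x) = (\<lambda>x. (f x - psum K f x) + psum K (\<lambda>x. f x - p x) x)"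
    proof
      fix x
      have "psum K (\<lambda>x. f x - p x) x = psum K f x - psum K p x"
        unfolding psum_def using f pL by (simp add: fourier_diff L2_integrable left_diff_distrib sum_subtractf)
      moreover have "p x = psum K p x" using pp by metis
      ultimately show "f x - p x = (f x - psum K f x) + psum K (\<lambda>x. f x - p x) x" by simp
    qed
    then have "L2_norm (\<lambda>x. f x - p x) = L2_norm (\<lambda>x. (f x - psum K f x) + psum K (\<lambda>x. f x - p x) x)"
      by (rule arg_cong)
    then have "(L2_norm (\<lambda>x. f x - p x))\<^sup>2
      = (L2_norm (\<lambda>x. f x - psum K f x))\<^sup>2 + (L2_norm (psum K (\<lambda>x. f x - p x)))\<^sup>2"
      using K f pL L2_norm_sq_add[of "\<lambda>x. f x - psum K f x" "psum K (\<lambda>x. f x - p x)"]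
      by (auto simp: ip_diff_psum L2_psum L2_diff)
    then have "(L2_norm (\<lambda>x. f x - psum K f x))\<^sup>2 < e\<^sup>2"
      using lt by (smt (verit) zero_le_power2)
    then show ?thesis using e power2_less_imp_less by fastforce
  qed
  then show "\<forall>\<^sub>F K in finite_subsets_at_top UNIV. dist (L2_norm (\<lambda>x. f x - psum K f x)) 0 < e"
    unfolding eventually_finite_subsets_at_top using K0(1)
    by (intro exI[of _ K0]) auto
qed

lemma ip_psum_tendsto:
  assumes f: "f \<in> L2_torus" and g: "g \<in> L2_torus"
  shows "((\<lambda>K. ip (psum K f) g) \<longlongrightarrow> ip f g) (finite_subsets_at_top UNIV)"
proof (rule LIM_zero_cancel, rule Lim_null_comparison)
  have ev: "\<forall>\<^sub>F K in finite_subsets_at_top UNIV. finite (K :: (int^'a) set)"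
    by (auto simp: eventually_finite_subsets_at_top)
  show "\<forall>\<^sub>F K in finite_subsets_at_top UNIV.
      cmod (ip (psum K f) g - ip f g) \<le> L2_norm (\<lambda>x. f x - psum K f x) * L2_norm g"
    using ev
  proof eventually_elim
    case (elim K)
    have "ip (psum K f) g - ip f g = - ip (\<lambda>x. f x - psum K f x) g"
      using elim f g by (simp add: ip_diff_left L2_psum)
    then show ?case using norm_ip_le[OF L2_diff[OF f L2_psum[OF elim]] g] by simp
  qed
  show "((\<lambda>K. L2_norm (\<lambda>x. f x - psum K f x) * L2_norm g) \<longlongrightarrow> 0) (finite_subsets_at_top UNIV)"
    using tendsto_mult_left_zero[OF psum_tendsto[OF f]] .
qed

text \<open>The series converges along the net of all finite sets of frequencies, so later
  rearrangements of sums over modes need no order on the lattice.\<close>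

theorem parseval:
  assumes f: "f \<in> L2_torus" and g: "g \<in> L2_torus"
  shows "((\<lambda>k. fourier f k * cnj (fourier g k)) has_sum ip f g) UNIV"
  unfolding has_sum_def
proof (rule Lim_transform_eventually[OF ip_psum_tendsto[OF f g]])
  show "\<forall>\<^sub>F K in finite_subsets_at_top UNIV. ip (psum K f) g = (\<Sum>k\<in>K. fourier f k * cnj (fourier g k))"
    using g by (auto simp: eventually_finite_subsets_at_top ip_psum_left)
qed

lemma parseval_norm:
  assumes "f \<in> L2_torus"
  shows "((\<lambda>k. (cmod (fourier f k))\<^sup>2) has_sum (L2_norm f)\<^sup>2) UNIV"
proof -
  have "((\<lambda>k. complex_of_real ((cmod (fourier f k))\<^sup>2)) has_sum of_real ((L2_norm f)\<^sup>2)) UNIV"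
    using parseval[OF assms assms] by (simp add: ip_self complex_norm_square del: of_real_power)
  then show ?thesis by (simp only: has_sum_of_real_iff)
qed

lemma parseval_abs_summable:
  assumes "f \<in> L2_torus" "g \<in> L2_torus"
  shows "(\<lambda>k. cmod (fourier f k) * cmod (fourier g k)) summable_on UNIV"
    and "(\<Sum>\<^sub>\<infinity>k. cmod (fourier f k) * cmod (fourier g k)) \<le> L2_norm f * L2_norm g"
proof -
  have bound: "(\<Sum>k\<in>K. cmod (fourier f k) * cmod (fourier g k)) \<le> L2_norm f * L2_norm g"
    if "finite K" for K
  proof -
    have "(\<Sum>k\<in>K. cmod (fourier f k) * cmod (fourier g k))
      \<le> L2_set (\<lambda>k. cmod (fourier f k)) K * L2_set (\<lambda>k. cmod (fourier g k)) K"
      using L2_set_mult_ineq[of "\<lambda>k. cmod (fourier f k)" "\<lambda>k. cmod (fourier g k)" K] by simp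
    also have "\<dots> \<le> L2_norm f * L2_norm g"
    proof (rule mult_mono)
      show "L2_set (\<lambda>k. cmod (fourier f k)) K \<le> L2_norm f"
        unfolding L2_set_def by (rule real_le_lsqrt) (use bessel_le[OF that assms(1)] in \<open>auto simp: sum_nonneg\<close>)
      show "L2_set (\<lambda>k. cmod (fourier g k)) K \<le> L2_norm g"
        unfolding L2_set_def by (rule real_le_lsqrt) (use bessel_le[OF that assms(2)] in \<open>auto simp: sum_nonneg\<close>)
    qed auto
    finally show ?thesis .
  qed
  show s: "(\<lambda>k. cmod (fourier f k) * cmod (fourier g k)) summable_on UNIV"
    by (rule nonneg_bounded_partial_sums_imp_summable_on) 
      (auto simp: eventually_finite_subsets_at_top intro!: exI[of _ "{}"] bound)
  show "(\<Sum>\<^sub>\<infinity>k. cmod (fourier f k) * cmod (fourier g k)) \<le> L2_norm f * L2_norm g"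
    by (rule infsum_le_finite_sums[OF s]) (use bound in auto)
qed

text \<open>\<open>Pi_ge r f\<close> is a chosen function, of which only the norm is used. The norm
  does not depend on the choice, because every candidate is the L2 limit of the same partial sums;
  the candidate f minus its finite low-frequency part shows that the choice is not void and computes
  the norm.\<close>

lemma L2_norm_Pi_ge:
  assumes f: "f \<in> L2_torus"
  shows "(L2_norm (Pi_ge r f))\<^sup>2
    = (L2_norm f)\<^sup>2 - (\<Sum>k | norm (freq k) < r. (cmod (fourier f k))\<^sup>2)"
proof -
  let ?lo = "{k :: int^'a. norm (freq k) < r}" and ?hi = "{k :: int^'a. r \<le> norm (freq k)}"
  let ?P = "\<lambda>h. h \<in> L2_torus \<and>
     ((\<lambda>K. L2_norm (\<lambda>x. h x - (\<Sum>k\<in>K. fourier f k * character k x))) \<longlongrightarrow> 0) (finite_subsets_at_top ?hi)"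
  have lo: "finite ?lo" by (rule finite_freq_ball)
  define h where "h x = f x - psum ?lo f x" for x
  have hL: "h \<in> L2_torus" unfolding h_def using f lo by auto
  \<comment> \<open>Adjoining the finitely many low frequencies to finite sets of high ones yields
    sets that eventually contain any given finite set, so the convergence of the full partial sums
    applies to them.\<close>
  have flim: "filterlim (\<lambda>K. K \<union> ?lo) (finite_subsets_at_top UNIV) (finite_subsets_at_top ?hi)"
    unfolding filterlim_iff
  proof (intro allI impI)
    fix P :: "(int^'a) set \<Rightarrow> bool" assume "eventually P (finite_subsets_at_top UNIV)"
    then obtain X where X: "finite X" "\<And>Y. finite Y \<Longrightarrow> X \<subseteq> Y \<Longrightarrow> P Y"
      unfolding eventually_finite_subsets_at_top by auto
    have "P (Y \<union> ?lo)" if "finite Y" "X \<inter> ?hi \<subseteq> Y" for Y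
      by (rule X(2)) (use that lo in auto)
    then show "\<forall>\<^sub>F K in finite_subsets_at_top ?hi. P (K \<union> ?lo)"
      unfolding eventually_finite_subsets_at_top using X(1)
      by (intro exI[of _ "X \<inter> ?hi"]) auto
  qed
  have "((\<lambda>K. L2_norm (\<lambda>x. f x - psum (K \<union> ?lo) f x)) \<longlongrightarrow> 0) (finite_subsets_at_top ?hi)"
    by (rule filterlim_compose[OF psum_tendsto[OF f] flim])
  then have "((\<lambda>K. L2_norm (\<lambda>x. h x - psum K f x)) \<longlongrightarrow> 0) (finite_subsets_at_top ?hi)"
  proof (rule Lim_transform_eventually)
    have "L2_norm (\<lambda>x. f x - psum (Y \<union> ?lo) f x) = L2_norm (\<lambda>x. h x - psum Y f x)"
      if "finite Y" "Y \<subseteq> ?hi" for Y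
    proof -
      have "psum (Y \<union> ?lo) f x = psum Y f x + psum ?lo f x" for x
        unfolding psum_def by (rule sum.union_disjoint) (use that lo in auto)
      then show ?thesis by (simp add: h_def algebra_simps)
    qed
    then show "\<forall>\<^sub>F K in finite_subsets_at_top ?hi. L2_norm (\<lambda>x. f x - psum (K \<union> ?lo) f x)
        = L2_norm (\<lambda>x. h x - psum K f x)"
      unfolding eventually_finite_subsets_at_top by (intro exI[of _ "{}"]) auto
  qed
  then have Ph: "?P h" using hL by (simp add: psum_def)
  then have PP: "?P (Pi_ge r f)"
    unfolding Pi_ge_def by (rule someI[of ?P])
  have norm_lim: "((\<lambda>K. L2_norm (psum K f)) \<longlongrightarrow> L2_norm q) (finite_subsets_at_top ?hi)" if "?P q" for q
  proof (rule LIM_zero_cancel, rule Lim_null_comparison)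
    show "((\<lambda>K. L2_norm (\<lambda>x. q x - psum K f x)) \<longlongrightarrow> 0) (finite_subsets_at_top ?hi)"
      using that by (simp add: psum_def)
    show "\<forall>\<^sub>F K in finite_subsets_at_top ?hi. norm (L2_norm (psum K f) - L2_norm q)
        \<le> L2_norm (\<lambda>x. q x - psum K f x)"
      unfolding eventually_finite_subsets_at_top
      using L2_norm_diff_le[of q "psum K f" for K] that
      by (intro exI[of _ "{}"]) (auto simp: abs_minus_commute)
  qed
  have "L2_norm (Pi_ge r f) = L2_norm h"
    by (rule tendsto_unique[OF _ norm_lim[OF PP] norm_lim[OF Ph]]) simp
  then show ?thesis using bessel_eq[OF lo f] by (simp add: h_def[abs_def])
qed

lemma fourier_cong_AE:
  assumes "f \<in> borel_measurable torus" "g \<in> borel_measurable torus" "AE x in torus. f x = g x"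
  shows "fourier f k = fourier g k"
  unfolding fourier_def by (intro integral_cong_AE) (use assms in auto)

lemma has_weak_deriv_weak_deriv:
  "has_weak_deriv j f h \<Longrightarrow> has_weak_deriv j f (weak_deriv j f)"
  unfolding weak_deriv_def by (rule someI[of "has_weak_deriv j f"])

lemma has_weak_deriv_borel:
  "has_weak_deriv j f h \<Longrightarrow> h \<in> borel_measurable borel"
  unfolding has_weak_deriv_def by (auto intro: periodic_borel_measurable)

lemma has_weak_deriv_fourier:
  "has_weak_deriv j f h \<Longrightarrow> fourier h k = 2 * pi * \<i> * of_int (k $ j) * fourier f k"
  unfolding has_weak_deriv_def by simp

lemma H1_L2: "f \<in> H1_torus \<Longrightarrow> f \<in> L2_torus"
  by (simp add: H1_torus_def)

text \<open>The chosen representative \<open>weak_deriv j f\<close> is a priori only integrable. It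
  has the same Fourier coefficients as the square-integrable derivative that membership in
  \<open>H1_torus\<close> provides, hence agrees with it almost everywhere.\<close>

lemma
  assumes "f \<in> H1_torus"
  shows L2_weak_deriv: "weak_deriv j f \<in> L2_torus"
    and fourier_weak_deriv: "fourier (weak_deriv j f) k = 2 * pi * \<i> * of_int (k $ j) * fourier f k"
proof -
  obtain h where h: "h \<in> L2_torus" "has_weak_deriv j f h"
    using assms by (auto simp: H1_torus_def)
  let ?d = "weak_deriv j f"
  have d: "has_weak_deriv j f ?d" by (rule has_weak_deriv_weak_deriv[OF h(2)])
  show fd: "fourier ?d k = 2 * pi * \<i> * of_int (k $ j) * fourier f k" for k
    by (rule has_weak_deriv_fourier[OF d])
  have [measurable]: "?d \<in> borel_measurable borel" by (rule has_weak_deriv_borel[OF d])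
  have int: "integrable torus ?d" using d by (simp add: has_weak_deriv_def)
  have "AE x in torus. ?d x - h x = 0"
    by (rule fourier_unique)
      (use int h in \<open>auto simp: L2_integrable fourier_diff fd has_weak_deriv_fourier[OF h(2)]\<close>)
  then have "AE x in torus. (cmod (?d x))\<^sup>2 \<le> (cmod (h x))\<^sup>2"
    by eventually_elim simp
  then show "?d \<in> L2_torus"
    by (intro L2_torus_bound[OF _ _ L2_integrable_sq[OF h(1)]])
      (use d in \<open>auto simp: has_weak_deriv_def\<close>)
qed

subsection \<open>Velocity fields\<close>

lemma ip_tendsto:
  assumes fn: "\<And>n. f n \<in> L2_torus" "g \<in> L2_torus" "\<And>n. fn n \<in> L2_torus" "gg \<in> L2_torus"
    and l1: "((\<lambda>n. L2_norm (\<lambda>x. f n x - g x)) \<longlongrightarrow> 0) F"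
    and l2: "((\<lambda>n. L2_norm (\<lambda>x. fn n x - gg x)) \<longlongrightarrow> 0) F"
  shows "((\<lambda>n. ip (f n) (fn n)) \<longlongrightarrow> ip g gg) F"
proof (rule LIM_zero_cancel, rule Lim_null_comparison)
  let ?a = "\<lambda>n. L2_norm (\<lambda>x. f n x - g x)" and ?b = "\<lambda>n. L2_norm (\<lambda>x. fn n x - gg x)"
  show "\<forall>\<^sub>F n in F. cmod (ip (f n) (fn n) - ip g gg) \<le> ?a n * (?b n + L2_norm gg) + L2_norm g * ?b n"
  proof (rule always_eventually, rule allI)
    fix n
    have "ip (f n) (fn n) - ip g gg = ip (\<lambda>x. f n x - g x) (fn n) + ip g (\<lambda>x. fn n x - gg x)"
      using fn by (simp add: ip_diff_left ip_diff_right)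
    also have "cmod \<dots> \<le> cmod (ip (\<lambda>x. f n x - g x) (fn n)) + cmod (ip g (\<lambda>x. fn n x - gg x))"
      by (rule norm_triangle_ineq)
    also have "\<dots> \<le> ?a n * L2_norm (fn n) + L2_norm g * ?b n"
      using fn by (intro add_mono norm_ip_le) auto
    also have "L2_norm (fn n) \<le> ?b n + L2_norm gg"
      using L2_norm_triangle[OF L2_diff[OF fn(3)[of n] fn(4)] fn(4)] by simp
    finally show "cmod (ip (f n) (fn n) - ip g gg) \<le> ?a n * (?b n + L2_norm gg) + L2_norm g * ?b n"
      by (simp add: mult_left_mono)
  qed
  have "((\<lambda>n. ?a n * (?b n + L2_norm gg) + L2_norm g * ?b n) \<longlongrightarrow> 0 * (0 + L2_norm gg) + L2_norm g * 0) F"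
    by (intro tendsto_intros l1 l2)
  then show "((\<lambda>n. ?a n * (?b n + L2_norm gg) + L2_norm g * ?b n) \<longlongrightarrow> 0) F" by simp
qed

lemma Linf_norm_AE:
  assumes "Linf_norm f < \<infinity>"
  shows "AE x in torus. norm (f x) \<le> enn2real (Linf_norm f)"
proof -
  have "AE x in torus. ennreal (norm (f x)) \<le> Linf_norm f"
    unfolding Linf_norm_def by (rule esssup_AE)
  then show ?thesis
    by eventually_elim (metis assms enn2real_mono enn2real_ennreal norm_ge_zero infinity_ennreal_def)
qed

lemma comp_fun_cnj [simp]: "cnj (comp_fun v i x) = comp_fun v i x"
  by (simp add: comp_fun_def)

lemma advection_alt: "advection v f x = (\<Sum>j\<in>UNIV. comp_fun v j x * weak_deriv j f x)"
  by (simp add: advection_def comp_fun_def)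

lemma has_sum_sum:
  fixes f :: "'i \<Rightarrow> 'a \<Rightarrow> 'b::{topological_comm_monoid_add}"
  assumes "\<And>i. i \<in> I \<Longrightarrow> (f i has_sum s i) A"
  shows "((\<lambda>x. \<Sum>i\<in>I. f i x) has_sum (\<Sum>i\<in>I. s i)) A"
  using assms by (induction I rule: infinite_finite_induct) (auto intro: has_sum_add)

locale velocity_field =
  fixes v :: "real^'d::finite \<Rightarrow> real^'d"
  assumes v_W1inf: "v \<in> W1inf_torus" and v_div: "divergence_free v"
begin

text \<open>Real-valued versions of the norms. Nothing is lost by \<open>enn2real\<close>, whose
  value at \<infinity> is 0, since all these norms are finite on \<open>W1inf_torus\<close>. In
  \<open>lip j i\<close> the first index is the component, the second the direction of the
  derivative.\<close>

definition "sup_v = enn2real (Linf_norm v)"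
definition "lip j i = enn2real (Linf_norm (weak_deriv i (comp_fun v j)))"

lemma W1inf_eq: "W1inf_norm v = ennreal (sup_v + (\<Sum>j\<in>UNIV. \<Sum>i\<in>UNIV. lip j i))"
  and fin_v: "Linf_norm v < \<infinity>" and fin_dv: "Linf_norm (weak_deriv i (comp_fun v j)) < \<infinity>"
proof -
  have fin: "W1inf_norm v < \<infinity>" using v_W1inf by (simp add: W1inf_torus_def)
  then show v: "Linf_norm v < \<infinity>" by (simp add: W1inf_norm_def)
  have "(\<Sum>i\<in>UNIV. \<Sum>j\<in>UNIV. Linf_norm (weak_deriv j (comp_fun v i))) < \<infinity>"
    using fin by (simp add: W1inf_norm_def)
  then have dv: "Linf_norm (weak_deriv i (comp_fun v j)) < \<infinity>" for i j by simp
  then show "Linf_norm (weak_deriv i (comp_fun v j)) < \<infinity>" .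
  have "Linf_norm v = ennreal sup_v" using v by (simp add: sup_v_def less_top)
  moreover have "Linf_norm (weak_deriv i (comp_fun v j)) = ennreal (lip j i)" for i j
    using dv[of i j] by (simp add: lip_def less_top)
  moreover have "0 \<le> sup_v" "0 \<le> lip j i" for i j by (simp_all add: sup_v_def lip_def)
  ultimately show "W1inf_norm v = ennreal (sup_v + (\<Sum>j\<in>UNIV. \<Sum>i\<in>UNIV. lip j i))"
    by (simp add: W1inf_norm_def sum_ennreal sum_nonneg ennreal_plus)
qed

lemma sup_v_nonneg [simp]: "0 \<le> sup_v" and lip_nonneg [simp]: "0 \<le> lip j i"
  by (simp_all add: sup_v_def lip_def)

lemma comp_periodic: "periodic (comp_fun v j)"
  using v_W1inf by (simp add: W1inf_torus_def periodic_def comp_fun_def)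

lemma comp_borel [measurable]: "comp_fun v j \<in> borel_measurable borel"
proof -
  have [measurable]: "v \<in> borel_measurable borel"
    using v_W1inf by (simp add: W1inf_torus_def)
  have [measurable]: "(\<lambda>x :: real^'d. x $ j) \<in> borel_measurable borel"
    by (intro borel_measurable_continuous_onI continuous_intros)
  show ?thesis unfolding comp_fun_def[abs_def] by measurable
qed

lemma comp_bound: "AE x in torus. cmod (comp_fun v j x) \<le> sup_v"
  using Linf_norm_AE[OF fin_v] 
  by eventually_elim (auto simp: comp_fun_def sup_v_def intro: order_trans[OF component_le_norm_cart])

lemma comp_L2: "comp_fun v j \<in> L2_torus"
  using L2_mult_bounded[OF L2_const[of 1] comp_periodic comp_borel comp_bound] by simp

lemma dv_weak: "has_weak_deriv i (comp_fun v j) (weak_deriv i (comp_fun v j))"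
  using v_W1inf by (auto simp: W1inf_torus_def intro: has_weak_deriv_weak_deriv)

lemma dv_borel [measurable]: "weak_deriv i (comp_fun v j) \<in> borel_measurable borel"
  by (rule has_weak_deriv_borel[OF dv_weak])

lemma dv_bound: "AE x in torus. cmod (weak_deriv i (comp_fun v j) x) \<le> lip j i"
  using Linf_norm_AE[OF fin_dv] by (simp add: lip_def)

lemma dv_periodic: "periodic (weak_deriv i (comp_fun v j))"
  using dv_weak by (simp add: has_weak_deriv_def)

lemma div_fourier: "(\<Sum>j\<in>UNIV. of_int (k $ j) * fourier (comp_fun v j) k) = 0"
proof -
  let ?d = "\<lambda>j. weak_deriv j (comp_fun v j)"
  have "(\<Sum>j\<in>UNIV. fourier (?d j) k) = fourier (\<lambda>x. \<Sum>j\<in>UNIV. ?d j x) k"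
    by (rule fourier_sum[symmetric]) (use dv_weak in \<open>auto simp: has_weak_deriv_def\<close>)
  also have "\<dots> = fourier (\<lambda>x. 0) k"
    by (rule fourier_cong_AE) (use v_div in \<open>auto simp: divergence_free_def\<close>)
  finally have "(\<Sum>j\<in>UNIV. 2 * pi * \<i> * of_int (k $ j) * fourier (comp_fun v j) k) = 0"
    by (simp add: has_weak_deriv_fourier[OF dv_weak]) (simp add: fourier_def)
  then have "2 * pi * \<i> * (\<Sum>j\<in>UNIV. of_int (k $ j) * fourier (comp_fun v j) k) = 0"
    by (simp add: sum_distrib_left mult.assoc)
  then show ?thesis by simp
qed

lemma mult_L2 [intro]: "f \<in> L2_torus \<Longrightarrow> (\<lambda>x. comp_fun v j x * f x) \<in> L2_torus"
  by (rule L2_mult_bounded[OF _ comp_periodic comp_borel comp_bound])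

lemma mult_L2_norm: "f \<in> L2_torus \<Longrightarrow> L2_norm (\<lambda>x. comp_fun v j x * f x) \<le> sup_v * L2_norm f"
  by (rule L2_norm_mult_bounded[OF _ comp_periodic comp_borel comp_bound]) auto

lemma fourier_comp_reflect: "cnj (fourier (comp_fun v j) k) = fourier (comp_fun v j) (- k)"
  unfolding fourier_def Bochner_Integration.integral_cnj[symmetric] by (simp add: character_minus)

text \<open>Parseval for \<open>f\<close> against the product of \<open>character k\<close> with the
  component of \<open>v\<close>: the coefficients of that product are those of the component shifted
  by \<open>k\<close>, and conjugation is reflection because \<open>v\<close> is real.\<close>

lemma fourier_mult_has_sum:
  assumes "f \<in> L2_torus"
  shows "((\<lambda>l. fourier f l * fourier (comp_fun v j) (k - l)) has_sum
    fourier (\<lambda>x. comp_fun v j x * f x) k) UNIV"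
proof -
  have g: "(\<lambda>x. character k x * comp_fun v j x) \<in> L2_torus"
    using mult_L2[OF L2_character, of j k] by (simp add: mult.commute)
  have "((\<lambda>l. fourier f l * cnj (fourier (\<lambda>x. character k x * comp_fun v j x) l)) has_sum
      ip f (\<lambda>x. character k x * comp_fun v j x)) UNIV"
    by (rule parseval[OF assms g])
  moreover have "ip f (\<lambda>x. character k x * comp_fun v j x) = fourier (\<lambda>x. comp_fun v j x * f x) k"
    by (simp add: ip_def fourier_def character_minus mult_ac)
  ultimately show ?thesis
    by (simp add: fourier_mult_character fourier_comp_reflect)
qed

lemma advection_L2: "f \<in> H1_torus \<Longrightarrow> advection v f \<in> L2_torus"
  unfolding advection_alt[abs_def] by (intro L2_sum mult_L2 L2_weak_deriv)

text \<open>Both sides are convolutions; they differ by the divergence of \<open>v\<close>.\<close>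

lemma fourier_advection:
  assumes f: "f \<in> H1_torus"
  shows "fourier (advection v f) k
    = 2 * pi * \<i> * (\<Sum>j\<in>UNIV. of_int (k $ j) * fourier (\<lambda>x. comp_fun v j x * f x) k)"
proof -
  have fL: "f \<in> L2_torus" using f by (rule H1_L2)
  have 1: "fourier (advection v f) k = (\<Sum>j\<in>UNIV. fourier (\<lambda>x. comp_fun v j x * weak_deriv j f x) k)"
    unfolding advection_alt[abs_def]
    by (intro fourier_sum L2_integrable mult_L2 L2_weak_deriv f)
  have 2: "((\<lambda>l. \<Sum>j\<in>UNIV. fourier (weak_deriv j f) l * fourier (comp_fun v j) (k - l)) has_sum
      (\<Sum>j\<in>UNIV. fourier (\<lambda>x. comp_fun v j x * weak_deriv j f x) k)) UNIV"
    by (intro has_sum_sum fourier_mult_has_sum L2_weak_deriv f)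
  have 3: "((\<lambda>l. 2 * pi * \<i> * (\<Sum>j\<in>UNIV. of_int (k $ j) * (fourier f l * fourier (comp_fun v j) (k - l))))
      has_sum 2 * pi * \<i> * (\<Sum>j\<in>UNIV. of_int (k $ j) * fourier (\<lambda>x. comp_fun v j x * f x) k)) UNIV"
    by (intro has_sum_cmult_right has_sum_sum fourier_mult_has_sum fL)
  have 4: "(\<Sum>j\<in>UNIV. fourier (weak_deriv j f) l * fourier (comp_fun v j) (k - l))
    = 2 * pi * \<i> * (\<Sum>j\<in>UNIV. of_int (k $ j) * (fourier f l * fourier (comp_fun v j) (k - l)))" for l
  proof -
    have "(\<Sum>j\<in>UNIV. of_int (k $ j) * (fourier f l * fourier (comp_fun v j) (k - l)))
        - (\<Sum>j\<in>UNIV. of_int (l $ j) * (fourier f l * fourier (comp_fun v j) (k - l)))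
      = fourier f l * (\<Sum>j\<in>UNIV. of_int ((k - l) $ j) * fourier (comp_fun v j) (k - l))"
      by (simp add: sum_subtractf[symmetric] sum_distrib_left algebra_simps)
    then have "(\<Sum>j\<in>UNIV. of_int (k $ j) * (fourier f l * fourier (comp_fun v j) (k - l)))
        = (\<Sum>j\<in>UNIV. of_int (l $ j) * (fourier f l * fourier (comp_fun v j) (k - l)))"
      by (simp only: div_fourier) simp
    then show ?thesis
      by (simp only:) (simp add: fourier_weak_deriv[OF f] sum_distrib_left mult_ac)
  qed
  show ?thesis
    unfolding 1 by (rule has_sum_unique[OF 2 3[folded 4]])
qed

text \<open>Integration by parts carried out on Fourier coefficients: moving the factor 2 pi i k_j
  onto \<open>f\<close> turns the pairing into minus its own conjugate. The divergence term is
  already gone in \<open>fourier_advection\<close>.\<close>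

lemma Re_ip_advection:
  assumes f: "f \<in> H1_torus"
  shows "Re (ip (advection v f) f) = 0"
proof -
  have fL: "f \<in> L2_torus" using f by (rule H1_L2)
  have 1: "((\<lambda>k. fourier (advection v f) k * cnj (fourier f k)) has_sum ip (advection v f) f) UNIV"
    by (rule parseval[OF advection_L2[OF f] fL])
  have 2: "((\<lambda>k. - (\<Sum>j\<in>UNIV. fourier (\<lambda>x. comp_fun v j x * f x) k * cnj (fourier (weak_deriv j f) k)))
      has_sum - (\<Sum>j\<in>UNIV. ip (\<lambda>x. comp_fun v j x * f x) (weak_deriv j f))) UNIV"
    by (intro has_sum_uminusI has_sum_sum parseval mult_L2 fL L2_weak_deriv f)
  have "fourier (advection v f) k * cnj (fourier f k)
    = - (\<Sum>j\<in>UNIV. fourier (\<lambda>x. comp_fun v j x * f x) k * cnj (fourier (weak_deriv j f) k))" for k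
    by (simp add: fourier_advection[OF f] fourier_weak_deriv[OF f] sum_distrib_left sum_distrib_right
        sum_negf[symmetric] mult_ac)
  then have "ip (advection v f) f = - (\<Sum>j\<in>UNIV. ip (\<lambda>x. comp_fun v j x * f x) (weak_deriv j f))"
    using has_sum_unique[OF 1] 2 by simp
  also have "(\<Sum>j\<in>UNIV. ip (\<lambda>x. comp_fun v j x * f x) (weak_deriv j f))
    = (\<Sum>j\<in>UNIV. ip f (\<lambda>x. comp_fun v j x * weak_deriv j f x))"
    by (simp add: ip_def mult_ac)
  also have "\<dots> = ip f (advection v f)"
    unfolding advection_alt[abs_def] by (intro ip_sum_right[symmetric] fL mult_L2 L2_weak_deriv f) simp
  also have "\<dots> = cnj (ip (advection v f) f)" by (rule ip_cnj)
  finally have "ip (advection v f) f = - cnj (ip (advection v f) f)" .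
  then have "Re (ip (advection v f) f) = - Re (ip (advection v f) f)"
    by (metis complex_cnj(1) complex_surj uminus_complex.sel(1) cnj.sel(1))
  then show ?thesis by simp
qed

section \<open>Increments of the velocity\<close>

lemma integral_trig_shift:
  assumes q: "trig_poly q" "q = (\<lambda>x. \<Sum>k\<in>K. a k * character k x)" "finite K"
    and g: "periodic g" "g \<in> borel_measurable borel" "integrable torus g"
  shows "(\<integral>x. q x * g (x + h) \<partial>torus) = (\<Sum>k\<in>K. a k * (character (- k) h * fourier g (- k)))"
proof -
  have int: "integrable torus (\<lambda>x. g (x + h))"
    using g by (subst integrable_torus_shift) auto
  have "(\<integral>x. q x * g (x + h) \<partial>torus) = (\<integral>x. (\<Sum>k\<in>K. a k * (g (x + h) * character k x)) \<partial>torus)"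
    unfolding q(2) by (simp only: sum_distrib_right mult.assoc mult.commute[of "character _ _"])
  also have "\<dots> = (\<Sum>k\<in>K. a k * (\<integral>x. g (x + h) * character k x \<partial>torus))"
    by (subst Bochner_Integration.integral_sum) (auto intro!: integrable_mult_right integrable_mult_character int)
  also have "\<dots> = (\<Sum>k\<in>K. a k * fourier (\<lambda>x. g (x + h)) (- k))"
    by (simp add: fourier_def)
  finally show ?thesis by (simp add: fourier_shift[OF g(1,2)])
qed

abbreviation modulus :: "'d \<Rightarrow> real^'d \<Rightarrow> real" where
  "modulus j h \<equiv> \<Sum>i\<in>UNIV. \<bar>h $ i\<bar> * lip j i"

text \<open>The Lipschitz bound in dual form, which avoids a continuous representative of
  \<open>v\<close>. Against a trigonometric polynomial the translates of \<open>v\<close> are seen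
  through finitely many characters only, so the pairing is smooth along the segment from 0 to
  \<open>h\<close>; its derivative is the pairing with translated weak derivatives, and these are
  bounded.\<close>

lemma trig_increment_bound:
  assumes q: "trig_poly q"
  shows "cmod (\<integral>x. q x * (comp_fun v j (x + h) - comp_fun v j x) \<partial>torus)
    \<le> modulus j h * (\<integral>x. cmod (q x) \<partial>torus)"
proof -
  obtain K a where K: "finite K" "q = (\<lambda>x. \<Sum>k\<in>K. a k * character k x)"
    using q by (rule trig_polyE)
  note [measurable] = trig_poly_borel[OF q]
  have qint: "integrable torus q" by (rule L2_integrable[OF L2_trig_poly[OF q]])
  let ?g = "comp_fun v j" and ?d = "\<lambda>i. weak_deriv i (comp_fun v j)"
  have gint: "integrable torus ?g" by (rule L2_integrable[OF comp_L2])
  have dint: "integrable torus (?d i)" for i using dv_weak by (simp add: has_weak_deriv_def)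
  define \<Phi> where "\<Phi> s = (\<Sum>k\<in>K. a k * (cis (- 2 * pi * (freq k \<bullet> h) * s) * fourier ?g (- k)))" for s
  have char_s: "character (- k) (s *\<^sub>R h) = cis (- 2 * pi * (freq k \<bullet> h) * s)" for k s
    by (simp add: character_def mult_ac)
  have Phi: "(\<integral>x. q x * ?g (x + s *\<^sub>R h) \<partial>torus) = \<Phi> s" for s
    by (simp add: integral_trig_shift[OF q K(2,1) comp_periodic comp_borel gint] \<Phi>_def char_s)
  define \<Psi> where "\<Psi> s = (\<Sum>i\<in>UNIV. h $ i * (\<integral>x. q x * ?d i (x + s *\<^sub>R h) \<partial>torus))" for s
  have Psi: "\<Psi> s = (\<Sum>k\<in>K. a k * ((- 2 * pi * (freq k \<bullet> h)) * (\<i> * cis (- 2 * pi * (freq k \<bullet> h) * s)) * fourier ?g (- k)))" for s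
  proof -
    have "\<Psi> s = (\<Sum>i\<in>UNIV. h $ i * (\<Sum>k\<in>K. a k * (cis (- 2 * pi * (freq k \<bullet> h) * s) * fourier (?d i) (- k))))"
      by (simp add: \<Psi>_def integral_trig_shift[OF q K(2,1) dv_periodic dv_borel dint] char_s)
    also have "\<dots> = (\<Sum>i\<in>UNIV. \<Sum>k\<in>K. a k * ((- 2 * pi * (of_int (k $ i) * h $ i)) * (\<i> * cis (- 2 * pi * (freq k \<bullet> h) * s)) * fourier ?g (- k)))"
      by (simp add: sum_distrib_left has_weak_deriv_fourier[OF dv_weak] mult_ac)
    also have "\<dots> = (\<Sum>k\<in>K. \<Sum>i\<in>UNIV. a k * ((- 2 * pi * (of_int (k $ i) * h $ i)) * (\<i> * cis (- 2 * pi * (freq k \<bullet> h) * s)) * fourier ?g (- k)))"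
      by (rule sum.swap)
    also have "\<dots> = (\<Sum>k\<in>K. a k * ((- 2 * pi * (freq k \<bullet> h)) * (\<i> * cis (- 2 * pi * (freq k \<bullet> h) * s)) * fourier ?g (- k)))"
      by (intro sum.cong refl) (simp add: inner_vec_def sum_distrib_left sum_distrib_right mult_ac)
    finally show ?thesis .
  qed
  have cis_deriv: "((\<lambda>s. cis (c * s)) has_vector_derivative c * (\<i> * cis (c * s))) (at s)" for c s :: real
    using exp_scaleR_has_vector_derivative_right[of "\<i> * of_real c" s UNIV]
    by (simp add: cis_conv_exp scaleR_conv_of_real mult_ac)
  have "(\<Phi> has_vector_derivative \<Psi> s) (at s)" for s
    unfolding \<Phi>_def[abs_def] Psi
    by (intro has_vector_derivative_sum has_vector_derivative_mult_right has_vector_derivative_mult_left cis_deriv)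
  then have deriv: "(\<Phi> has_derivative (\<lambda>t. t *\<^sub>R \<Psi> s)) (at s)" for s
    by (simp add: has_vector_derivative_def)
  have "continuous_on {0..1} \<Phi>"
    by (rule continuous_at_imp_continuous_on) (use deriv has_derivative_continuous in blast)
  \<comment> \<open>For complex-valued functions the mean value theorem is an inequality of norms,
    which suffices here.\<close>
  then obtain s where s: "norm (\<Phi> 1 - \<Phi> 0) \<le> norm ((1 - 0) *\<^sub>R \<Psi> s)"
    using mvt_general[of 0 1 \<Phi> "\<lambda>s t. t *\<^sub>R \<Psi> s"] deriv by auto
  have "cmod (\<integral>x. q x * ?d i (x + s *\<^sub>R h) \<partial>torus) \<le> lip j i * (\<integral>x. cmod (q x) \<partial>torus)" for i
  proof -
    have "periodic (\<lambda>x. cmod (?d i x) \<le> lip j i)" using dv_periodic[of i j] by (simp add: periodic_def)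
    then have ae: "AE x in torus. cmod (?d i (x + s *\<^sub>R h)) \<le> lip j i"
      by (rule AE_torus_shift[OF _ dv_bound])
    have "(\<integral>x. cmod (q x * ?d i (x + s *\<^sub>R h)) \<partial>torus) \<le> (\<integral>x. lip j i * cmod (q x) \<partial>torus)"
    proof (rule integral_mono_AE)
      show ae': "AE x in torus. cmod (q x * ?d i (x + s *\<^sub>R h)) \<le> lip j i * cmod (q x)"
        using ae by eventually_elim (auto simp: norm_mult mult.commute[of "cmod (q _)"] intro!: mult_right_mono)
      show i: "integrable torus (\<lambda>x. lip j i * cmod (q x))" using qint by simp
      show "integrable torus (\<lambda>x. cmod (q x * ?d i (x + s *\<^sub>R h)))"
        by (rule Bochner_Integration.integrable_bound[OF i]) (use ae' in \<open>auto elim!: eventually_mono\<close>)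
    qed
    then have "(\<integral>x. cmod (q x * ?d i (x + s *\<^sub>R h)) \<partial>torus) \<le> lip j i * (\<integral>x. cmod (q x) \<partial>torus)"
      by simp
    then show ?thesis by (rule order_trans[OF integral_norm_bound])
  qed
  then have "norm (\<Psi> s) \<le> (\<Sum>i\<in>UNIV. \<bar>h $ i\<bar> * (lip j i * (\<integral>x. cmod (q x) \<partial>torus)))"
    unfolding \<Psi>_def by (intro order_trans[OF norm_sum] sum_mono) (auto simp: norm_mult intro!: mult_left_mono)
  moreover have "(\<integral>x. q x * (?g (x + h) - ?g x) \<partial>torus) = \<Phi> 1 - \<Phi> 0"
  proof -
    have c: "(\<lambda>x. cnj (?g x)) \<in> L2_torus" "(\<lambda>x. cnj (?g (x + h))) \<in> L2_torus"
      by (intro L2_cnj L2_shift comp_L2)+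
    have "integrable torus (\<lambda>x. q x * ?g (x + h))" "integrable torus (\<lambda>x. q x * ?g x)"
      using ip_integrable[OF L2_trig_poly[OF q] c(2)] ip_integrable[OF L2_trig_poly[OF q] c(1)] by simp_all
    then show ?thesis
      by (simp add: Phi[symmetric] right_diff_distrib)
  qed
  ultimately show ?thesis using s by (simp add: sum_distrib_right mult.assoc)
qed

text \<open>For a partial sum of \<open>f\<close>, the product of its conjugate and its translate is
  a trigonometric polynomial with L1 norm at most the square of the L2 norm of \<open>f\<close>, and
  the previous lemma applies. The constant does not depend on the partial sum, and boundedness of
  \<open>v\<close> allows the passage to the limit.\<close>

lemma increment_bound:
  assumes f: "f \<in> L2_torus"
  shows "cmod (\<integral>x. cnj (f x) * f (x + h) * (comp_fun v j (x + h) - comp_fun v j x) \<partial>torus)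
    \<le> modulus j h * (L2_norm f)\<^sup>2"
proof -
  define a where "a x = comp_fun v j (x + h) - comp_fun v j x" for x
  have "periodic (\<lambda>x. cmod (comp_fun v j x) \<le> sup_v)" using comp_periodic[of j] by (simp add: periodic_def)
  from AE_torus_shift[OF this comp_bound, of h] comp_bound[of j]
  have ab: "AE x in torus. cmod (a x) \<le> 2 * sup_v"
    by eventually_elim (auto simp: a_def intro!: order_trans[OF norm_triangle_ineq4])
  have am: "periodic a" "a \<in> borel_measurable borel"
  proof -
    have "(\<lambda>x. comp_fun v j (x + h)) \<in> L2_torus" by (intro L2_shift comp_L2)
    then have "a \<in> L2_torus" unfolding a_def by (intro L2_diff comp_L2)
    then show "periodic a" "a \<in> borel_measurable borel" by (auto dest: L2_periodic L2_borel)
  qed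
  have aL2: "(\<lambda>x. a x * g x) \<in> L2_torus" if "g \<in> L2_torus" for g
    by (rule L2_mult_bounded[OF that am ab])
  let ?F = "finite_subsets_at_top (UNIV :: (int^'d) set)"
  \<comment> \<open>Filled up by \<open>f\<close> on infinite sets, because
    \<open>ip_tendsto\<close> asks for membership in L2 at every index.\<close>
  define S where "S K = (if finite K then psum K f else f)" for K
  have S: "S K \<in> L2_torus" for K by (simp add: S_def f L2_psum)
  have fin: "\<forall>\<^sub>F K in ?F. finite K" by (auto simp: eventually_finite_subsets_at_top)
  have "((\<lambda>K. L2_norm (\<lambda>x. f x - psum K f x)) \<longlongrightarrow> 0) ?F" by (rule psum_tendsto[OF f])
  then have l2: "((\<lambda>K. L2_norm (\<lambda>x. S K x - f x)) \<longlongrightarrow> 0) ?F"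
    by (rule Lim_transform_eventually) (use fin in \<open>eventually_elim, simp add: S_def L2_norm_minus_commute\<close>)
  have l1: "((\<lambda>K. L2_norm (\<lambda>x. a x * S K (x + h) - a x * f (x + h))) \<longlongrightarrow> 0) ?F"
  proof (rule Lim_null_comparison)
    show "\<forall>\<^sub>F K in ?F. norm (L2_norm (\<lambda>x. a x * S K (x + h) - a x * f (x + h)))
      \<le> 2 * sup_v * L2_norm (\<lambda>x. S K x - f x)"
    proof (rule always_eventually, rule allI)
      fix K
      have d: "(\<lambda>x. S K x - f x) \<in> L2_torus" using S f by auto
      have "L2_norm (\<lambda>x. a x * (S K (x + h) - f (x + h))) \<le> 2 * sup_v * L2_norm (\<lambda>x. S K (x + h) - f (x + h))"
        by (rule L2_norm_mult_bounded[OF L2_shift[OF d] am ab]) simp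
      then show "norm (L2_norm (\<lambda>x. a x * S K (x + h) - a x * f (x + h)))
        \<le> 2 * sup_v * L2_norm (\<lambda>x. S K x - f x)"
        using L2_norm_shift[OF d, of h] by (simp add: right_diff_distrib)
    qed
    show "((\<lambda>K. 2 * sup_v * L2_norm (\<lambda>x. S K x - f x)) \<longlongrightarrow> 0) ?F"
      by (rule tendsto_mult_right_zero[OF l2])
  qed
  have lim: "((\<lambda>K. ip (\<lambda>x. a x * S K (x + h)) (S K)) \<longlongrightarrow> ip (\<lambda>x. a x * f (x + h)) f) ?F"
    by (rule ip_tendsto[OF _ _ _ _ l1 l2]) (auto intro!: aL2 S f)
  have "\<forall>\<^sub>F K in ?F. cmod (ip (\<lambda>x. a x * S K (x + h)) (S K)) \<le> modulus j h * (L2_norm f)\<^sup>2"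
    using fin
  proof eventually_elim
    case (elim K)
    let ?q = "\<lambda>x. cnj (psum K f x) * psum K f (x + h)"
    have pL: "psum K f \<in> L2_torus" using elim by auto
    have cnj_tp: "trig_poly (\<lambda>x. cnj (psum K f x))"
      unfolding psum_def by (auto simp: character_minus[symmetric] intro!: trig_poly_sum trig_poly_character)
    have sh_tp: "trig_poly (\<lambda>x. psum K f (x + h))"
    proof -
      have "(\<lambda>x. psum K f (x + h)) = (\<lambda>x. \<Sum>k\<in>K. (fourier f k * character k h) * character k x)"
        by (simp add: psum_def character_shift mult_ac)
      then show ?thesis by (simp only:) (intro trig_poly_sum trig_poly_character)
    qed
    have q: "trig_poly ?q" by (rule trig_poly_mult[OF cnj_tp sh_tp])
    have "(\<integral>x. cmod (?q x) \<partial>torus) \<le> L2_norm (psum K f) * L2_norm (\<lambda>x. psum K f (x + h))"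
      using L2_cauchy_schwarz[OF pL L2_shift[OF pL]] by (simp add: norm_mult)
    also have "\<dots> = (L2_norm (psum K f))\<^sup>2" by (simp add: L2_norm_shift[OF pL] power2_eq_square)
    also have "\<dots> \<le> (L2_norm f)\<^sup>2" using bessel_le[OF elim f] by (simp add: L2_norm_psum[OF elim])
    finally have le: "(\<integral>x. cmod (?q x) \<partial>torus) \<le> (L2_norm f)\<^sup>2" .
    have "ip (\<lambda>x. a x * S K (x + h)) (S K) = (\<integral>x. ?q x * (comp_fun v j (x + h) - comp_fun v j x) \<partial>torus)"
      using elim by (simp add: ip_def S_def a_def mult_ac)
    also have "cmod \<dots> \<le> modulus j h * (\<integral>x. cmod (?q x) \<partial>torus)"
      by (rule trig_increment_bound[OF q])
    also have "\<dots> \<le> modulus j h * (L2_norm f)\<^sup>2"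
      by (intro mult_left_mono le sum_nonneg mult_nonneg_nonneg) auto
    finally show ?case .
  qed
  then have "cmod (ip (\<lambda>x. a x * f (x + h)) f) \<le> modulus j h * (L2_norm f)\<^sup>2"
    by (rule tendsto_upperbound[OF tendsto_norm[OF lim]]) simp
  then show ?thesis by (simp add: ip_def a_def mult_ac)
qed

end

subsection \<open>Gaussian averages and the commutator estimate\<close>

text \<open>Completing the square in 0 \<le> (|x| - 1)^2 gives an exponential tail, enough for the
  boundary terms of an integration by parts to vanish.\<close>

lemma std_normal_density_le: "std_normal_density x \<le> exp (1/2 - \<bar>x\<bar>)"
proof -
  have "0 \<le> (\<bar>x\<bar> - 1)\<^sup>2" by simp
  then have "- x\<^sup>2 / 2 \<le> 1/2 - \<bar>x\<bar>" by (simp add: power2_diff)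
  moreover have "1 / sqrt (2 * pi) \<le> 1"
    using pi_gt3 by (simp add: real_le_rsqrt)
  ultimately have "(1 / sqrt (2 * pi)) * exp (- x\<^sup>2 / 2) \<le> 1 * exp (1/2 - \<bar>x\<bar>)"
    by (intro mult_mono) auto
  then show ?thesis by (simp add: std_normal_density_def)
qed

lemma std_normal_density_tendsto:
  "(std_normal_density \<longlongrightarrow> 0) at_top" "(std_normal_density \<longlongrightarrow> 0) at_bot"
proof -
  have "((\<lambda>x. exp (1/2) * exp (- x)) \<longlongrightarrow> (0::real)) at_top"
    by (intro tendsto_mult_right_zero filterlim_compose[OF exp_at_bot] filterlim_uminus_at_bot_at_top)
  then have 1: "((\<lambda>x. exp (1/2 - x)) \<longlongrightarrow> (0::real)) at_top"
    by (simp add: exp_add[symmetric])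
  show "(std_normal_density \<longlongrightarrow> 0) at_top"
  proof (rule Lim_null_comparison[OF _ 1])
    show "\<forall>\<^sub>F x in at_top. norm (std_normal_density x) \<le> exp (1/2 - x)"
      using eventually_ge_at_top[of 0]
    proof eventually_elim
      case (elim x)
      then show ?case using std_normal_density_le[of x] by simp
    qed
  qed
  have "std_normal_density (- x) = std_normal_density x" for x
    by (simp add: std_normal_density_def)
  then have "((\<lambda>x. std_normal_density (- x)) \<longlongrightarrow> 0) at_top"
    using \<open>(std_normal_density \<longlongrightarrow> 0) at_top\<close> by (simp only:)
  then show "(std_normal_density \<longlongrightarrow> 0) at_bot"
    by (simp add: filterlim_at_bot_mirror)
qed

lemma std_normal_iexp:
  "integrable std_normal_distribution (\<lambda>x. iexp (t * x))"
  "(\<integral>x. iexp (t * x) \<partial>std_normal_distribution) = of_real (exp (- t\<^sup>2 / 2))"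
proof -
  interpret real_distribution std_normal_distribution by (rule real_dist_normal_dist)
  show "integrable std_normal_distribution (\<lambda>x. iexp (t * x))"
    by (rule integrable_iexp) auto
  show "(\<integral>x. iexp (t * x) \<partial>std_normal_distribution) = of_real (exp (- t\<^sup>2 / 2))"
    using fun_cong[OF char_std_normal_distribution, of t] by (simp add: char_def)
qed

text \<open>Stein's identity: the Gaussian density has logarithmic derivative \<open>- x\<close>.\<close>

lemma std_normal_x_iexp:
  "integrable std_normal_distribution (\<lambda>x. of_real x * iexp (t * x))"
  "(\<integral>x. of_real x * iexp (t * x) \<partial>std_normal_distribution) = \<i> * t * of_real (exp (- t\<^sup>2 / 2))"
proof -
  let ?N = std_normal_distribution and ?d = std_normal_density
  have "integrable ?N (\<lambda>x. x ^ 1)" by (rule integrable_std_normal_distribution_moment)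
  then have "integrable ?N (\<lambda>x. complex_of_real (x ^ 1))" by (rule integrable_of_real)
  then show int1: "integrable ?N (\<lambda>x. of_real x * iexp (t * x))"
    by (rule Bochner_Integration.integrable_bound) (auto simp: norm_mult)
  have int0: "integrable ?N (\<lambda>x. iexp (t * x))" by (rule std_normal_iexp)
  define F where "F x = - (of_real (?d x) * iexp (t * x))" for x
  define f where "f x = of_real (?d x) * (of_real x * iexp (t * x)) - \<i> * t * (of_real (?d x) * iexp (t * x))" for x
  have i1: "integrable lborel (\<lambda>x. of_real (?d x) * (of_real x * iexp (t * x)))"
    using int1 by (subst (asm) integrable_density) (auto simp: scaleR_conv_of_real)
  have i0: "integrable lborel (\<lambda>x. of_real (?d x) * iexp (t * x))"
    using int0 by (subst (asm) integrable_density) (auto simp: scaleR_conv_of_real)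
  have "(LBINT x=-\<infinity>..\<infinity>. f x) = 0 - 0"
  proof (rule interval_integral_FTC_integrable[where F=F])
    fix x :: real
    have "(?d has_real_derivative (- x * ?d x)) (at x)"
      unfolding std_normal_density_def[abs_def]
      by (auto intro!: derivative_eq_intros simp: field_simps)
    then have d: "((\<lambda>x. complex_of_real (?d x)) has_vector_derivative of_real (- x * ?d x)) (at x)"
      by (intro has_vector_derivative_of_real) (simp add: has_real_derivative_iff_has_vector_derivative)
    have "((\<lambda>x. iexp (t * x)) has_vector_derivative t *\<^sub>R (\<i> * iexp (t * x))) (at x)"
      using exp_scaleR_has_vector_derivative_right[of "\<i> * of_real t" x UNIV]
      by (simp add: scaleR_conv_of_real mult_ac)
    from has_vector_derivative_minus[OF has_vector_derivative_mult[OF d this]]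
    show "(F has_vector_derivative f x) (at x)"
      unfolding F_def[abs_def] f_def by (simp add: scaleR_conv_of_real algebra_simps)
    show "isCont f x"
      unfolding f_def[abs_def] std_normal_density_def by (intro continuous_intros) auto
  next
    show "set_integrable lborel (einterval (-\<infinity>) \<infinity>) f"
      unfolding f_def[abs_def] using i0 i1 by (simp add: einterval_def set_integrable_def)
    have nF: "norm (F x) = ?d x" for x by (simp add: F_def norm_mult)
    show "((F \<circ> real_of_ereal) \<longlongrightarrow> 0) (at_right (-\<infinity>))"
      unfolding ereal_tendsto_simps
      by (rule Lim_null_comparison[OF _ std_normal_density_tendsto(2)]) (simp add: nF)
    show "((F \<circ> real_of_ereal) \<longlongrightarrow> 0) (at_left \<infinity>)"
      unfolding ereal_tendsto_simps
      by (rule Lim_null_comparison[OF _ std_normal_density_tendsto(1)]) (simp add: nF)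
  qed simp
  then have "(\<integral>x. f x \<partial>lborel) = 0"
    by (simp add: interval_lebesgue_integral_def einterval_def set_lebesgue_integral_def)
  then have "(\<integral>x. of_real (?d x) * (of_real x * iexp (t * x)) \<partial>lborel)
      = \<i> * t * (\<integral>x. of_real (?d x) * iexp (t * x) \<partial>lborel)"
    unfolding f_def using i0 i1 by (simp add: mult.assoc)
  moreover have "(\<integral>x. of_real x * iexp (t * x) \<partial>?N) = (\<integral>x. of_real (?d x) * (of_real x * iexp (t * x)) \<partial>lborel)"
    by (subst integral_density) (auto simp: scaleR_conv_of_real)
  moreover have "(\<integral>x. iexp (t * x) \<partial>?N) = (\<integral>x. of_real (?d x) * iexp (t * x) \<partial>lborel)"
    by (subst integral_density) (auto simp: scaleR_conv_of_real)
  moreover note std_normal_iexp(2)[of t]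
  ultimately show "(\<integral>x. of_real x * iexp (t * x) \<partial>?N) = \<i> * t * of_real (exp (- t\<^sup>2 / 2))"
    by (simp only:)
qed

section \<open>Gaussian averages of characters\<close>

definition gauss :: "('d::finite \<Rightarrow> real) measure" where
  "gauss = PiM UNIV (\<lambda>_. std_normal_distribution)"

interpretation gauss_component: product_prob_space "\<lambda>_::'d::finite. std_normal_distribution" UNIV
proof -
  interpret real_distribution std_normal_distribution by (rule real_dist_normal_dist)
  show "product_prob_space (\<lambda>_::'d. std_normal_distribution)"
    by unfold_locales
qed

interpretation gauss: prob_space "gauss :: ('d::finite \<Rightarrow> real) measure"
  unfolding gauss_def by (rule gauss_component.P.prob_space_axioms)

text \<open>The characteristic function of \<sigma> times a standard Gaussian vector at 2 pi k;
  equivalently the multiplier of the heat semigroup at time \<sigma>^2/2.\<close>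

definition heat :: "real \<Rightarrow> int^'d::finite \<Rightarrow> real" where
  "heat \<sigma> k = exp (- (2 * pi * \<sigma> * norm (freq k))\<^sup>2 / 2)"

lemma heat_pos: "0 < heat \<sigma> k" and heat_le_1: "heat \<sigma> k \<le> 1"
  by (simp_all add: heat_def)

lemma gauss_square:
  fixes i :: "'d::finite"
  shows
  "integrable gauss (\<lambda>z. (z i)\<^sup>2)" "(\<integral>z. (z i)\<^sup>2 \<partial>gauss) = 1"
proof -
  have m: "(\<lambda>z. z i) \<in> measurable gauss std_normal_distribution"
    unfolding gauss_def by measurable
  have d: "distr gauss std_normal_distribution (\<lambda>z. z i) = std_normal_distribution"
    unfolding gauss_def by (rule gauss_component.PiM_component) simp
  have "integrable std_normal_distribution (\<lambda>x. x\<^sup>2)"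
    by (rule integrable_std_normal_distribution_moment)
  then have "integrable (distr gauss std_normal_distribution (\<lambda>z :: 'd \<Rightarrow> real. z i)) (\<lambda>x. x\<^sup>2)" by (simp only: d)
  then show "integrable gauss (\<lambda>z. (z i)\<^sup>2)"
    by (subst (asm) integrable_distr_eq[OF m]) auto
  have "(\<integral>z. (z i)\<^sup>2 \<partial>gauss) = (\<integral>x. x\<^sup>2 \<partial>distr gauss std_normal_distribution (\<lambda>z :: 'd \<Rightarrow> real. z i))"
    by (rule integral_distr[OF m, symmetric]) simp
  also have "\<dots> = (\<integral>x. x\<^sup>2 \<partial>std_normal_distribution)" by (simp only: d)
  also have "\<dots> = 1" using std_normal_distribution_even_moments(1)[of 1] by simp
  finally show "(\<integral>z. (z i)\<^sup>2 \<partial>gauss) = 1" .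
qed

text \<open>The integrand factors over the coordinates: Stein's identity handles coordinate
  \<open>j\<close>, the one-dimensional characteristic function all others.\<close>

lemma gauss_character:
  fixes k :: "int^'d::finite"
  shows "integrable gauss (\<lambda>z. of_real (z j) * character k (\<sigma> *\<^sub>R vec_lambda z))"
    and "(\<integral>z. of_real (z j) * character k (\<sigma> *\<^sub>R vec_lambda z) \<partial>gauss)
      = 2 * pi * \<i> * of_real \<sigma> * of_int (k $ j) * of_real (heat \<sigma> k)"
proof -
  define t where "t i = 2 * pi * \<sigma> * k $ i" for i
  define g where "g i x = (if i = j then of_real x else 1) * iexp (t i * x)" for i and x :: real
  have int: "integrable std_normal_distribution (g i)" for i
    unfolding g_def using std_normal_iexp(1)[of "t i"] std_normal_x_iexp(1)[of "t i"] by (cases "i = j") simp_all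
  have gi: "(\<integral>x. g i x \<partial>std_normal_distribution)
      = (if i = j then \<i> * t j else 1) * of_real (exp (- (t i)\<^sup>2 / 2))" for i
    unfolding g_def using std_normal_iexp(2)[of "t i"] std_normal_x_iexp(2)[of "t i"] by (cases "i = j") simp_all
  have eq: "of_real (z j) * character k (\<sigma> *\<^sub>R vec_lambda z) = (\<Prod>i\<in>UNIV. g i (z i))" for z :: "'d \<Rightarrow> real"
  proof -
    have "character k (\<sigma> *\<^sub>R vec_lambda z) = exp (\<Sum>i\<in>UNIV. \<i> * of_real (t i * z i))"
      by (simp add: character_def cis_conv_exp inner_vec_def t_def sum_distrib_left mult_ac)
    also have "\<dots> = (\<Prod>i\<in>UNIV. iexp (t i * z i))" by (rule exp_sum) simp
    finally have c: "character k (\<sigma> *\<^sub>R vec_lambda z) = (\<Prod>i\<in>UNIV. iexp (t i * z i))" .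
    have "(\<Prod>i\<in>UNIV. if i = j then complex_of_real (z i) else 1) = of_real (z j)"
      by simp
    then show ?thesis unfolding g_def prod.distrib c by simp
  qed
  show "integrable gauss (\<lambda>z. of_real (z j) * character k (\<sigma> *\<^sub>R vec_lambda z))"
    unfolding eq gauss_def by (rule gauss_component.product_integrable_prod) (simp_all add: int)
  have "(\<integral>z. of_real (z j) * character k (\<sigma> *\<^sub>R vec_lambda z) \<partial>gauss)
      = (\<Prod>i\<in>UNIV. (\<integral>x. g i x \<partial>std_normal_distribution))"
    unfolding eq gauss_def by (rule gauss_component.product_integral_prod) (simp_all add: int)
  also have "\<dots> = (\<i> * t j) * (\<Prod>i\<in>UNIV. of_real (exp (- (t i)\<^sup>2 / 2)))"
    unfolding gi prod.distrib by simp
  also have "(\<Prod>i\<in>UNIV. complex_of_real (exp (- (t i)\<^sup>2 / 2))) = of_real (exp (\<Sum>i\<in>UNIV. - (t i)\<^sup>2 / 2))"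
    by (subst exp_sum) simp_all
  also have "(\<Sum>i\<in>UNIV. - (t i)\<^sup>2 / 2) = - (2 * pi * \<sigma> * norm (freq k))\<^sup>2 / 2"
  proof -
    have "(norm (freq k))\<^sup>2 = (\<Sum>i\<in>UNIV. (real_of_int (k $ i))\<^sup>2)"
      by (simp add: norm_vec_def L2_set_def sum_nonneg)
    then show ?thesis
      by (simp add: t_def power_mult_distrib sum_distrib_left sum_divide_distrib sum_negf)
  qed
  finally show "(\<integral>z. of_real (z j) * character k (\<sigma> *\<^sub>R vec_lambda z) \<partial>gauss)
      = 2 * pi * \<i> * of_real \<sigma> * of_int (k $ j) * of_real (heat \<sigma> k)"
    by (simp add: t_def heat_def mult_ac)
qed

text \<open>A mollified derivative, written as an average of differences of translations. The weight
  \<open>z j\<close> is odd, so subtracting the reflected translation merely doubles the average.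
  The antisymmetric form is the one in which increments of the velocity appear.\<close>

lemma heat_symmetrised:
  fixes k :: "int^'d::finite"
  assumes "\<sigma> \<noteq> 0"
    and D: "\<And>z. D z = character k (\<sigma> *\<^sub>R vec_lambda z) - character k (- (\<sigma> *\<^sub>R vec_lambda z))"
  shows "integrable gauss (\<lambda>z. of_real (z j) * D z)"
    and "2 * pi * \<i> * of_int (k $ j) * of_real (heat \<sigma> k) = (\<integral>z. of_real (z j) * D z \<partial>gauss) / of_real (2 * \<sigma>)"
proof -
  have neg: "- (\<sigma> *\<^sub>R x) = (- \<sigma>) *\<^sub>R x" for x :: "real^'d" by simp
  have eq: "of_real (z j) * D z = of_real (z j) * character k (\<sigma> *\<^sub>R vec_lambda z)
      - of_real (z j) * character k ((- \<sigma>) *\<^sub>R vec_lambda z)" for z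
    unfolding D neg by (simp add: right_diff_distrib)
  show "integrable gauss (\<lambda>z. of_real (z j) * D z)"
    unfolding eq by (intro Bochner_Integration.integrable_diff gauss_character)
  have "heat (- \<sigma>) k = heat \<sigma> k" by (simp add: heat_def)
  then have "(\<integral>z. of_real (z j) * D z \<partial>gauss) = 2 * (2 * pi * \<i> * of_real \<sigma> * of_int (k $ j) * of_real (heat \<sigma> k))"
    unfolding eq by (subst Bochner_Integration.integral_diff[OF gauss_character(1) gauss_character(1)])
      (simp only: gauss_character(2), simp)
  then show "2 * pi * \<i> * of_int (k $ j) * of_real (heat \<sigma> k) = (\<integral>z. of_real (z j) * D z \<partial>gauss) / of_real (2 * \<sigma>)"
    using assms(1) by simp
qed

lemma norm_has_sum_diff_le:
  fixes f :: "'a \<Rightarrow> complex"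
  assumes s: "(f has_sum S) UNIV" and a: "(\<lambda>x. cmod (f x)) summable_on UNIV" and "finite K"
  shows "cmod (S - sum f K) \<le> (\<Sum>\<^sub>\<infinity>x. cmod (f x)) - (\<Sum>x\<in>K. cmod (f x))"
proof -
  have fs: "f summable_on UNIV" using s by (auto simp: summable_on_def)
  have "S - sum f K = infsum f (UNIV - K)"
    using infsumI[OF s] assms(3) by (subst infsum_Diff[OF fs]) auto
  also have "cmod \<dots> \<le> infsum (\<lambda>x. cmod (f x)) (UNIV - K)"
    by (rule norm_infsum_bound) (rule summable_on_subset_banach[OF a], simp)
  also have "\<dots> = (\<Sum>\<^sub>\<infinity>x. cmod (f x)) - (\<Sum>x\<in>K. cmod (f x))"
    using assms(3) by (subst infsum_Diff[OF a]) auto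
  finally show ?thesis .
qed

section \<open>The commutator estimate\<close>

context velocity_field
begin

definition "flux_coeff f j k = fourier (\<lambda>x. comp_fun v j x * f x) k * cnj (fourier f k)"
text \<open>The l1 mass, outside \<open>K\<close>, of the Parseval series for the pairing of the
  product v_j f with f. It is the price for cutting that series off.\<close>

definition "flux_tail f j K = (\<Sum>\<^sub>\<infinity>k. cmod (flux_coeff f j k)) - (\<Sum>k\<in>K. cmod (flux_coeff f j k))"

lemma flux_coeff_summable:
  assumes "f \<in> L2_torus"
  shows "(\<lambda>k. cmod (flux_coeff f j k)) summable_on UNIV"
    and "(\<Sum>\<^sub>\<infinity>k. cmod (flux_coeff f j k)) \<le> sup_v * (L2_norm f)\<^sup>2"
proof -
  note P = parseval_abs_summable[OF mult_L2[OF assms, of j] assms]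
  show "(\<lambda>k. cmod (flux_coeff f j k)) summable_on UNIV"
    unfolding flux_coeff_def using P(1) by (simp add: norm_mult)
  have "(\<Sum>\<^sub>\<infinity>k. cmod (flux_coeff f j k)) \<le> L2_norm (\<lambda>x. comp_fun v j x * f x) * L2_norm f"
    unfolding flux_coeff_def using P(2) by (simp add: norm_mult)
  also have "\<dots> \<le> sup_v * L2_norm f * L2_norm f"
    by (intro mult_right_mono mult_L2_norm assms) simp
  finally show "(\<Sum>\<^sub>\<infinity>k. cmod (flux_coeff f j k)) \<le> sup_v * (L2_norm f)\<^sup>2"
    by (simp add: power2_eq_square mult.assoc)
qed

lemma flux_tail_bounds:
  assumes "f \<in> L2_torus" "finite K"
  shows "0 \<le> flux_tail f j K" "flux_tail f j K \<le> sup_v * (L2_norm f)\<^sup>2"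
proof -
  have "(\<Sum>k\<in>K. cmod (flux_coeff f j k)) \<le> (\<Sum>\<^sub>\<infinity>k. cmod (flux_coeff f j k))"
    by (rule finite_sum_le_infsum[OF flux_coeff_summable(1)]) (use assms in auto)
  then show "0 \<le> flux_tail f j K" by (simp add: flux_tail_def)
  have "0 \<le> (\<Sum>k\<in>K. cmod (flux_coeff f j k))" by (simp add: sum_nonneg)
  then show "flux_tail f j K \<le> sup_v * (L2_norm f)\<^sup>2"
    using flux_coeff_summable(2)[OF assms(1), of j] by (simp add: flux_tail_def)
qed

text \<open>Without truncation the sum is Q(h) - Q(-h), where Q(y) pairs the translate by y of v_j f
  with f. Translating Q(-h) by h and conjugating it gives the same integral as Q(h), but with v_j
  taken at x instead of x + h. Real parts ignore the conjugation, so only the increment of v_j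
  remains. The two truncations cost one tail each.\<close>

lemma truncated_increment:
  assumes f: "f \<in> L2_torus" and K: "finite K"
  shows "\<bar>Re (\<Sum>k\<in>K. (character k h - character k (- h)) * flux_coeff f j k)\<bar>
    \<le> modulus j h * (L2_norm f)\<^sup>2 + 2 * flux_tail f j K"
proof -
  let ?u = "\<lambda>x. comp_fun v j x * f x"
  have u: "?u \<in> L2_torus" by (rule mult_L2[OF f])
  define Q where "Q y = ip (\<lambda>x. ?u (x + y)) f" for y
  have hs: "((\<lambda>k. character k y * flux_coeff f j k) has_sum Q y) UNIV" for y
    using parseval[OF L2_shift[OF u, of y] f] fourier_shift[OF L2_periodic[OF u] L2_borel[OF u], of y]
    by (simp add: Q_def flux_coeff_def mult.assoc)
  have tail: "cmod (Q y - (\<Sum>k\<in>K. character k y * flux_coeff f j k)) \<le> flux_tail f j K" for y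
    using norm_has_sum_diff_le[OF hs[of y] _ K] flux_coeff_summable(1)[OF f, of j]
    by (simp add: norm_mult flux_tail_def)
  let ?S = "\<lambda>y. \<Sum>k\<in>K. character k y * flux_coeff f j k"
  have "\<bar>Re (Q h) - Re (Q (- h))\<bar> \<le> modulus j h * (L2_norm f)\<^sup>2"
  proof -
    have c: "(\<lambda>x. cnj (comp_fun v j x * cnj (f x))) \<in> L2_torus" "(\<lambda>x. f (x + h)) \<in> L2_torus"
      by (intro L2_cnj mult_L2 L2_shift f)+
    have int1: "integrable torus (\<lambda>x. cnj (f x) * f (x + h) * comp_fun v j x)"
      using ip_integrable[OF c(2,1)] by (simp add: mult_ac)
    have int2: "integrable torus (\<lambda>x. cnj (f x) * f (x + h) * comp_fun v j (x + h))"
      using ip_integrable[OF L2_shift[OF u, of h] f] by (simp add: mult_ac)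
    have "Q (- h) = (\<integral>x. ?u ((x + h) + (- h)) * cnj (f (x + h)) \<partial>torus)"
      unfolding Q_def ip_def
    proof (rule integral_torus_shift[symmetric])
      show "periodic (\<lambda>x. ?u (x + - h) * cnj (f x))"
        using L2_periodic[OF L2_shift[OF u, of "-h"]] L2_periodic[OF f] by (simp add: periodic_def)
      show "(\<lambda>x. ?u (x + - h) * cnj (f x)) \<in> borel_measurable torus"
        using ip_integrable[OF L2_shift[OF u, of "-h"] f] by simp
    qed
    then have "cnj (Q (- h)) = (\<integral>x. cnj (f x) * f (x + h) * comp_fun v j x \<partial>torus)"
      by (simp add: Bochner_Integration.integral_cnj[symmetric] mult_ac del: Bochner_Integration.integral_cnj)
    moreover have "Q h = (\<integral>x. cnj (f x) * f (x + h) * comp_fun v j (x + h) \<partial>torus)"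
      by (simp add: Q_def ip_def mult_ac)
    ultimately have "Q h - cnj (Q (- h))
      = (\<integral>x. cnj (f x) * f (x + h) * (comp_fun v j (x + h) - comp_fun v j x) \<partial>torus)"
      using int1 int2 by (simp add: right_diff_distrib)
    then have "cmod (Q h - cnj (Q (- h))) \<le> modulus j h * (L2_norm f)\<^sup>2"
      using increment_bound[OF f, of h j] by simp
    moreover have "\<bar>Re (Q h - cnj (Q (- h)))\<bar> \<le> cmod (Q h - cnj (Q (- h)))" by (rule abs_Re_le_cmod)
    ultimately show ?thesis by simp
  qed
  moreover have "\<bar>Re (Q y) - Re (?S y)\<bar> \<le> flux_tail f j K" for y
    using order_trans[OF abs_Re_le_cmod tail[of y]] by simp
  from this[of h] this[of "-h"]
  have "\<bar>Re (Q h) - Re (?S h)\<bar> \<le> flux_tail f j K" "\<bar>Re (Q (-h)) - Re (?S (-h))\<bar> \<le> flux_tail f j K" by auto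
  moreover have "Re (\<Sum>k\<in>K. (character k h - character k (- h)) * flux_coeff f j k) = Re (?S h) - Re (?S (-h))"
    by (simp only: left_diff_distrib sum_subtractf minus_complex.simps)
  ultimately show ?thesis by linarith
qed

abbreviation transfer :: "(real^'d \<Rightarrow> complex) \<Rightarrow> int^'d \<Rightarrow> complex" where
  "transfer f k \<equiv> cnj (fourier f k) * fourier (advection v f) k"

text \<open>The preceding bound is averaged over h = \<sigma> z with weight z_j / (2 \<sigma>). The
  modulus of continuity contributes a factor \<sigma>, which cancels the denominator, so the main
  term is uniform in \<sigma>; the truncation error has no such factor and keeps its
  1/\<sigma>.\<close>

lemma commutator_bound:
  assumes f: "f \<in> H1_torus" and K: "finite K" and \<sigma>: "0 < \<sigma>"
  shows "\<bar>\<Sum>k\<in>K. heat \<sigma> k * Re (transfer f k)\<bar>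
    \<le> (\<Sum>j\<in>UNIV. \<Sum>i\<in>UNIV. lip j i) * (L2_norm f)\<^sup>2 / 2 + (\<Sum>j\<in>UNIV. flux_tail f j K) / \<sigma>"
proof -
  have fL: "f \<in> L2_torus" using f by (rule H1_L2)
  let ?N = "(L2_norm f)\<^sup>2"
  define D where "D k z = character k (\<sigma> *\<^sub>R vec_lambda z) - character k (- (\<sigma> *\<^sub>R vec_lambda z))" for k :: "int^'d" and z
  have Dint: "integrable gauss (\<lambda>z. of_real (z j) * D k z)" for j k
    by (rule heat_symmetrised(1)[OF _ D_def]) (use \<sigma> in simp)
  let ?E = "\<lambda>j k. \<integral>z. complex_of_real (z j) * D k z \<partial>gauss"
  have Deq: "2 * pi * \<i> * of_int (k $ j) * of_real (heat \<sigma> k) = ?E j k / of_real (2 * \<sigma>)" for j k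
    by (rule heat_symmetrised(2)[OF _ D_def]) (use \<sigma> in simp)
  define R where "R j z = Re (\<Sum>k\<in>K. D k z * flux_coeff f j k)" for j z
  have Rint: "integrable gauss (\<lambda>z. z j * R j z)"
    and Req: "(\<integral>z. z j * R j z \<partial>gauss) = Re (\<Sum>k\<in>K. ?E j k * flux_coeff f j k)" for j
  proof -
    have e: "z j * R j z = Re (\<Sum>k\<in>K. (of_real (z j) * D k z) * flux_coeff f j k)" for z
    proof -
      have "(\<Sum>k\<in>K. (of_real (z j) * D k z) * flux_coeff f j k) = of_real (z j) * (\<Sum>k\<in>K. D k z * flux_coeff f j k)"
        by (simp only: sum_distrib_left mult.assoc)
      then show ?thesis by (simp add: R_def)
    qed
    have i: "integrable gauss (\<lambda>z. \<Sum>k\<in>K. (of_real (z j) * D k z) * flux_coeff f j k)"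
      by (intro Bochner_Integration.integrable_sum integrable_mult_left Dint)
    show "integrable gauss (\<lambda>z. z j * R j z)" unfolding e by (rule integrable_Re[OF i])
    show "(\<integral>z. z j * R j z \<partial>gauss) = Re (\<Sum>k\<in>K. ?E j k * flux_coeff f j k)"
      unfolding e integral_Re[OF i]
      by (subst Bochner_Integration.integral_sum) (auto intro: integrable_mult_left Dint)
  qed
  have "(\<Sum>k\<in>K. heat \<sigma> k * Re (transfer f k))
    = Re (\<Sum>k\<in>K. \<Sum>j\<in>UNIV. (2 * pi * \<i> * of_int (k $ j) * of_real (heat \<sigma> k)) * flux_coeff f j k)"
  proof -
    have "complex_of_real (heat \<sigma> k) * (transfer f k)
      = (\<Sum>j\<in>UNIV. (2 * pi * \<i> * of_int (k $ j) * of_real (heat \<sigma> k)) * flux_coeff f j k)" for k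
      by (simp add: fourier_advection[OF f] flux_coeff_def sum_distrib_left mult_ac)
    from arg_cong[OF this, of Re]
    have "heat \<sigma> k * Re (transfer f k)
      = Re (\<Sum>j\<in>UNIV. (2 * pi * \<i> * of_int (k $ j) * of_real (heat \<sigma> k)) * flux_coeff f j k)" for k
      by simp
    then show ?thesis by (simp only: Re_sum)
  qed
  also have "\<dots> = Re (\<Sum>j\<in>UNIV. \<Sum>k\<in>K. ?E j k / of_real (2 * \<sigma>) * flux_coeff f j k)"
    unfolding Deq by (subst sum.swap) simp
  also have "\<dots> = (\<Sum>j\<in>UNIV. (\<integral>z. z j * R j z \<partial>gauss) / (2 * \<sigma>))"
  proof -
    have "Re (\<Sum>k\<in>K. ?E j k / of_real (2 * \<sigma>) * flux_coeff f j k)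
      = (\<integral>z. z j * R j z \<partial>gauss) / (2 * \<sigma>)" for j
    proof -
      have "(\<Sum>k\<in>K. ?E j k / of_real (2 * \<sigma>) * flux_coeff f j k)
        = (\<Sum>k\<in>K. ?E j k * flux_coeff f j k) / of_real (2 * \<sigma>)"
        by (simp add: sum_divide_distrib)
      then show ?thesis by (simp only: Req Re_divide_of_real)
    qed
    then show ?thesis by (simp only: Re_sum)
  qed
  finally have eq: "(\<Sum>k\<in>K. heat \<sigma> k * Re (transfer f k))
    = (\<Sum>j\<in>UNIV. (\<integral>z. z j * R j z \<partial>gauss) / (2 * \<sigma>))" .
  have bound: "\<bar>\<integral>z. z j * R j z \<partial>gauss\<bar> \<le> \<sigma> * ?N * (\<Sum>i\<in>UNIV. lip j i) + 2 * flux_tail f j K" for j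
  proof -
    \<comment> \<open>Products of absolute values are replaced by squares, so that only second
      moments, all equal to 1, have to be integrated.\<close>
    let ?U = "\<lambda>z. (\<Sum>i\<in>UNIV. \<sigma> * ?N * lip j i * ((z j)\<^sup>2 + (z i)\<^sup>2) / 2) + flux_tail f j K * (1 + (z j)\<^sup>2)"
    have Uint: "integrable gauss ?U"
      by (intro Bochner_Integration.integrable_add Bochner_Integration.integrable_sum integrable_mult_right
          integrable_divide gauss_square gauss.integrable_const)
    have "\<bar>\<integral>z. z j * R j z \<partial>gauss\<bar> \<le> (\<integral>z. \<bar>z j * R j z\<bar> \<partial>gauss)"
      by (rule integral_abs_bound)
    also have "\<dots> \<le> (\<integral>z. ?U z \<partial>gauss)"
    proof (rule integral_mono)
      show "integrable gauss (\<lambda>z. \<bar>z j * R j z\<bar>)" using Rint by (rule integrable_abs)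
      show "integrable gauss ?U" by (rule Uint)
      fix z :: "'d \<Rightarrow> real"
      let ?h = "\<sigma> *\<^sub>R vec_lambda z :: real^'d"
      have "\<bar>R j z\<bar> \<le> (\<Sum>i\<in>UNIV. \<bar>?h $ i\<bar> * lip j i) * ?N + 2 * flux_tail f j K"
        unfolding R_def D_def by (rule truncated_increment[OF fL K])
      also have "(\<Sum>i\<in>UNIV. \<bar>?h $ i\<bar> * lip j i) = (\<Sum>i\<in>UNIV. \<sigma> * \<bar>z i\<bar> * lip j i)"
        using \<sigma> by (simp add: abs_mult)
      finally have "\<bar>z j\<bar> * \<bar>R j z\<bar> \<le> \<bar>z j\<bar> * ((\<Sum>i\<in>UNIV. \<sigma> * \<bar>z i\<bar> * lip j i) * ?N + 2 * flux_tail f j K)"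
        by (intro mult_left_mono) auto
      also have "\<dots> = (\<Sum>i\<in>UNIV. \<sigma> * ?N * lip j i * (\<bar>z j\<bar> * \<bar>z i\<bar>)) + flux_tail f j K * (2 * \<bar>z j\<bar>)"
        by (simp add: distrib_left sum_distrib_left sum_distrib_right mult_ac)
      also have "\<dots> \<le> (\<Sum>i\<in>UNIV. \<sigma> * ?N * lip j i * (((z j)\<^sup>2 + (z i)\<^sup>2) / 2)) + flux_tail f j K * (1 + (z j)\<^sup>2)"
      proof (intro add_mono sum_mono mult_left_mono)
        fix i
        show "\<bar>z j\<bar> * \<bar>z i\<bar> \<le> ((z j)\<^sup>2 + (z i)\<^sup>2) / 2"
          using sum_squares_bound[of "\<bar>z j\<bar>" "\<bar>z i\<bar>"] by simp
        show "2 * \<bar>z j\<bar> \<le> 1 + (z j)\<^sup>2"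
          using sum_squares_bound[of 1 "\<bar>z j\<bar>"] by simp
      qed (use \<sigma> flux_tail_bounds(1)[OF fL K] in auto)
      finally show "\<bar>z j * R j z\<bar> \<le> ?U z" by (simp add: abs_mult)
    qed
    also have "\<dots> = \<sigma> * ?N * (\<Sum>i\<in>UNIV. lip j i) + 2 * flux_tail f j K"
    proof -
      have 1: "(\<integral>z. \<sigma> * ?N * lip j i * ((z j)\<^sup>2 + (z i)\<^sup>2) / 2 \<partial>gauss) = \<sigma> * ?N * lip j i" for i
        by (simp add: gauss_square)
      have 2: "(\<integral>z. flux_tail f j K * (1 + (z j)\<^sup>2) \<partial>gauss) = 2 * flux_tail f j K"
        by (simp add: gauss_square gauss.prob_space)
      show ?thesis
        by (subst Bochner_Integration.integral_add, (intro Bochner_Integration.integrable_add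
          Bochner_Integration.integrable_sum integrable_mult_right integrable_divide gauss_square gauss.integrable_const)+,
          subst Bochner_Integration.integral_sum, (intro Bochner_Integration.integrable_add
          integrable_mult_right integrable_divide gauss_square), simp only: 1 2 sum_distrib_left)
    qed
    finally show ?thesis .
  qed
  have "\<bar>\<Sum>k\<in>K. heat \<sigma> k * Re (transfer f k)\<bar>
    \<le> (\<Sum>j\<in>UNIV. (\<sigma> * ?N * (\<Sum>i\<in>UNIV. lip j i) + 2 * flux_tail f j K) / (2 * \<sigma>))"
    unfolding eq using \<sigma> bound
    by (intro order_trans[OF sum_abs] sum_mono) (auto simp: abs_divide divide_right_mono)
  also have "\<dots> = (\<Sum>j\<in>UNIV. \<Sum>i\<in>UNIV. lip j i) * ?N / 2 + (\<Sum>j\<in>UNIV. flux_tail f j K) / \<sigma>"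
    using \<sigma> by (simp add: add_divide_distrib sum.distrib sum_distrib_left sum_distrib_right sum_divide_distrib mult_ac)
  finally show ?thesis .
qed

end

subsection \<open>Functions of time\<close>

text \<open>The chain rule for the square of an absolutely continuous function. Let
  \<open>\<Phi>\<close> be the square minus the claimed integral. Its increment over [a,b] is the
  integral of (c b + c a - 2 c s) f s, which uniform continuity of \<open>c\<close> bounds by e
  times the integral of |f| once b - a is small. Such increments add up, and e is arbitrary.\<close>

lemma indefinite_integral_square:
  fixes f c :: "real \<Rightarrow> real"
  assumes f: "f absolutely_integrable_on {0..T}" and T: "0 \<le> T"
    and c: "\<And>t. t \<in> {0..T} \<Longrightarrow> c t = c 0 + integral {0..t} f"
  shows "(\<lambda>s. 2 * c s * f s) absolutely_integrable_on {0..T}"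
    and "(c T)\<^sup>2 = (c 0)\<^sup>2 + integral {0..T} (\<lambda>s. 2 * c s * f s)"
proof -
  have fi: "f integrable_on {0..T}" and nfi: "(\<lambda>s. \<bar>f s\<bar>) integrable_on {0..T}"
    using f by (auto simp: absolutely_integrable_on_def)
  have cont: "continuous_on {0..T} c"
  proof -
    have "continuous_on {0..T} (\<lambda>t. c 0 + integral {0..t} f)"
      by (intro continuous_intros indefinite_integral_continuous_1 fi)
    then show ?thesis by (rule continuous_on_eq) (rule c[symmetric])
  qed
  have cont2: "continuous_on {0..T} (\<lambda>s. 2 * c s)" by (intro continuous_intros cont)
  show abs: "(\<lambda>s. 2 * c s * f s) absolutely_integrable_on {0..T}"
  proof (rule absolutely_integrable_bounded_measurable_product_real[OF _ _ _ f])
    show "(\<lambda>s. 2 * c s) \<in> borel_measurable (lebesgue_on {0..T})"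
      by (rule continuous_imp_measurable_on_sets_lebesgue[OF cont2]) simp
    show "bounded ((\<lambda>s. 2 * c s) ` {0..T})"
      by (intro compact_imp_bounded compact_continuous_image cont2) simp
  qed simp
  then have hi: "(\<lambda>s. 2 * c s * f s) integrable_on {0..T}"
    by (rule set_lebesgue_integral_eq_integral)
  define \<Phi> where "\<Phi> t = (c t)\<^sup>2 - integral {0..t} (\<lambda>s. 2 * c s * f s)" for t
  define G where "G t = integral {0..t} (\<lambda>s. \<bar>f s\<bar>)" for t
  have sub: "h integrable_on {0..T} \<Longrightarrow> 0 \<le> a \<Longrightarrow> a \<le> b \<Longrightarrow> b \<le> T \<Longrightarrow>
      integral {0..b} h - integral {0..a} h = integral {a..b} h" for h :: "real \<Rightarrow> real" and a b
    using Henstock_Kurzweil_Integration.integral_combine[where f=h and a=0 and c=a and b=b]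
      integrable_on_subinterval[of h "{0..T}" 0 b] by simp
  have si: "h integrable_on {0..T} \<Longrightarrow> 0 \<le> a \<Longrightarrow> b \<le> T \<Longrightarrow> h integrable_on {a..b}"
    for h :: "real \<Rightarrow> real" and a b
    by (rule integrable_on_subinterval) auto
  have small: "\<bar>\<Phi> T - \<Phi> 0\<bar> \<le> e * (G T - G 0)" if e: "0 < e" for e
  proof -
    have uc: "uniformly_continuous_on {0..T} c"
      by (rule compact_uniformly_continuous[OF cont]) simp
    then obtain d where d: "0 < d"
      "\<And>x y. x \<in> {0..T} \<Longrightarrow> y \<in> {0..T} \<Longrightarrow> dist y x < d \<Longrightarrow> dist (c y) (c x) < e / 2"
      unfolding uniformly_continuous_on_def using e by (metis half_gt_zero)
    have loc: "\<bar>\<Phi> b - \<Phi> a\<bar> \<le> e * (G b - G a)" if ab: "0 \<le> a" "a \<le> b" "b \<le> T" "b - a < d" for a b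
    proof -
      have cab: "c b - c a = integral {a..b} f"
        using c[of a] c[of b] ab sub[OF fi, of a b] by simp
      have "\<Phi> b - \<Phi> a = (c b + c a) * (c b - c a) - integral {a..b} (\<lambda>s. 2 * c s * f s)"
        using sub[OF hi, of a b] ab by (simp add: \<Phi>_def algebra_simps power2_eq_square)
      also have "\<dots> = integral {a..b} (\<lambda>s. (c b + c a) * f s) - integral {a..b} (\<lambda>s. 2 * c s * f s)"
        by (simp add: cab)
      also have "\<dots> = integral {a..b} (\<lambda>s. (c b + c a) * f s - 2 * c s * f s)"
        by (rule integral_diff[symmetric]) (intro integrable_on_mult_right si[OF fi ab(1,3)] si[OF hi ab(1,3)])+
      also have "norm \<dots> \<le> integral {a..b} (\<lambda>s. e * \<bar>f s\<bar>)"
      proof (rule Henstock_Kurzweil_Integration.integral_norm_bound_integral)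
        show "(\<lambda>s. (c b + c a) * f s - 2 * c s * f s) integrable_on {a..b}"
          by (intro integrable_diff integrable_on_mult_right si[OF fi ab(1,3)] si[OF hi ab(1,3)])
        show "(\<lambda>s. e * \<bar>f s\<bar>) integrable_on {a..b}"
          by (intro integrable_on_mult_right si[OF nfi ab(1,3)])
        fix s assume s: "s \<in> {a..b}"
        have "\<bar>c b - c s\<bar> < e / 2" "\<bar>c a - c s\<bar> < e / 2"
          using d(2)[of s b] d(2)[of s a] s ab by (auto simp: dist_real_def)
        then have "\<bar>(c b + c a) - 2 * c s\<bar> \<le> e" by linarith
        then have "\<bar>((c b + c a) - 2 * c s) * f s\<bar> \<le> e * \<bar>f s\<bar>"
          unfolding abs_mult by (rule mult_right_mono) simp
        then show "norm ((c b + c a) * f s - 2 * c s * f s) \<le> e * \<bar>f s\<bar>"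
          by (simp add: left_diff_distrib)
      qed
      also have "\<dots> = e * (G b - G a)"
        using sub[OF nfi, of a b] ab by (simp add: G_def)
      finally show ?thesis by simp
    qed
    \<comment> \<open>\<open>Bolzano\<close> is induction by bisection: a property that is additive
      over adjacent intervals and holds on short ones holds on the whole interval. The restriction
      to [0,T] is part of \<open>?P\<close> because shortness is required around every real
      point.\<close>
    let ?P = "\<lambda>a b. 0 \<le> a \<and> b \<le> T \<longrightarrow> \<bar>\<Phi> b - \<Phi> a\<bar> \<le> e * (G b - G a)"
    have "?P 0 T"
    proof (rule Bolzano[of 0 T ?P, OF T])
      fix a b c :: real
      assume P: "?P a b" "?P b c" "a \<le> b" "b \<le> c"
      show "?P a c"
      proof
        assume "0 \<le> a \<and> c \<le> T"
        then have "\<bar>\<Phi> b - \<Phi> a\<bar> \<le> e * (G b - G a)" "\<bar>\<Phi> c - \<Phi> b\<bar> \<le> e * (G c - G b)"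
          using P by auto
        then show "\<bar>\<Phi> c - \<Phi> a\<bar> \<le> e * (G c - G a)"
          by (simp add: right_diff_distrib)
      qed
    next
      fix x
      show "\<exists>d>0. \<forall>a b. a \<le> x \<and> x \<le> b \<and> b - a < d \<longrightarrow> ?P a b"
        using loc d(1) order_trans by (intro exI[of _ d]) blast
    qed
    then show ?thesis by simp
  qed
  have G: "0 \<le> G T - G 0"
    unfolding G_def by (simp add: integral_nonneg[OF nfi])
  have "\<bar>\<Phi> T - \<Phi> 0\<bar> \<le> 0"
  proof (rule field_le_epsilon)
    fix e :: real assume e: "0 < e"
    have "\<bar>\<Phi> T - \<Phi> 0\<bar> \<le> e / (1 + (G T - G 0)) * (G T - G 0)"
      by (rule small) (use e G in auto)
    also have "\<dots> \<le> e / (1 + (G T - G 0)) * (1 + (G T - G 0))"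
      using e G by (intro mult_left_mono) auto
    also have "\<dots> = e" using G by simp
    finally show "\<bar>\<Phi> T - \<Phi> 0\<bar> \<le> 0 + e" by simp
  qed
  then show "(c T)\<^sup>2 = (c 0)\<^sup>2 + integral {0..T} (\<lambda>s. 2 * c s * f s)"
    by (simp add: \<Phi>_def)
qed

text \<open>\<open>integrable_ccontinuous_explicit\<close> differentiates over intervals to the
  right of a point; applied to the reflected function it also yields the derivative from the left.
  Extension by zero makes the function integrable on every interval.\<close>

lemma AE_indefinite_integral_deriv:
  fixes f :: "real \<Rightarrow> real"
  assumes f: "\<And>T. 0 \<le> T \<Longrightarrow> f absolutely_integrable_on {0..T}"
  shows "AE t in lebesgue. 0 < t \<longrightarrow> ((\<lambda>t. integral {0..t} f) has_real_derivative f t) (at t)"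
proof -
  define F where "F x = (if x \<in> {0..} then f x else 0)" for x
  have F: "F integrable_on {a..b}" for a b
  proof -
    have "f integrable_on {0..max 0 b}"
      using f[of "max 0 b"] by (auto simp: absolutely_integrable_on_def)
    then have 1: "F integrable_on {0..max 0 b}"
      by (rule integrable_eq) (auto simp: F_def)
    have 2: "F integrable_on {min a 0..0}"
      by (rule integrable_spike_finite[of "{0}" _ _ "\<lambda>_. 0"]) (auto simp: F_def)
    have "F integrable_on {min a 0..max 0 b}"
      by (rule Henstock_Kurzweil_Integration.integrable_combine[OF _ _ 2 1]) auto
    then show ?thesis by (rule integrable_on_subinterval) auto
  qed
  then have F': "(\<lambda>x. F (- x)) integrable_on {a..b}" for a b
    using Henstock_Kurzweil_Integration.integrable_reflect_real[where f=F and a="-b" and b="-a"] by simp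
  obtain N1 where N1: "negligible N1" "\<And>x e. x \<notin> N1 \<Longrightarrow> 0 < e \<Longrightarrow>
      \<exists>d>0. \<forall>h. 0 < h \<and> h < d \<longrightarrow> norm (integral (cbox x (x + h *\<^sub>R One)) F /\<^sub>R h ^ DIM(real) - F x) < e"
    using integrable_ccontinuous_explicit[where f=F] F by auto
  obtain N2 where N2: "negligible N2" "\<And>x e. x \<notin> N2 \<Longrightarrow> 0 < e \<Longrightarrow>
      \<exists>d>0. \<forall>h. 0 < h \<and> h < d \<longrightarrow> norm (integral (cbox x (x + h *\<^sub>R One)) (\<lambda>x. F (- x)) /\<^sub>R h ^ DIM(real) - F (- x)) < e"
    using integrable_ccontinuous_explicit[where f="\<lambda>x. F (- x)"] F' by auto
  have "negligible (uminus ` N2)"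
    by (rule negligible_differentiable_image_negligible[OF _ N2(1)])
      (auto intro!: derivative_intros simp: differentiable_on_def)
  then have neg: "negligible (N1 \<union> uminus ` N2)" using N1(1) by auto
  have "((\<lambda>t. integral {0..t} f) has_real_derivative f t) (at t)"
    if t: "t \<notin> N1 \<union> uminus ` N2" "0 < t" for t
  proof -
    have t2: "- t \<notin> N2" using t(1) by (metis UnCI add.inverse_inverse image_eqI)
    have FI: "integral {0..x} f = integral {0..x} F" for x
      by (rule integral_cong) (simp add: F_def)
    have step: "integral {0..y} F - integral {0..x} F = integral {x..y} F" if "0 \<le> x" "x \<le> y" for x y
      using Henstock_Kurzweil_Integration.integral_combine[OF that F] by simp
    have "(\<lambda>h. (integral {0..t + h} f - integral {0..t} f) / h) \<midarrow>0\<rightarrow> f t"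
      unfolding LIM_def
    proof (intro allI impI)
      fix e :: real assume e: "0 < e"
      obtain d1 where d1: "0 < d1" "\<And>h. 0 < h \<Longrightarrow> h < d1 \<Longrightarrow> \<bar>integral {t..t + h} F / h - F t\<bar> < e"
        using N1(2)[of t e] t(1) e by (auto simp: divide_inverse mult.commute)
      obtain d2 where d2: "0 < d2" "\<And>h. 0 < h \<Longrightarrow> h < d2 \<Longrightarrow> \<bar>integral {-t..-t + h} (\<lambda>x. F (- x)) / h - F t\<bar> < e"
        using N2(2)[of "-t" e] t2 e by (auto simp: divide_inverse mult.commute)
      have "dist ((integral {0..t + h} f - integral {0..t} f) / h) (f t) < e"
        if h: "h \<noteq> 0" "dist h 0 < min t (min d1 d2)" for h
      proof (cases "0 < h")
        case True
        then show ?thesis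
          using d1(2)[of h] step[of t "t + h"] t(2) h(2)
          by (simp add: FI dist_real_def F_def[of t])
      next
        case False
        then have h0: "0 < - h" using h(1) by simp
        have "integral {-t..-t + - h} (\<lambda>x. F (- x)) = integral {t + h..t} F"
          using Henstock_Kurzweil_Integration.integral_reflect_real[where f=F and a="t + h" and b=t] by simp
        also have "\<dots> = integral {0..t} F - integral {0..t + h} F"
          using step[of "t + h" t] h h0 by (auto simp: dist_real_def)
        finally have "(integral {0..t + h} F - integral {0..t} F) / h = integral {-t..-t + - h} (\<lambda>x. F (- x)) / (- h)"
          by (simp only:) (simp add: diff_divide_distrib)
        then show ?thesis
          using d2(2)[OF h0] h h0 t(2) by (simp add: FI dist_real_def F_def[of t])
      qed
      then show "\<exists>s>0. \<forall>x. x \<noteq> 0 \<and> dist x 0 < s \<longrightarrow>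
          dist ((integral {0..t + x} f - integral {0..t} f) / x) (f t) < e"
        using t(2) d1(1) d2(1) by (intro exI[of _ "min t (min d1 d2)"]) auto
    qed
    then show ?thesis by (simp add: DERIV_def)
  qed
  moreover have "AE t in lebesgue. t \<notin> N1 \<union> uminus ` N2"
    using neg by (intro AE_not_in) (simp add: negligible_iff_null_sets)
  ultimately show ?thesis by (elim eventually_mono) blast
qed

text \<open>
  The majorant \<open>W\<close> need not be measurable, in which case its integral is a lower integral; the
  supremum of the functions \<open>R n\<close> is a measurable majorant below it.
\<close>

lemma dominated_convergence_nn_majorant:
  fixes R :: "nat \<Rightarrow> 'a \<Rightarrow> real"
  assumes R [measurable]: "\<And>n. R n \<in> borel_measurable M"
    and C: "0 < C"
    and dom: "AE x in M. \<forall>n. ennreal \<bar>R n x\<bar> \<le> ennreal C * W x"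
    and W: "(\<integral>\<^sup>+x. W x \<partial>M) < \<infinity>"
    and lim: "AE x in M. convergent (\<lambda>n. R n x)"
  shows "\<And>n. integrable M (R n)" and "integrable M (\<lambda>x. lim (\<lambda>n. R n x))"
    and "(\<lambda>n. \<integral>x. R n x \<partial>M) \<longlonglongrightarrow> (\<integral>x. lim (\<lambda>n. R n x) \<partial>M)"
proof -
  define G where "G x = (SUP n. ennreal \<bar>R n x\<bar>)" for x
  have [measurable]: "G \<in> borel_measurable M" unfolding G_def by measurable
  have "(\<integral>\<^sup>+x. ennreal (1 / C) * G x \<partial>M) \<le> (\<integral>\<^sup>+x. W x \<partial>M)"
  proof (rule nn_integral_mono_AE)
    show "AE x in M. ennreal (1 / C) * G x \<le> W x"
      using dom
    proof eventually_elim
      case (elim x)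
      then have "G x \<le> ennreal C * W x" unfolding G_def by (intro SUP_least) auto
      then have "ennreal (1 / C) * G x \<le> ennreal (1 / C) * (ennreal C * W x)" by (rule mult_left_mono) simp
      also have "\<dots> = (ennreal (1 / C) * ennreal C) * W x" by (simp only: mult.assoc)
      also have "ennreal (1 / C) * ennreal C = 1"
        using C by (subst ennreal_mult[symmetric]) auto
      finally show ?case by simp
    qed
  qed
  then have "ennreal (1 / C) * (\<integral>\<^sup>+x. G x \<partial>M) < \<infinity>"
    using W by (simp add: nn_integral_cmult le_less_trans)
  then have Gfin: "(\<integral>\<^sup>+x. G x \<partial>M) < \<infinity>"
    using C by (auto simp: ennreal_mult_less_top)
  then have GAE: "AE x in M. G x \<noteq> \<infinity>"
    by (intro nn_integral_PInf_AE) auto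
  define w where "w x = enn2real (G x)" for x
  have wint: "integrable M w"
  proof (rule integrableI_bounded)
    show "w \<in> borel_measurable M" unfolding w_def by measurable
    have "(\<integral>\<^sup>+x. ennreal (norm (w x)) \<partial>M) \<le> (\<integral>\<^sup>+x. G x \<partial>M)"
      by (intro nn_integral_mono) (simp add: w_def ennreal_enn2real_if)
    then show "(\<integral>\<^sup>+x. ennreal (norm (w x)) \<partial>M) < \<infinity>" using Gfin by (rule le_less_trans)
  qed
  have bound: "AE x in M. norm (R n x) \<le> w x" for n
    using GAE
  proof eventually_elim
    case (elim x)
    have "ennreal \<bar>R n x\<bar> \<le> G x" unfolding G_def by (rule SUP_upper) simp
    then have "enn2real (ennreal \<bar>R n x\<bar>) \<le> enn2real (G x)"
      using elim by (intro enn2real_mono) (auto simp: less_top)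
    then show ?case by (simp add: w_def)
  qed
  have lim': "AE x in M. (\<lambda>n. R n x) \<longlonglongrightarrow> lim (\<lambda>n. R n x)"
    using lim by (simp add: convergent_LIMSEQ_iff)
  have m: "(\<lambda>x. lim (\<lambda>n. R n x)) \<in> borel_measurable M" by measurable
  show "\<And>n. integrable M (R n)" by (rule Bochner_Integration.integrable_bound[OF wint]) (use bound in \<open>auto simp: w_def\<close>)
  show "integrable M (\<lambda>x. lim (\<lambda>n. R n x))"
    by (rule integrable_dominated_convergence[OF m R wint lim' bound])
  show "(\<lambda>n. \<integral>x. R n x \<partial>M) \<longlonglongrightarrow> (\<integral>x. lim (\<lambda>n. R n x) \<partial>M)"
    by (rule integral_dominated_convergence[OF m R wint lim' bound])
qed

section \<open>Exhaustion by frequency balls and removal of the Gaussian multiplier\<close>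

definition freq_ball :: "nat \<Rightarrow> (int^'d::finite) set" where
  "freq_ball n = {k. norm (freq k) < real n}"

lemma finite_freq_ball_nat [simp]: "finite (freq_ball n)"
  by (simp add: freq_ball_def finite_freq_ball)

text \<open>Replaces the net of finite sets by a sequence, since dominated convergence in time works
  along sequences only.\<close>

lemma freq_ball_exhausts: "filterlim freq_ball (finite_subsets_at_top UNIV) sequentially"
  unfolding filterlim_iff
proof (intro allI impI)
  fix P :: "(int^'d::finite) set \<Rightarrow> bool" assume "eventually P (finite_subsets_at_top UNIV)"
  then obtain X where X: "finite X" "\<And>Y. finite Y \<Longrightarrow> X \<subseteq> Y \<Longrightarrow> P Y"
    unfolding eventually_finite_subsets_at_top by auto
  obtain N :: nat where N: "(\<Sum>k\<in>X. norm (freq k)) < real N"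
    using reals_Archimedean2 by blast
  have "P (freq_ball n)" if "N \<le> n" for n
  proof (rule X(2))
    have "norm (freq k) < real n" if "k \<in> X" for k
      using member_le_sum[of k X "\<lambda>k. norm (freq k)"] X(1) that N \<open>N \<le> n\<close> by fastforce
    then show "X \<subseteq> freq_ball n" by (auto simp: freq_ball_def)
  qed simp
  then show "\<forall>\<^sub>F n in sequentially. P (freq_ball n)"
    by (rule eventually_sequentiallyI)
qed

lemma has_sum_freq_ball:
  "(a has_sum S) UNIV \<Longrightarrow> (\<lambda>n. \<Sum>k\<in>freq_ball n. a k) \<longlonglongrightarrow> S"
  unfolding has_sum_def by (rule filterlim_compose[OF _ freq_ball_exhausts])

lemma abs_heat [simp]: "\<bar>heat \<sigma> k\<bar> = heat \<sigma> k"
  using heat_pos[of \<sigma> k] by simp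

lemma heat_tendsto: "(\<lambda>n. heat (1 / real (Suc n)) k) \<longlonglongrightarrow> 1"
proof -
  have "(\<lambda>n. exp (- (2 * pi * (1 / real (Suc n)) * norm (freq k))\<^sup>2 / 2)) \<longlonglongrightarrow> exp (- (2 * pi * 0 * norm (freq k))\<^sup>2 / 2)"
    by (intro tendsto_intros) (use LIMSEQ_inverse_real_of_nat in \<open>auto simp: inverse_eq_divide\<close>)
  then show ?thesis by (simp add: heat_def)
qed

lemma heat_summable:
  fixes a :: "int^'d::finite \<Rightarrow> real"
  assumes "(\<lambda>k. \<bar>a k\<bar>) summable_on UNIV"
  shows "(\<lambda>k. \<bar>heat \<sigma> k * a k\<bar>) summable_on UNIV" "(\<lambda>k. heat \<sigma> k * a k) summable_on UNIV"
proof -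
  show 1: "(\<lambda>k. \<bar>heat \<sigma> k * a k\<bar>) summable_on UNIV"
    by (rule summable_on_comparison_test[OF assms])
      (use heat_le_1 less_imp_le[OF heat_pos] in \<open>auto simp: abs_mult intro!: mult_left_le_one_le mult_nonneg_nonneg\<close>)
  then show "(\<lambda>k. heat \<sigma> k * a k) summable_on UNIV"
    using abs_summable_summable[of "\<lambda>k. heat \<sigma> k * a k" UNIV] by simp
qed

text \<open>Dominated convergence for the counting measure: the multiplier tends to 1 at each
  frequency and never exceeds 1.\<close>

lemma infsum_heat_tendsto:
  fixes a :: "int^'d::finite \<Rightarrow> real"
  assumes a: "(\<lambda>k. \<bar>a k\<bar>) summable_on UNIV"
  shows "(\<lambda>n. \<Sum>\<^sub>\<infinity>k. heat (1 / real (Suc n)) k * a k) \<longlonglongrightarrow> (\<Sum>\<^sub>\<infinity>k. a k)"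
proof -
  have conv: "infsum b UNIV = (\<integral>k. b k \<partial>count_space UNIV)" and int: "integrable (count_space UNIV) b"
    if "(\<lambda>k. \<bar>b k\<bar>) summable_on UNIV" for b :: "int^'d \<Rightarrow> real"
  proof -
    have "Infinite_Set_Sum.abs_summable_on b UNIV"
      using that unfolding abs_summable_equivalent[symmetric] by simp
    from infsetsum_infsum[OF this] this
    show "infsum b UNIV = (\<integral>k. b k \<partial>count_space UNIV)" "integrable (count_space UNIV) b"
      unfolding infsetsum_def Infinite_Set_Sum.abs_summable_on_def by simp_all
  qed
  have "(\<lambda>n. \<integral>k. heat (1 / real (Suc n)) k * a k \<partial>count_space UNIV) \<longlonglongrightarrow> (\<integral>k. a k \<partial>count_space UNIV)"
  proof (rule integral_dominated_convergence)
    show "integrable (count_space UNIV) (\<lambda>k. \<bar>a k\<bar>)" using int[OF a] by simp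
    show "AE k in count_space UNIV. (\<lambda>n. heat (1 / real (Suc n)) k * a k) \<longlonglongrightarrow> a k"
    proof (rule AE_I2)
      fix k
      have "(\<lambda>n. heat (1 / real (Suc n)) k * a k) \<longlonglongrightarrow> 1 * a k"
        by (intro tendsto_intros heat_tendsto)
      then show "(\<lambda>n. heat (1 / real (Suc n)) k * a k) \<longlonglongrightarrow> a k" by simp
    qed
    show "AE k in count_space UNIV. norm (heat (1 / real (Suc n)) k * a k) \<le> \<bar>a k\<bar>" for n
      using heat_le_1 less_imp_le[OF heat_pos] by (intro AE_I2) (auto simp: abs_mult intro!: mult_left_le_one_le)
  qed auto
  then show ?thesis by (simp add: conv heat_summable a)
qed

subsection \<open>The flux through a frequency shell\<close>

lemma weight_conv_eq:
  "weight_conv w f r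
    = (\<integral>\<^sup>+k. inverse (w \<bar>r - norm (freq k)\<bar>) * ennreal ((cmod (fourier f k))\<^sup>2) \<partial>count_space UNIV)"
  unfolding weight_conv_def mass_measure_def
  by (subst nn_integral_distr) (auto simp: nn_integral_density mult.commute)

text \<open>Moves the estimate into \<open>ennreal\<close>, where sums may be enlarged and exchanged
  with no summability to check.\<close>

lemma norm_has_sum_le_nn_integral:
  fixes f :: "'a \<Rightarrow> complex"
  assumes "(f has_sum s) A"
  shows "ennreal (cmod s) \<le> (\<integral>\<^sup>+x. ennreal (cmod (f x)) \<partial>count_space A)"
proof (rule tendsto_upperbound)
  show "((\<lambda>F. ennreal (cmod (sum f F))) \<longlongrightarrow> ennreal (cmod s)) (finite_subsets_at_top A)"
    using assms unfolding has_sum_def by (intro tendsto_ennrealI tendsto_norm)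
  have "ennreal (cmod (sum f F)) \<le> (\<integral>\<^sup>+x. ennreal (cmod (f x)) \<partial>count_space A)" if "finite F" "F \<subseteq> A" for F
  proof -
    have "ennreal (cmod (sum f F)) \<le> ennreal (\<Sum>x\<in>F. cmod (f x))"
      by (intro ennreal_leI norm_sum)
    also have "\<dots> = (\<integral>\<^sup>+x. ennreal (cmod (f x)) \<partial>count_space F)"
      using that(1) by (simp add: nn_integral_count_space_finite)
    also have "\<dots> \<le> (\<integral>\<^sup>+x. ennreal (cmod (f x)) \<partial>count_space A)"
      using that(2) by (auto simp: nn_integral_count_space_indicator[of F] nn_integral_count_space_indicator[of A]
          intro!: nn_integral_mono split: split_indicator)
    finally show ?thesis .
  qed
  then show "\<forall>\<^sub>F F in finite_subsets_at_top A. ennreal (cmod (sum f F)) \<le> (\<integral>\<^sup>+x. ennreal (cmod (f x)) \<partial>count_space A)"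
    unfolding eventually_finite_subsets_at_top by (intro exI[of _ "{}"]) auto
qed simp

lemma nn_integral_count_space_mono_set:
  "A \<subseteq> B \<Longrightarrow> (\<integral>\<^sup>+x. f x \<partial>count_space A) \<le> (\<integral>\<^sup>+x. f x \<partial>count_space B)"
  by (auto simp: nn_integral_count_space_indicator[of A] nn_integral_count_space_indicator[of B]
      intro!: nn_integral_mono split: split_indicator)

text \<open>Counting measure on the lattice is invariant under translation and reflection. Both
  terms of Young's inequality therefore sum to the same product.\<close>

lemma nn_integral_convolution:
  fixes V G :: "int^'d::finite \<Rightarrow> ennreal"
  shows "(\<integral>\<^sup>+k. \<integral>\<^sup>+l. V (k - l) * G k \<partial>count_space UNIV \<partial>count_space UNIV)
      = (\<integral>\<^sup>+q. V q \<partial>count_space UNIV) * (\<integral>\<^sup>+k. G k \<partial>count_space UNIV)"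
    and "(\<integral>\<^sup>+k. \<integral>\<^sup>+l. V (k - l) * G l \<partial>count_space UNIV \<partial>count_space UNIV)
      = (\<integral>\<^sup>+q. V q \<partial>count_space UNIV) * (\<integral>\<^sup>+k. G k \<partial>count_space UNIV)"
proof -
  have inner: "(\<integral>\<^sup>+l. V (k - l) \<partial>count_space UNIV) = (\<integral>\<^sup>+q. V q \<partial>count_space UNIV)" for k
    by (rule nn_integral_bij_count_space[where g="\<lambda>l. k - l"])
      (auto intro!: bij_betw_byWitness[where f'="\<lambda>l. k - l"])
  have inner': "(\<integral>\<^sup>+k. V (k - l) \<partial>count_space UNIV) = (\<integral>\<^sup>+q. V q \<partial>count_space UNIV)" for l
    by (rule nn_integral_bij_count_space[where g="\<lambda>k. k - l"])
      (auto intro!: bij_betw_byWitness[where f'="\<lambda>k. k + l"])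
  show "(\<integral>\<^sup>+k. \<integral>\<^sup>+l. V (k - l) * G k \<partial>count_space UNIV \<partial>count_space UNIV)
      = (\<integral>\<^sup>+q. V q \<partial>count_space UNIV) * (\<integral>\<^sup>+k. G k \<partial>count_space UNIV)"
    by (simp add: nn_integral_multc inner nn_integral_cmult)
  have "(\<integral>\<^sup>+k. \<integral>\<^sup>+l. V (k - l) * G l \<partial>count_space UNIV \<partial>count_space UNIV)
      = (\<integral>\<^sup>+l. \<integral>\<^sup>+k. V (k - l) * G l \<partial>count_space UNIV \<partial>count_space UNIV)"
    by (rule nn_integral_count_space_nn_integral) auto
  then show "(\<integral>\<^sup>+k. \<integral>\<^sup>+l. V (k - l) * G l \<partial>count_space UNIV \<partial>count_space UNIV)
      = (\<integral>\<^sup>+q. V q \<partial>count_space UNIV) * (\<integral>\<^sup>+k. G k \<partial>count_space UNIV)"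
    by (simp add: nn_integral_multc inner' nn_integral_cmult)
qed

text \<open>The last hypothesis is there because the right-hand side vanishes for \<open>a = b = \<infinity>\<close>.\<close>

lemma weighted_young:
  fixes a b c :: ennreal
  assumes "1 \<le> a" "1 \<le> b" "a \<le> c" "b \<le> c" "0 \<le> x" "0 \<le> y" "0 \<le> u" "u = 0 \<or> c < \<infinity>"
  shows "ennreal (u * x * y) \<le> ennreal (1/2) * ((c * ennreal u) * (inverse a * ennreal (x\<^sup>2))
      + (c * ennreal u) * (inverse b * ennreal (y\<^sup>2)))"
proof (cases "u = 0")
  case False
  then have c: "c < \<infinity>" using assms by auto
  have ge: "ennreal z \<le> c * (inverse d * ennreal z)" if "1 \<le> d" "d \<le> c" for d z
  proof -
    have d: "d \<noteq> 0" "d \<noteq> top" using that c by (auto simp: top_unique)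
    then have "1 = d * inverse d"
      by (cases d rule: ennreal_cases) (auto simp: inverse_ennreal ennreal_mult[symmetric] less_le)
    also have "\<dots> \<le> c * inverse d" by (intro mult_right_mono that) simp
    finally have "1 * ennreal z \<le> (c * inverse d) * ennreal z" by (rule mult_right_mono) simp
    then show ?thesis by (simp add: mult.assoc)
  qed
  have "2 * (u * x * y) \<le> u * x\<^sup>2 + u * y\<^sup>2"
    using mult_left_mono[OF sum_squares_bound[of x y] assms(7)] by (simp add: algebra_simps)
  then have "ennreal (u * x * y) \<le> ennreal (1/2 * (u * x\<^sup>2 + u * y\<^sup>2))"
    by (intro ennreal_leI) simp
  also have "\<dots> = ennreal (1/2) * (ennreal u * ennreal (x\<^sup>2) + ennreal u * ennreal (y\<^sup>2))"
    using assms by (subst ennreal_mult) (auto simp: ennreal_mult ennreal_plus)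
  also have "\<dots> \<le> ennreal (1/2) * (ennreal u * (c * (inverse a * ennreal (x\<^sup>2)))
      + ennreal u * (c * (inverse b * ennreal (y\<^sup>2))))"
    by (intro mult_left_mono add_mono ge assms) auto
  finally show ?thesis by (simp add: mult_ac)
qed simp

section \<open>Triads and the flux through the shell\<close>

context velocity_field
begin

text \<open>The energy passing from mode \<open>l\<close> to mode \<open>k\<close> through the
  velocity mode \<open>k - l\<close>. The derivative contributes the factor \<open>k\<close>;
  incompressibility makes it interchangeable with \<open>l\<close>, and with \<open>k\<close> the
  low frequency it will be bounded by r.\<close>

definition "triad f k l = 2 * pi * \<i> * (\<Sum>j\<in>UNIV. of_int (k $ j) * fourier (comp_fun v j) (k - l))
  * (fourier f l * cnj (fourier f k))"

lemma triad_has_sum: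
  assumes f: "f \<in> H1_torus"
  shows "((\<lambda>l. triad f k l) has_sum transfer f k) UNIV"
proof -
  have "((\<lambda>l. cnj (fourier f k) * (2 * pi * \<i> * (\<Sum>j\<in>UNIV. of_int (k $ j) * (fourier f l * fourier (comp_fun v j) (k - l)))))
     has_sum transfer f k) UNIV"
    unfolding fourier_advection[OF f]
    by (intro has_sum_cmult_right has_sum_sum fourier_mult_has_sum H1_L2 f)
  moreover have "cnj (fourier f k) * (2 * pi * \<i> * (\<Sum>j\<in>UNIV. of_int (k $ j) * (fourier f l * fourier (comp_fun v j) (k - l))))
    = triad f k l" for l
    by (simp add: triad_def sum_distrib_left sum_distrib_right mult_ac)
  ultimately show ?thesis by simp
qed

text \<open>What mode \<open>k\<close> receives from \<open>l\<close>, mode \<open>l\<close> loses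
  to \<open>k\<close>. Reality of \<open>v\<close> turns conjugation into reflection of
  \<open>k - l\<close>, and incompressibility exchanges the factors \<open>k\<close> and
  \<open>l\<close>.\<close>

lemma cnj_triad: "cnj (triad f k l) = - triad f l k"
proof -
  have "(\<Sum>j\<in>UNIV. of_int (l $ j) * fourier (comp_fun v j) (l - k))
      - (\<Sum>j\<in>UNIV. of_int (k $ j) * fourier (comp_fun v j) (l - k))
    = (\<Sum>j\<in>UNIV. of_int ((l - k) $ j) * fourier (comp_fun v j) (l - k))"
    by (simp add: sum_subtractf[symmetric] left_diff_distrib)
  then have "(\<Sum>j\<in>UNIV. of_int (l $ j) * fourier (comp_fun v j) (l - k))
    = (\<Sum>j\<in>UNIV. of_int (k $ j) * fourier (comp_fun v j) (l - k))"
    by (simp only: div_fourier) simp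
  then show ?thesis by (simp add: triad_def fourier_comp_reflect mult_ac)
qed

lemma norm_triad_le:
  "cmod (triad f k l) \<le> 2 * pi * norm (freq k) * (norm (fourier_vec v (k - l)) * cmod (fourier f k) * cmod (fourier f l))"
proof -
  have "cmod (\<Sum>j\<in>UNIV. of_int (k $ j) * fourier (comp_fun v j) (k - l))
    \<le> (\<Sum>j\<in>UNIV. \<bar>freq k $ j\<bar> * \<bar>norm (fourier_vec v (k - l) $ j)\<bar>)"
    by (rule order_trans[OF norm_sum]) (simp add: norm_mult fourier_vec_def)
  also have "\<dots> \<le> norm (freq k) * norm (fourier_vec v (k - l))"
    unfolding norm_vec_def using L2_set_mult_ineq[of "\<lambda>j. freq k $ j" "\<lambda>j. norm (fourier_vec v (k - l) $ j)" UNIV]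
    by (simp add: L2_set_def)
  finally have "cmod (\<Sum>j\<in>UNIV. of_int (k $ j) * fourier (comp_fun v j) (k - l)) * (2 * pi * (cmod (fourier f l) * cmod (fourier f k)))
    \<le> norm (freq k) * norm (fourier_vec v (k - l)) * (2 * pi * (cmod (fourier f l) * cmod (fourier f k)))"
    by (intro mult_right_mono) auto
  then show ?thesis by (simp add: triad_def norm_mult mult_ac)
qed

lemma low_frequency_flux_bound:
  fixes w :: "real \<Rightarrow> ennreal"
  assumes f: "f \<in> H1_torus" and r: "0 < r"
    and w: "mono_on {0..} w" "\<And>z. 0 \<le> z \<Longrightarrow> 1 \<le> w z"
    and fin: "weighted_l1_norm w v < \<infinity>"
  shows "ennreal \<bar>\<Sum>k | norm (freq k) < r. Re (transfer f k)\<bar>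
    \<le> ennreal (2 * pi * r) * (weighted_l1_norm w v * weight_conv w f r)"
proof -
  let ?lo = "{k :: int^'d. norm (freq k) < r}"
  let ?cs = "count_space (UNIV :: (int^'d) set)"
  let ?D = "\<Sum>l\<in>?lo. \<Sum>k\<in>?lo. triad f k l"
  have lo: "finite ?lo" by (rule finite_freq_ball)
  define Z where "Z = (\<Sum>k\<in>?lo. transfer f k)"
  have "((\<lambda>l. \<Sum>k\<in>?lo. triad f k l) has_sum Z) UNIV"
    unfolding Z_def by (intro has_sum_sum triad_has_sum f)
  \<comment> \<open>Removing the finitely many low \<open>l\<close> leaves the flux across the
    shell. The removed part \<open>?D\<close> is minus its own conjugate by
    \<open>cnj_triad\<close>, hence invisible in the real part.\<close>
  then have hs: "((\<lambda>l. \<Sum>k\<in>?lo. triad f k l) has_sum (Z - ?D)) (UNIV - ?lo)"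
    by (rule has_sum_Diff) (use lo in auto)
  have "Re ?D = 0"
  proof -
    have "cnj ?D = - (\<Sum>l\<in>?lo. \<Sum>k\<in>?lo. triad f l k)"
      by (simp add: cnj_triad sum_negf)
    also have "(\<Sum>l\<in>?lo. \<Sum>k\<in>?lo. triad f l k) = ?D"
      by (rule sum.swap)
    finally have "Re (cnj ?D) = Re (- ?D)"
      by (rule arg_cong)
    then show ?thesis by simp
  qed
  then have ReZ: "\<bar>Re Z\<bar> \<le> cmod (Z - ?D)"
    using abs_Re_le_cmod[of "Z - ?D"] by simp
  define V where "V q = w (norm (freq q)) * ennreal (norm (fourier_vec v q))" for q
  define G where "G k = inverse (w \<bar>r - norm (freq k)\<bar>) * ennreal ((cmod (fourier f k))\<^sup>2)" for k
  let ?Y = "\<lambda>k l. ennreal (2 * pi * r) * (ennreal (1/2) * (V (k - l) * G k + V (k - l) * G l))"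
  have V_fin: "V q < \<infinity>" for q
  proof -
    have "V q \<le> weighted_l1_norm w v"
      unfolding weighted_l1_norm_def V_def by (rule nn_integral_ge_point) simp
    then show ?thesis using fin by (rule le_less_trans)
  qed
  have triad_le: "ennreal (cmod (triad f k l)) \<le> ?Y k l"
    if k: "k \<in> ?lo" and l: "l \<in> UNIV - ?lo" for k l
  proof -
    let ?u = "norm (fourier_vec v (k - l))"
    have "cmod (triad f k l) \<le> 2 * pi * r * (?u * cmod (fourier f k) * cmod (fourier f l))"
      using k by (intro order_trans[OF norm_triad_le] mult_right_mono) (auto intro!: mult_nonneg_nonneg)
    then have "ennreal (cmod (triad f k l)) \<le> ennreal (2 * pi * r) * ennreal (?u * cmod (fourier f k) * cmod (fourier f l))"
      using r by (subst ennreal_mult[symmetric]) (auto intro!: ennreal_leI)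
    also have "ennreal (?u * cmod (fourier f k) * cmod (fourier f l))
      \<le> ennreal (1/2) * (V (k - l) * G k + V (k - l) * G l)"
      unfolding V_def G_def
    proof (rule weighted_young)
      \<comment> \<open>Since |k| < r \<le> |l|, the number r lies between |k| and |l|, whose
        distance is at most |k - l|. The weight is monotone, so its value at |k - l| dominates both
        values it has to pay for.\<close>
      have "norm (freq l) - norm (freq k) \<le> norm (freq (k - l))"
        using norm_triangle_ineq2[of "freq l" "freq k"] by (simp add: freq_diff norm_minus_commute)
      then have "\<bar>r - norm (freq k)\<bar> \<le> norm (freq (k - l))" "\<bar>r - norm (freq l)\<bar> \<le> norm (freq (k - l))"
        using k l by auto
      then show "w \<bar>r - norm (freq k)\<bar> \<le> w (norm (freq (k - l)))" "w \<bar>r - norm (freq l)\<bar> \<le> w (norm (freq (k - l)))"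
        using w(1) by (auto simp: mono_on_def)
      \<comment> \<open>Finiteness of the weighted norm excludes an infinite weight on a frequency
        that the velocity actually carries.\<close>
      show "?u = 0 \<or> w (norm (freq (k - l))) < \<infinity>"
        using V_fin[of "k - l"] by (auto simp: V_def ennreal_mult_less_top)
    qed (use w(2) in auto)
    finally show ?thesis by (simp add: mult_left_mono)
  qed
  have "ennreal \<bar>Re Z\<bar> \<le> (\<integral>\<^sup>+l. ennreal (cmod (\<Sum>k\<in>?lo. triad f k l)) \<partial>count_space (UNIV - ?lo))"
    by (rule order_trans[OF ennreal_leI[OF ReZ] norm_has_sum_le_nn_integral[OF hs]])
  also have "\<dots> \<le> (\<integral>\<^sup>+l. (\<integral>\<^sup>+k. ?Y k l \<partial>count_space ?lo) \<partial>count_space (UNIV - ?lo))"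
  proof (rule nn_integral_mono)
    fix l assume l: "l \<in> space (count_space (UNIV - ?lo))"
    have "ennreal (cmod (\<Sum>k\<in>?lo. triad f k l)) \<le> (\<Sum>k\<in>?lo. ennreal (cmod (triad f k l)))"
      by (simp add: sum_ennreal ennreal_leI norm_sum)
    also have "\<dots> \<le> (\<Sum>k\<in>?lo. ?Y k l)"
      by (intro sum_mono triad_le) (use l in auto)
    also have "\<dots> = (\<integral>\<^sup>+k. ?Y k l \<partial>count_space ?lo)"
      using lo by (simp add: nn_integral_count_space_finite)
    finally show "ennreal (cmod (\<Sum>k\<in>?lo. triad f k l))
      \<le> (\<integral>\<^sup>+k. ?Y k l \<partial>count_space ?lo)" .
  qed
  \<comment> \<open>The terms are nonnegative; extending both sums to the whole lattice makes the
    convolutions factor.\<close>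
  also have "\<dots> \<le> (\<integral>\<^sup>+l. (\<integral>\<^sup>+k. ?Y k l \<partial>?cs) \<partial>?cs)"
    by (rule order_trans[OF nn_integral_mono nn_integral_count_space_mono_set])
      (auto intro: nn_integral_count_space_mono_set)
  also have "\<dots> = ennreal (2 * pi * r) * (ennreal (1/2) *
      ((\<integral>\<^sup>+l. \<integral>\<^sup>+k. V (k - l) * G k \<partial>?cs \<partial>?cs) + (\<integral>\<^sup>+l. \<integral>\<^sup>+k. V (k - l) * G l \<partial>?cs \<partial>?cs)))"
    by (simp add: nn_integral_cmult nn_integral_add)
  also have "(\<integral>\<^sup>+l. \<integral>\<^sup>+k. V (k - l) * G k \<partial>?cs \<partial>?cs) = (\<integral>\<^sup>+k. \<integral>\<^sup>+l. V (k - l) * G k \<partial>?cs \<partial>?cs)"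
    by (rule nn_integral_count_space_nn_integral) auto
  also have "(\<integral>\<^sup>+l. \<integral>\<^sup>+k. V (k - l) * G l \<partial>?cs \<partial>?cs) = (\<integral>\<^sup>+k. \<integral>\<^sup>+l. V (k - l) * G l \<partial>?cs \<partial>?cs)"
    by (rule nn_integral_count_space_nn_integral) auto
  also have "ennreal (2 * pi * r) * (ennreal (1/2) *
      ((\<integral>\<^sup>+k. \<integral>\<^sup>+l. V (k - l) * G k \<partial>?cs \<partial>?cs) + (\<integral>\<^sup>+k. \<integral>\<^sup>+l. V (k - l) * G l \<partial>?cs \<partial>?cs)))
    = ennreal (2 * pi * r) * (weighted_l1_norm w v * weight_conv w f r)"
  proof -
    have half: "ennreal (1/2) * (x + x) = x" for x :: ennreal
    proof -
      have "ennreal (1/2) * (x + x) = (ennreal (1/2) * 2) * x"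
        by (simp only: mult_2[symmetric] mult.assoc)
      also have "ennreal (1/2) * 2 = 1"
      proof -
        have "ennreal (1/2) * ennreal 2 = ennreal (1/2 * 2)" by (rule ennreal_mult[symmetric]) auto
        then show ?thesis by (simp only: ennreal_numeral) simp
      qed
      finally show ?thesis by simp
    qed
    have "weighted_l1_norm w v = (\<integral>\<^sup>+q. V q \<partial>?cs)" "weight_conv w f r = (\<integral>\<^sup>+k. G k \<partial>?cs)"
      by (simp_all add: weighted_l1_norm_def V_def weight_conv_eq G_def)
    then show ?thesis
      by (simp only: nn_integral_convolution half)
  qed
  finally show ?thesis by (simp add: Z_def)
qed

lemma flux_bound:
  fixes w :: "real \<Rightarrow> ennreal"
  assumes f: "f \<in> H1_torus" and r: "0 \<le> r"
    and w: "mono_on {0..} w" "\<And>z. 0 \<le> z \<Longrightarrow> 1 \<le> w z"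
  shows "ereal (2 * (\<Sum>k | norm (freq k) < r. Re (transfer f k)))
    \<le> enn2ereal (ennreal (4 * pi * r) * flux_product (weighted_l1_norm w v) (weight_conv w f r))"
proof (cases "r = 0")
  case True
  \<comment> \<open>At r = 0 the right-hand side is 0 even if the weighted norm is infinite, by
    \<open>0 * \<infinity> = 0\<close> in \<open>ennreal\<close>. There are no lower modes, so the
    left-hand side is 0 as well.\<close>
  then have "{k :: int^'d. norm (freq k) < r} = {}" by auto
  then show ?thesis by (simp add: zero_ereal_def[symmetric] enn2ereal_nonneg)
next
  case False
  then have r0: "0 < r" using r by simp
  show ?thesis
  proof (cases "weighted_l1_norm w v = \<infinity>")
    case True
    then have "ennreal (4 * pi * r) * flux_product (weighted_l1_norm w v) (weight_conv w f r) = \<infinity>"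
      using r0 by (simp add: flux_product_def ennreal_mult_eq_top_iff)
    then show ?thesis by simp
  next
    case fin: False
    let ?s = "\<Sum>k | norm (freq k) < r. Re (transfer f k)"
    have "ennreal (2 * \<bar>?s\<bar>) = ennreal 2 * ennreal \<bar>?s\<bar>" by (rule ennreal_mult) auto
    also have "\<dots> \<le> ennreal 2 * (ennreal (2 * pi * r) * (weighted_l1_norm w v * weight_conv w f r))"
      by (intro mult_left_mono low_frequency_flux_bound f r0 w) (use fin in \<open>auto simp: less_top\<close>)
    also have "\<dots> = ennreal (4 * pi * r) * flux_product (weighted_l1_norm w v) (weight_conv w f r)"
    proof -
      have "ennreal 2 * ennreal (2 * pi * r) = ennreal (4 * pi * r)"
        using r by (subst ennreal_mult[symmetric]) auto
      then show ?thesis using fin by (simp only: flux_product_def if_False mult.assoc[symmetric])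
    qed
    finally have "enn2ereal (ennreal (2 * \<bar>?s\<bar>))
      \<le> enn2ereal (ennreal (4 * pi * r) * flux_product (weighted_l1_norm w v) (weight_conv w f r))"
      by (simp only: less_eq_ennreal.rep_eq)
    moreover have "ereal (2 * ?s) \<le> enn2ereal (ennreal (2 * \<bar>?s\<bar>))"
      by (simp add: enn2ereal_ennreal)
    ultimately show ?thesis by (rule order_trans[rotated])
  qed
qed

end

subsection \<open>The energy identity and the high-frequency balance\<close>

definition heat_sum :: "(int^'d::finite \<Rightarrow> 'a \<Rightarrow> real) \<Rightarrow> nat \<Rightarrow> nat \<Rightarrow> 'a \<Rightarrow> real" where
  "heat_sum a n m s = (\<Sum>k\<in>freq_ball m. heat (1 / real (Suc n)) k * a k s)"

text \<open>The sum over all modes, encoded as an iterated limit of sequences so that it is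
  measurable in \<open>s\<close> even on the null set where the modes are not summable.\<close>

definition heat_lim :: "(int^'d::finite \<Rightarrow> 'a \<Rightarrow> real) \<Rightarrow> 'a \<Rightarrow> real" where
  "heat_lim a s = lim (\<lambda>n. lim (\<lambda>m. heat_sum a n m s))"

abbreviation heat_mean :: "(int^'d::finite \<Rightarrow> 'a \<Rightarrow> real) \<Rightarrow> nat \<Rightarrow> 'a \<Rightarrow> real" where
  "heat_mean a n s \<equiv> \<Sum>\<^sub>\<infinity>k. heat (1 / real (Suc n)) k * a k s"

lemma heat_sum_tendsto:
  assumes "(\<lambda>k. \<bar>a k s\<bar>) summable_on UNIV"
  shows "(\<lambda>m. heat_sum a n m s) \<longlonglongrightarrow> heat_mean a n s"
  unfolding heat_sum_def by (rule has_sum_freq_ball) (simp add: heat_summable(2)[OF assms])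

lemma heat_lim_inner:
  assumes "(\<lambda>k. \<bar>a k s\<bar>) summable_on UNIV"
  shows "lim (\<lambda>m. heat_sum a n m s) = heat_mean a n s"
  by (rule limI[OF heat_sum_tendsto[of a s, OF assms]])

lemma heat_lim_tendsto:
  assumes "(\<lambda>k. \<bar>a k s\<bar>) summable_on UNIV"
  shows "(\<lambda>n. lim (\<lambda>m. heat_sum a n m s)) \<longlonglongrightarrow> (\<Sum>\<^sub>\<infinity>k. a k s)"
  unfolding heat_lim_inner[of a s, OF assms] by (rule infsum_heat_tendsto[OF assms])

lemma heat_lim_eq:
  assumes "(\<lambda>k. \<bar>a k s\<bar>) summable_on UNIV"
  shows "heat_lim a s = (\<Sum>\<^sub>\<infinity>k. a k s)"
  unfolding heat_lim_def by (rule limI[OF heat_lim_tendsto[of a s, OF assms]])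

text \<open>Dominated convergence twice. The constant \<open>C n\<close> for removing the truncation
  may depend on the mollification, whereas \<open>D\<close>, for removing the mollification
  afterwards, may not. This is why the limits are iterated in this order.\<close>

lemma heat_lim_integral:
  fixes a :: "int^'d::finite \<Rightarrow> 'a \<Rightarrow> real"
  assumes m [measurable]: "\<And>k. a k \<in> borel_measurable M"
    and W: "(\<integral>\<^sup>+s. W s \<partial>M) < \<infinity>"
    and summ: "AE s in M. (\<lambda>k. \<bar>a k s\<bar>) summable_on UNIV"
    and C: "\<And>n. 0 < C n" "\<And>n. AE s in M. \<forall>m. ennreal \<bar>heat_sum a n m s\<bar> \<le> ennreal (C n) * W s"
    and D: "0 < D" "AE s in M. \<forall>n. ennreal \<bar>heat_mean a n s\<bar> \<le> ennreal D * W s"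
  shows "integrable M (heat_lim a)"
    and "\<exists>J. (\<forall>n. (\<lambda>m. \<integral>s. heat_sum a n m s \<partial>M) \<longlonglongrightarrow> J n) \<and> J \<longlonglongrightarrow> (\<integral>s. heat_lim a s \<partial>M)"
proof -
  have m1 [measurable]: "(\<lambda>s. heat_sum a n m s) \<in> borel_measurable M" for n m
    unfolding heat_sum_def by measurable
  have m2: "(\<lambda>s. lim (\<lambda>m. heat_sum a n m s)) \<in> borel_measurable M" for n by measurable
  have conv: "AE s in M. convergent (\<lambda>m. heat_sum a n m s)" for n
    using summ by eventually_elim (rule convergentI[OF heat_sum_tendsto[of a]])
  note inner = dominated_convergence_nn_majorant[where R="\<lambda>m s. heat_sum a n m s" and C="C n" and W=W for n,
      OF m1 C(1) C(2) W conv]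
  have dom: "AE s in M. \<forall>n. ennreal \<bar>lim (\<lambda>m. heat_sum a n m s)\<bar> \<le> ennreal D * W s"
    using D(2) summ by eventually_elim (simp add: heat_lim_inner)
  have conv2: "AE s in M. convergent (\<lambda>n. lim (\<lambda>m. heat_sum a n m s))"
    using summ by eventually_elim (rule convergentI[OF heat_lim_tendsto[of a]])
  note outer = dominated_convergence_nn_majorant[where R="\<lambda>n s. lim (\<lambda>m. heat_sum a n m s)" and C=D and W=W,
      OF m2 D(1) dom W conv2]
  show "integrable M (heat_lim a)" using outer(2) by (simp add: heat_lim_def[abs_def])
  show "\<exists>J. (\<forall>n. (\<lambda>m. \<integral>s. heat_sum a n m s \<partial>M) \<longlonglongrightarrow> J n) \<and> J \<longlonglongrightarrow> (\<integral>s. heat_lim a s \<partial>M)"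
    using inner(3) outer(3) by (intro exI[of _ "\<lambda>n. \<integral>s. lim (\<lambda>m. heat_sum a n m s) \<partial>M"]) (simp add: heat_lim_def)
qed

lemma abs_integrable_lebesgue_on:
  fixes f :: "real \<Rightarrow> real"
  assumes "f absolutely_integrable_on {0..T}"
  shows "integrable (lebesgue_on {0..T}) f"
  using assms by (simp add: set_integrable_def integrable_restrict_space)

lemma lebesgue_on_abs_integrable:
  fixes f :: "real \<Rightarrow> real"
  assumes "integrable (lebesgue_on {0..T}) f"
  shows "f absolutely_integrable_on {0..T}"
  using assms by (simp add: set_integrable_def integrable_restrict_space)

section \<open>Fourier modes of the solution for one realisation of the velocity\<close>

locale advected =
  fixes \<nu> :: real and v :: "real \<Rightarrow> real^'d::finite \<Rightarrow> real^'d"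
    and g :: "real^'d \<Rightarrow> complex" and f :: "real \<Rightarrow> real^'d \<Rightarrow> complex"
  assumes \<nu>: "0 < \<nu>" and adm: "admissible_velocity v"
    and sol: "advection_diffusion_solution \<nu> v g f"
begin

definition "c k t = fourier (f t) k"
definition "rhs k t = fourier (advection (v t) (f t)) k + of_real (\<nu> * (2 * pi * norm (freq k))\<^sup>2) * c k t"
definition "b k t = Re (cnj (c k t) * fourier (advection (v t) (f t)) k)"
definition "dissip k t = (2 * pi * norm (freq k))\<^sup>2 * (cmod (c k t))\<^sup>2"
text \<open>The time derivative of |c_k|^2, split into nonlinear transfer and viscous loss.\<close>

definition "energy_rate k t = - 2 * b k t - 2 * \<nu> * dissip k t"
definition "good t \<longleftrightarrow> v t \<in> W1inf_torus \<and> divergence_free (v t) \<and> f t \<in> H1_torus"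

lemma fL2: "0 \<le> t \<Longrightarrow> f t \<in> L2_torus"
  using sol by (simp add: advection_diffusion_solution_def)

lemma AE_good: "AE t in lebesgue. 0 \<le> t \<longrightarrow> good t"
proof -
  have "AE t in lebesgue. 0 \<le> t \<longrightarrow> v t \<in> W1inf_torus \<and> divergence_free (v t)"
    using adm by (simp add: admissible_velocity_def)
  moreover have "AE t in lebesgue. 0 \<le> t \<longrightarrow> f t \<in> H1_torus"
    using sol by (simp add: advection_diffusion_solution_def)
  ultimately show ?thesis by eventually_elim (simp add: good_def)
qed

lemma rhs_integrable: "0 \<le> t \<Longrightarrow> rhs k absolutely_integrable_on {0..t}"
  and c_rhs: "0 \<le> t \<Longrightarrow> c k t = fourier g k - integral {0..t} (rhs k)"
proof -
  have rhs: "rhs k = (\<lambda>s. fourier (advection (v s) (f s)) k + of_real (\<nu> * (2 * pi * norm (freq k))\<^sup>2) * fourier (f s) k)"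
    by (rule ext) (simp only: rhs_def c_def)
  have "\<forall>k. \<forall>t\<ge>0. let F = (\<lambda>s. fourier (advection (v s) (f s)) k
                  + of_real (\<nu> * (2 * pi * norm (freq k))\<^sup>2) * fourier (f s) k)
        in F absolutely_integrable_on {0..t} \<and> fourier (f t) k = fourier g k - integral {0..t} F"
    using sol unfolding advection_diffusion_solution_def by (elim conjE)
  then show "0 \<le> t \<Longrightarrow> rhs k absolutely_integrable_on {0..t}"
    "0 \<le> t \<Longrightarrow> c k t = fourier g k - integral {0..t} (rhs k)"
    unfolding Let_def rhs c_def by (blast, blast)
qed

lemma c_eq: "0 \<le> t \<Longrightarrow> c k t = c k 0 - integral {0..t} (rhs k)"
  using c_rhs[of t k] c_rhs[of 0 k] by simp

lemma c_parts:
  assumes "0 \<le> t"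
  shows "(\<lambda>s. - Re (rhs k s)) absolutely_integrable_on {0..t}" "(\<lambda>s. - Im (rhs k s)) absolutely_integrable_on {0..t}"
    and "Re (c k t) = Re (c k 0) + integral {0..t} (\<lambda>s. - Re (rhs k s))"
    and "Im (c k t) = Im (c k 0) + integral {0..t} (\<lambda>s. - Im (rhs k s))"
proof -
  have bl: "bounded_linear (\<lambda>z. - Re z)" "bounded_linear (\<lambda>z. - Im z)"
    by (intro bounded_linear_minus bounded_linear_Re bounded_linear_Im)+
  show "(\<lambda>s. - Re (rhs k s)) absolutely_integrable_on {0..t}" "(\<lambda>s. - Im (rhs k s)) absolutely_integrable_on {0..t}"
    using absolutely_integrable_linear[OF rhs_integrable[OF assms, of k] bl(1)]
      absolutely_integrable_linear[OF rhs_integrable[OF assms, of k] bl(2)] by (simp_all add: o_def)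
  have i: "rhs k integrable_on {0..t}"
    by (rule set_lebesgue_integral_eq_integral[OF rhs_integrable[OF assms]])
  show "Re (c k t) = Re (c k 0) + integral {0..t} (\<lambda>s. - Re (rhs k s))"
    using integral_linear[OF i bl(1)] c_eq[OF assms, of k] by (simp add: o_def)
  show "Im (c k t) = Im (c k 0) + integral {0..t} (\<lambda>s. - Im (rhs k s))"
    using integral_linear[OF i bl(2)] c_eq[OF assms, of k] by (simp add: o_def)
qed

lemma energy_rate_eq: "energy_rate k s = 2 * Re (c k s) * (- Re (rhs k s)) + 2 * Im (c k s) * (- Im (rhs k s))"
  unfolding energy_rate_def b_def dissip_def rhs_def cmod_power2
  by (simp add: algebra_simps power2_eq_square)

lemma energy_rate_integral:
  assumes T: "0 \<le> T"
  shows "energy_rate k absolutely_integrable_on {0..T}"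
    and "(cmod (c k T))\<^sup>2 = (cmod (c k 0))\<^sup>2 + integral {0..T} (energy_rate k)"
proof -
  note R = indefinite_integral_square[OF c_parts(1)[OF T, of k] T, of "\<lambda>t. Re (c k t)"]
  note I = indefinite_integral_square[OF c_parts(2)[OF T, of k] T, of "\<lambda>t. Im (c k t)"]
  have R1: "(\<lambda>s. 2 * Re (c k s) * (- Re (rhs k s))) absolutely_integrable_on {0..T}"
    and R2: "(Re (c k T))\<^sup>2 = (Re (c k 0))\<^sup>2 + integral {0..T} (\<lambda>s. 2 * Re (c k s) * (- Re (rhs k s)))"
    by (rule R, rule c_parts(3), simp)+
  have I1: "(\<lambda>s. 2 * Im (c k s) * (- Im (rhs k s))) absolutely_integrable_on {0..T}"
    and I2: "(Im (c k T))\<^sup>2 = (Im (c k 0))\<^sup>2 + integral {0..T} (\<lambda>s. 2 * Im (c k s) * (- Im (rhs k s)))"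
    by (rule I, rule c_parts(4), simp)+
  show "energy_rate k absolutely_integrable_on {0..T}"
    unfolding energy_rate_eq[abs_def] by (rule set_integral_add(1)[OF R1 I1])
  have "integral {0..T} (energy_rate k) = integral {0..T} (\<lambda>s. 2 * Re (c k s) * (- Re (rhs k s)))
      + integral {0..T} (\<lambda>s. 2 * Im (c k s) * (- Im (rhs k s)))"
    unfolding energy_rate_eq[abs_def]
    by (rule Henstock_Kurzweil_Integration.integral_add)
      (rule set_lebesgue_integral_eq_integral(1)[OF R1] set_lebesgue_integral_eq_integral(1)[OF I1])+
  then show "(cmod (c k T))\<^sup>2 = (cmod (c k 0))\<^sup>2 + integral {0..T} (energy_rate k)"
    using R2 I2 by (simp add: cmod_power2)
qed

lemma dissip_integrable:
  assumes T: "0 \<le> T" shows "dissip k absolutely_integrable_on {0..T}"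
proof -
  have i: "rhs k integrable_on {0..T}"
    by (rule set_lebesgue_integral_eq_integral[OF rhs_integrable[OF assms]])
  have "continuous_on {0..T} (\<lambda>t. c k 0 - integral {0..t} (rhs k))"
    by (intro continuous_intros indefinite_integral_continuous_1 i)
  then have "continuous_on {0..T} (c k)"
    by (rule continuous_on_eq) (rule c_eq[symmetric], simp)
  then show ?thesis
    unfolding dissip_def[abs_def] by (intro absolutely_integrable_continuous_real continuous_intros)
qed

text \<open>The advection term is given in time only as a part of \<open>rhs\<close>, so the
  integrability of \<open>b k\<close> is recovered from that of \<open>energy_rate k\<close> by
  subtracting the dissipation, which is continuous because the mode is.\<close>

lemma b_integrable:
  assumes T: "0 \<le> T" shows "b k absolutely_integrable_on {0..T}"
proof -
  have "(\<lambda>s. (- 1/2) *\<^sub>R energy_rate k s + (- \<nu>) *\<^sub>R dissip k s) absolutely_integrable_on {0..T}"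
    by (intro set_integral_add(1) absolutely_integrable_scaleR_left energy_rate_integral(1) dissip_integrable T)
  moreover have "(- 1/2) *\<^sub>R energy_rate k s + (- \<nu>) *\<^sub>R dissip k s = b k s" for s
    by (simp add: energy_rate_def algebra_simps)
  ultimately show ?thesis by simp
qed

lemma energy_bounded:
  obtains A where "0 < A" "\<And>t. t \<in> {0..T} \<Longrightarrow> (L2_norm (f t))\<^sup>2 \<le> A"
proof -
  have "continuous_on {0..T} (\<lambda>t. L2_norm (f t))"
    unfolding continuous_on_def
  proof
    fix t assume t: "t \<in> {0..T}"
    have "((\<lambda>s. L2_norm (\<lambda>x. f s x - f t x)) \<longlongrightarrow> 0) (at t within {0..})"
      using sol t by (simp add: advection_diffusion_solution_def)
    then have lim: "((\<lambda>s. L2_norm (\<lambda>x. f s x - f t x)) \<longlongrightarrow> 0) (at t within {0..T})"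
      by (rule tendsto_within_subset) auto
    have ev: "\<forall>\<^sub>F s in at t within {0..T}. norm (L2_norm (f s) - L2_norm (f t)) \<le> L2_norm (\<lambda>x. f s x - f t x)"
      unfolding eventually_at_filter
      by (rule always_eventually) (use t L2_norm_diff_le[OF fL2 fL2] in auto)
    show "((\<lambda>t. L2_norm (f t)) \<longlongrightarrow> L2_norm (f t)) (at t within {0..T})"
      by (rule LIM_zero_cancel[OF Lim_null_comparison[OF ev lim]])
  qed
  then have "bounded ((\<lambda>t. L2_norm (f t)) ` {0..T})"
    by (intro compact_imp_bounded compact_continuous_image) auto
  then obtain B where B: "0 < B" "\<And>t. t \<in> {0..T} \<Longrightarrow> \<bar>L2_norm (f t)\<bar> \<le> B"
    unfolding bounded_pos by auto
  show thesis
  proof (rule that[of "B\<^sup>2"])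
    show "(L2_norm (f t))\<^sup>2 \<le> B\<^sup>2" if "t \<in> {0..T}" for t
      using B(2)[OF that] by (intro power_mono) auto
  qed (use B in simp)
qed

lemma AE_good_on: "AE t in lebesgue_on {0..T}. good t"
  using AE_good by (subst AE_restrict_space_iff) (auto elim!: eventually_mono)

lemma velocity_field_good: "good t \<Longrightarrow> velocity_field (v t)"
  by (simp add: good_def velocity_field_def)

lemma b_has_sum:
  assumes "good t"
  shows "((\<lambda>k. b k t) has_sum 0) UNIV" "(\<lambda>k. \<bar>b k t\<bar>) summable_on UNIV"
proof -
  interpret velocity_field "v t" by (rule velocity_field_good[OF assms])
  have f: "f t \<in> H1_torus" using assms by (simp add: good_def)
  have hs: "((\<lambda>k. Re (fourier (advection (v t) (f t)) k * cnj (fourier (f t) k))) has_sum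
      Re (ip (advection (v t) (f t)) (f t))) UNIV"
    by (rule has_sum_Re[OF parseval[OF advection_L2[OF f] H1_L2[OF f]]])
  then show "((\<lambda>k. b k t) has_sum 0) UNIV"
    by (simp add: b_def c_def Re_ip_advection[OF f] mult.commute)
  then have "(\<lambda>k. b k t) summable_on UNIV" by (rule has_sum_imp_summable)
  then show "(\<lambda>k. \<bar>b k t\<bar>) summable_on UNIV"
    using summable_on_iff_abs_summable_on_real by force
qed

lemma dissip_has_sum:
  assumes "good t"
  shows "((\<lambda>k. dissip k t) has_sum (\<Sum>j\<in>UNIV. (L2_norm (weak_deriv j (f t)))\<^sup>2)) UNIV"
    and "\<And>k. dissip k t = (\<Sum>j\<in>UNIV. (cmod (fourier (weak_deriv j (f t)) k))\<^sup>2)"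
proof -
  have f: "f t \<in> H1_torus" using assms by (simp add: good_def)
  show eq: "\<And>k. dissip k t = (\<Sum>j\<in>UNIV. (cmod (fourier (weak_deriv j (f t)) k))\<^sup>2)"
  proof -
    fix k :: "int^'d"
    have "(norm (freq k))\<^sup>2 = (\<Sum>j\<in>UNIV. (real_of_int (k $ j))\<^sup>2)"
      by (simp add: norm_vec_def L2_set_def sum_nonneg)
    then show "dissip k t = (\<Sum>j\<in>UNIV. (cmod (fourier (weak_deriv j (f t)) k))\<^sup>2)"
      by (simp add: dissip_def c_def fourier_weak_deriv[OF f] norm_mult power_mult_distrib sum_distrib_left sum_distrib_right)
  qed
  show "((\<lambda>k. dissip k t) has_sum (\<Sum>j\<in>UNIV. (L2_norm (weak_deriv j (f t)))\<^sup>2)) UNIV"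
    unfolding eq by (intro has_sum_sum parseval_norm L2_weak_deriv f)
qed

lemma dissip_nonneg: "0 \<le> dissip k t"
  by (simp add: dissip_def)

lemma dissip_summable:
  assumes "good t" shows "(\<lambda>k. \<bar>dissip k t\<bar>) summable_on UNIV"
  using has_sum_imp_summable[OF dissip_has_sum(1)[OF assms]] by (simp add: dissip_nonneg)

text \<open>At fixed n the commutator bound contains Fourier tails divided by \<sigma> = 1/(n+1).
  Estimated by \<open>sup_v\<close>, they give a constant that grows with n, harmless for the limit
  in m. In that limit the tails vanish and only the derivatives of \<open>v\<close> are left, with a
  constant independent of n.\<close>

lemma b_heat_lim:
  assumes T: "0 \<le> T"
  shows "integrable (lebesgue_on {0..T}) (heat_lim b)"
    and "\<exists>J. (\<forall>n. (\<lambda>m. \<integral>s. heat_sum b n m s \<partial>lebesgue_on {0..T}) \<longlonglongrightarrow> J n)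
      \<and> J \<longlonglongrightarrow> (\<integral>s. heat_lim b s \<partial>lebesgue_on {0..T})"
proof -
  let ?M = "lebesgue_on {0..T}"
  obtain A where A: "0 < A" "\<And>t. t \<in> {0..T} \<Longrightarrow> (L2_norm (f t))\<^sup>2 \<le> A"
    using energy_bounded[where T=T] by blast
  \<comment> \<open>The dimension times n + 1 accounts for one tail per coordinate, each at most
    \<open>sup_v * A\<close> and divided by \<sigma>.\<close>
  define C where "C n = A * (1 + real CARD('d) * real (Suc n))" for n
  have m: "b k \<in> borel_measurable ?M" for k
    using abs_integrable_lebesgue_on[OF b_integrable[OF T, of k]] by simp
  have "(\<integral>\<^sup>+t\<in>{0..T}. W1inf_norm (v t) \<partial>lebesgue) < \<infinity>"
    using adm T by (simp add: admissible_velocity_def)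
  then have W: "(\<integral>\<^sup>+t. W1inf_norm (v t) \<partial>?M) < \<infinity>"
    by (subst nn_integral_restrict_space) auto
  have pointwise: "\<forall>n m. ennreal \<bar>heat_sum b n m t\<bar> \<le> ennreal (C n) * W1inf_norm (v t) \<and>
      ennreal \<bar>heat_mean b n t\<bar> \<le> ennreal A * W1inf_norm (v t)"
    if "good t" "t \<in> {0..T}" for t
  proof -
    interpret velocity_field "v t" by (rule velocity_field_good[OF \<open>good t\<close>])
    have f: "f t \<in> H1_torus" using \<open>good t\<close> by (simp add: good_def)
    note fL = H1_L2[OF f]
    define l where "l = (\<Sum>j\<in>UNIV. \<Sum>i\<in>UNIV. lip j i)"
    have l: "0 \<le> l" unfolding l_def by (intro sum_nonneg) simp
    have N: "0 \<le> (L2_norm (f t))\<^sup>2" "(L2_norm (f t))\<^sup>2 \<le> A" using A(2)[OF that(2)] by auto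
    have bd: "\<bar>heat_sum b n m t\<bar> \<le> l * (L2_norm (f t))\<^sup>2 / 2 + (\<Sum>j\<in>UNIV. flux_tail (f t) j (freq_ball m)) * real (Suc n)" for n m
      using commutator_bound[OF f finite_freq_ball_nat[of m], of "1 / real (Suc n)"]
      by (simp add: heat_sum_def b_def c_def l_def)
    have 1: "\<bar>heat_sum b n m t\<bar> \<le> C n * (sup_v + l)" for n m
    proof -
      have "(\<Sum>j\<in>UNIV. flux_tail (f t) j (freq_ball m)) \<le> (\<Sum>j\<in>(UNIV :: 'd set). sup_v * A)"
        by (intro sum_mono order_trans[OF flux_tail_bounds(2)[OF fL]] mult_left_mono N) auto
      then have "(\<Sum>j\<in>UNIV. flux_tail (f t) j (freq_ball m)) * real (Suc n) \<le> real CARD('d) * (sup_v * A) * real (Suc n)"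
        by (intro mult_right_mono) auto
      also have "\<dots> \<le> real CARD('d) * ((sup_v + l) * A) * real (Suc n)"
        using l A by (intro mult_right_mono mult_left_mono) auto
      finally have "(\<Sum>j\<in>UNIV. flux_tail (f t) j (freq_ball m)) * real (Suc n) \<le> real CARD('d) * ((sup_v + l) * A) * real (Suc n)" .
      moreover have "l * (L2_norm (f t))\<^sup>2 / 2 \<le> (sup_v + l) * A"
      proof -
        have "l * (L2_norm (f t))\<^sup>2 / 2 \<le> l * (L2_norm (f t))\<^sup>2" using l N by simp
        also have "\<dots> \<le> (sup_v + l) * A" using l N by (intro mult_mono) auto
        finally show ?thesis .
      qed
      ultimately show ?thesis
        using bd[of n m] by (simp add: C_def algebra_simps)
    qed
    have 2: "\<bar>heat_mean b n t\<bar> \<le> A * (sup_v + l)" for n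
    proof -
      have "(\<lambda>m. flux_tail (f t) j (freq_ball m)) \<longlonglongrightarrow> (\<Sum>\<^sub>\<infinity>k. cmod (flux_coeff (f t) j k)) - (\<Sum>\<^sub>\<infinity>k. cmod (flux_coeff (f t) j k))" for j
        unfolding flux_tail_def
        by (intro tendsto_intros has_sum_freq_ball has_sum_infsum flux_coeff_summable fL)
      then have upper: "(\<lambda>m. l * (L2_norm (f t))\<^sup>2 / 2 + (\<Sum>j\<in>UNIV. flux_tail (f t) j (freq_ball m)) * real (Suc n))
        \<longlonglongrightarrow> l * (L2_norm (f t))\<^sup>2 / 2 + (\<Sum>j\<in>(UNIV::'d set). 0) * real (Suc n)"
        by (intro tendsto_intros) simp
      have lower: "(\<lambda>m. \<bar>heat_sum b n m t\<bar>) \<longlonglongrightarrow> \<bar>heat_mean b n t\<bar>"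
        by (intro tendsto_intros heat_sum_tendsto b_has_sum \<open>good t\<close>)
      have "\<bar>heat_mean b n t\<bar> \<le> l * (L2_norm (f t))\<^sup>2 / 2 + (\<Sum>j\<in>(UNIV::'d set). 0) * real (Suc n)"
        by (rule LIMSEQ_le[OF lower upper]) (use bd in blast)
      also have "\<dots> \<le> l * (L2_norm (f t))\<^sup>2" using l N by simp
      also have "\<dots> \<le> A * (sup_v + l)" using l N by (subst mult.commute) (intro mult_mono, auto)
      finally show ?thesis .
    qed
    have "0 \<le> C n" for n using A(1) by (simp add: C_def)
    then show ?thesis
      unfolding W1inf_eq l_def[symmetric] using 1 2 l A(1)
      by (auto simp: ennreal_mult[symmetric] simp del: ennreal_plus intro!: ennreal_leI)
  qed
  have dom: "AE t in ?M. \<forall>n m. ennreal \<bar>heat_sum b n m t\<bar> \<le> ennreal (C n) * W1inf_norm (v t) \<and>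
      ennreal \<bar>heat_mean b n t\<bar> \<le> ennreal A * W1inf_norm (v t)"
    using AE_good_on[of T] AE_space[of ?M]
    by eventually_elim (rule pointwise, simp_all add: space_restrict_space)
  have summ: "AE t in ?M. (\<lambda>k. \<bar>b k t\<bar>) summable_on UNIV"
    using AE_good_on[of T] by eventually_elim (rule b_has_sum)
  have C0: "0 < C n" for n using A(1) by (simp add: C_def add_pos_nonneg)
  have dom1: "AE t in ?M. \<forall>m. ennreal \<bar>heat_sum b n m t\<bar> \<le> ennreal (C n) * W1inf_norm (v t)" for n
    using dom by eventually_elim auto
  have dom2: "AE t in ?M. \<forall>n. ennreal \<bar>heat_mean b n t\<bar> \<le> ennreal A * W1inf_norm (v t)"
    using dom by eventually_elim auto
  note R = heat_lim_integral[of b, OF m W summ C0 dom1 A(1) dom2]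
  show "integrable ?M (heat_lim b)" by (rule R(1))
  show "\<exists>J. (\<forall>n. (\<lambda>m. \<integral>s. heat_sum b n m s \<partial>?M) \<longlonglongrightarrow> J n) \<and> J \<longlonglongrightarrow> (\<integral>s. heat_lim b s \<partial>?M)"
    by (rule R(2))
qed

lemma dissip_heat_lim:
  assumes T: "0 \<le> T"
  shows "integrable (lebesgue_on {0..T}) (heat_lim dissip)"
    and "\<exists>J. (\<forall>n. (\<lambda>m. \<integral>s. heat_sum dissip n m s \<partial>lebesgue_on {0..T}) \<longlonglongrightarrow> J n)
      \<and> J \<longlonglongrightarrow> (\<integral>s. heat_lim dissip s \<partial>lebesgue_on {0..T})"
proof -
  let ?M = "lebesgue_on {0..T}"
  let ?W = "\<lambda>t. \<Sum>j\<in>UNIV. ennreal ((L2_norm (weak_deriv j (f t)))\<^sup>2)"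
  have m: "dissip k \<in> borel_measurable ?M" for k
    using abs_integrable_lebesgue_on[OF dissip_integrable[OF T, of k]] by simp
  have "(\<integral>\<^sup>+t\<in>{0..T}. ?W t \<partial>lebesgue) < \<infinity>"
    using sol T by (simp add: advection_diffusion_solution_def)
  then have W: "(\<integral>\<^sup>+t. ?W t \<partial>?M) < \<infinity>"
    by (subst nn_integral_restrict_space) auto
  have summ: "AE t in ?M. (\<lambda>k. \<bar>dissip k t\<bar>) summable_on UNIV"
    using AE_good_on[of T] by eventually_elim (rule dissip_summable)
  have bound: "\<bar>heat_sum dissip n m t\<bar> \<le> (\<Sum>j\<in>UNIV. (L2_norm (weak_deriv j (f t)))\<^sup>2)" if "good t" for n m t
  proof -
    have "\<bar>heat_sum dissip n m t\<bar> \<le> (\<Sum>k\<in>freq_ball m. dissip k t)"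
      unfolding heat_sum_def
      by (intro order_trans[OF sum_abs] sum_mono)
        (auto simp: abs_mult dissip_nonneg heat_le_1 less_imp_le[OF heat_pos] intro!: mult_left_le_one_le)
    also have "\<dots> \<le> (\<Sum>j\<in>UNIV. (L2_norm (weak_deriv j (f t)))\<^sup>2)"
      by (rule finite_sum_le_has_sum[OF dissip_has_sum(1)[OF that]]) (auto simp: dissip_nonneg)
    finally show ?thesis .
  qed
  have bound2: "\<bar>heat_mean dissip n t\<bar> \<le> (\<Sum>j\<in>UNIV. (L2_norm (weak_deriv j (f t)))\<^sup>2)" if "good t" for n t
    by (rule LIMSEQ_le_const2[OF tendsto_rabs[OF heat_sum_tendsto[of dissip t, OF dissip_summable[OF that]]]])
      (use bound[OF that] in auto)
  have We: "?W t = ennreal (\<Sum>j\<in>UNIV. (L2_norm (weak_deriv j (f t)))\<^sup>2)" for t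
    by (rule sum_ennreal) simp
  have dom1: "AE t in ?M. \<forall>m. ennreal \<bar>heat_sum dissip n m t\<bar> \<le> ennreal 1 * ?W t" for n
    using AE_good_on[of T] by eventually_elim (auto simp: We intro!: ennreal_leI bound simp del: sum_ennreal)
  have dom2: "AE t in ?M. \<forall>n. ennreal \<bar>heat_mean dissip n t\<bar> \<le> ennreal 1 * ?W t"
    using AE_good_on[of T] by eventually_elim (use bound2 in \<open>auto simp: We intro!: ennreal_leI simp del: sum_ennreal\<close>)
  note R = heat_lim_integral[of dissip ?M ?W "\<lambda>_. 1" 1, OF m W summ zero_less_one dom1 zero_less_one dom2]
  show "integrable ?M (heat_lim dissip)" by (rule R(1))
  show "\<exists>J. (\<forall>n. (\<lambda>m. \<integral>s. heat_sum dissip n m s \<partial>?M) \<longlonglongrightarrow> J n) \<and> J \<longlonglongrightarrow> (\<integral>s. heat_lim dissip s \<partial>?M)"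
    by (rule R(2))
qed

text \<open>With truncation and Gaussian weights the sum over modes is finite and commutes with the
  time integral; the two limits are then taken on both sides. The transfer disappears only at the
  end, because the modes \<open>b k\<close> sum to 0 at almost every time, while no truncated or
  mollified sum of them need vanish.\<close>

theorem energy_identity:
  assumes T: "0 \<le> T"
  shows "(L2_norm (f T))\<^sup>2 = (L2_norm (f 0))\<^sup>2 - 2 * \<nu> * integral {0..T} (heat_lim dissip)"
    and "heat_lim dissip absolutely_integrable_on {0..T}"
proof -
  let ?M = "lebesgue_on {0..T}"
  obtain Jb where Jb: "\<And>n. (\<lambda>m. \<integral>s. heat_sum b n m s \<partial>?M) \<longlonglongrightarrow> Jb n" "Jb \<longlonglongrightarrow> (\<integral>s. heat_lim b s \<partial>?M)"
    using b_heat_lim(2)[OF T] by blast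
  obtain Jd where Jd: "\<And>n. (\<lambda>m. \<integral>s. heat_sum dissip n m s \<partial>?M) \<longlonglongrightarrow> Jd n" "Jd \<longlonglongrightarrow> (\<integral>s. heat_lim dissip s \<partial>?M)"
    using dissip_heat_lim(2)[OF T] by blast
  define e where "e k t = (cmod (c k t))\<^sup>2" for k t
  have e_sum: "(\<lambda>k. \<bar>e k t\<bar>) summable_on UNIV" and e_inf: "(\<Sum>\<^sub>\<infinity>k. e k t) = (L2_norm (f t))\<^sup>2" if "0 \<le> t" for t
    using parseval_norm[OF fL2[OF that]] by (auto simp: e_def c_def has_sum_imp_summable infsumI)
  have bi: "integrable ?M (b k)" and di: "integrable ?M (dissip k)" for k
    by (intro abs_integrable_lebesgue_on b_integrable dissip_integrable T)+
  have step: "heat_sum e n m T - heat_sum e n m 0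
      = - 2 * (\<integral>s. heat_sum b n m s \<partial>?M) - 2 * \<nu> * (\<integral>s. heat_sum dissip n m s \<partial>?M)" for n m
  proof -
    have "e k T - e k 0 = - 2 * (\<integral>s. b k s \<partial>?M) - 2 * \<nu> * (\<integral>s. dissip k s \<partial>?M)" for k
    proof -
      have "integral {0..T} (energy_rate k) = (\<integral>s. energy_rate k s \<partial>?M)"
        by (rule lebesgue_integral_eq_integral[symmetric])
          (auto intro: abs_integrable_lebesgue_on energy_rate_integral T)
      also have "\<dots> = - 2 * (\<integral>s. b k s \<partial>?M) - 2 * \<nu> * (\<integral>s. dissip k s \<partial>?M)"
        unfolding energy_rate_def using bi[of k] di[of k] by simp
      finally show ?thesis using energy_rate_integral(2)[OF T, of k] by (simp add: e_def)
    qed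
    then have "heat_sum e n m T - heat_sum e n m 0
      = (\<Sum>k\<in>freq_ball m. heat (1 / real (Suc n)) k * (- 2 * (\<integral>s. b k s \<partial>?M) - 2 * \<nu> * (\<integral>s. dissip k s \<partial>?M)))"
      by (simp only: heat_sum_def sum_subtractf[symmetric] right_diff_distrib[symmetric])
    also have "\<dots> = - 2 * (\<Sum>k\<in>freq_ball m. heat (1 / real (Suc n)) k * (\<integral>s. b k s \<partial>?M))
        - 2 * \<nu> * (\<Sum>k\<in>freq_ball m. heat (1 / real (Suc n)) k * (\<integral>s. dissip k s \<partial>?M))"
      by (simp add: sum_distrib_left sum_subtractf sum_negf algebra_simps)
    also have "(\<Sum>k\<in>freq_ball m. heat (1 / real (Suc n)) k * (\<integral>s. b k s \<partial>?M)) = (\<integral>s. heat_sum b n m s \<partial>?M)"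
      unfolding heat_sum_def by (subst Bochner_Integration.integral_sum) (auto intro!: integrable_mult_right bi)
    also have "(\<Sum>k\<in>freq_ball m. heat (1 / real (Suc n)) k * (\<integral>s. dissip k s \<partial>?M)) = (\<integral>s. heat_sum dissip n m s \<partial>?M)"
      unfolding heat_sum_def by (subst Bochner_Integration.integral_sum) (auto intro!: integrable_mult_right di)
    finally show ?thesis .
  qed
  have inner: "heat_mean e n T - heat_mean e n 0
      = - 2 * Jb n - 2 * \<nu> * Jd n" for n
  proof (rule LIMSEQ_unique)
    show "(\<lambda>m. heat_sum e n m T - heat_sum e n m 0)
      \<longlonglongrightarrow> heat_mean e n T - heat_mean e n 0"
      by (intro tendsto_diff heat_sum_tendsto e_sum T order_refl)
    show "(\<lambda>m. heat_sum e n m T - heat_sum e n m 0) \<longlonglongrightarrow> - 2 * Jb n - 2 * \<nu> * Jd n"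
      unfolding step by (intro tendsto_intros Jb Jd)
  qed
  have "(L2_norm (f T))\<^sup>2 - (L2_norm (f 0))\<^sup>2
      = - 2 * (\<integral>s. heat_lim b s \<partial>?M) - 2 * \<nu> * (\<integral>s. heat_lim dissip s \<partial>?M)"
  proof (rule LIMSEQ_unique)
    show "(\<lambda>n. heat_mean e n T - heat_mean e n 0)
        \<longlonglongrightarrow> (L2_norm (f T))\<^sup>2 - (L2_norm (f 0))\<^sup>2"
      unfolding e_inf[OF T, symmetric] e_inf[OF order_refl, symmetric]
      by (intro tendsto_diff infsum_heat_tendsto e_sum T order_refl)
    show "(\<lambda>n. heat_mean e n T - heat_mean e n 0)
        \<longlonglongrightarrow> - 2 * (\<integral>s. heat_lim b s \<partial>?M) - 2 * \<nu> * (\<integral>s. heat_lim dissip s \<partial>?M)"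
      unfolding inner by (intro tendsto_intros Jb Jd)
  qed
  moreover have "(\<integral>s. heat_lim b s \<partial>?M) = 0"
  proof -
    have "AE s in ?M. heat_lim b s = 0"
      using AE_good_on[of T]
      by eventually_elim (simp add: heat_lim_eq b_has_sum infsumI)
    then show ?thesis by (rule integral_eq_zero_AE)
  qed
  moreover have "(\<integral>s. heat_lim dissip s \<partial>?M) = integral {0..T} (heat_lim dissip)"
    by (rule lebesgue_integral_eq_integral[OF dissip_heat_lim(1)[OF T]]) simp
  ultimately show "(L2_norm (f T))\<^sup>2 = (L2_norm (f 0))\<^sup>2 - 2 * \<nu> * integral {0..T} (heat_lim dissip)"
    by simp
  show "heat_lim dissip absolutely_integrable_on {0..T}"
    by (rule lebesgue_on_abs_integrable[OF dissip_heat_lim(1)[OF T]])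
qed

section \<open>The high-frequency balance\<close>

definition "high_rate r t = - 2 * \<nu> * heat_lim dissip t - (\<Sum>k | norm (freq k) < r. energy_rate k t)"

lemma high_energy:
  assumes T: "0 \<le> T"
  shows "high_rate r absolutely_integrable_on {0..T}"
    and "(L2_norm (Pi_ge r (f T)))\<^sup>2 = (L2_norm (Pi_ge r (f 0)))\<^sup>2 + integral {0..T} (high_rate r)"
proof -
  let ?lo = "{k :: int^'d. norm (freq k) < r}"
  have lo: "finite ?lo" by (rule finite_freq_ball)
  have d: "(\<lambda>t. - 2 * \<nu> * heat_lim dissip t) absolutely_integrable_on {0..T}"
    using absolutely_integrable_scaleR_left[OF energy_identity(2)[OF T], of "- 2 * \<nu>"] by simp
  have s: "(\<lambda>t. \<Sum>k\<in>?lo. energy_rate k t) absolutely_integrable_on {0..T}"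
    by (intro absolutely_integrable_sum lo energy_rate_integral T)
  show "high_rate r absolutely_integrable_on {0..T}"
    unfolding high_rate_def[abs_def] by (rule set_integral_diff(1)[OF d s])
  have "integral {0..T} (high_rate r)
    = integral {0..T} (\<lambda>t. - 2 * \<nu> * heat_lim dissip t) - integral {0..T} (\<lambda>t. \<Sum>k\<in>?lo. energy_rate k t)"
    unfolding high_rate_def[abs_def]
    by (rule Henstock_Kurzweil_Integration.integral_diff)
      (rule set_lebesgue_integral_eq_integral(1)[OF d] set_lebesgue_integral_eq_integral(1)[OF s])+
  also have "integral {0..T} (\<lambda>t. \<Sum>k\<in>?lo. energy_rate k t) = (\<Sum>k\<in>?lo. integral {0..T} (energy_rate k))"
    by (rule Henstock_Kurzweil_Integration.integral_sum[OF lo])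
      (rule set_lebesgue_integral_eq_integral(1)[OF energy_rate_integral(1)[OF T]])
  also have "\<dots> = (\<Sum>k\<in>?lo. (cmod (c k T))\<^sup>2) - (\<Sum>k\<in>?lo. (cmod (c k 0))\<^sup>2)"
    by (simp add: energy_rate_integral(2)[OF T] sum.distrib)
  also have "integral {0..T} (\<lambda>t. - 2 * \<nu> * heat_lim dissip t) = (L2_norm (f T))\<^sup>2 - (L2_norm (f 0))\<^sup>2"
    by (simp add: energy_identity(1)[OF T])
  finally show "(L2_norm (Pi_ge r (f T)))\<^sup>2 = (L2_norm (Pi_ge r (f 0)))\<^sup>2 + integral {0..T} (high_rate r)"
    by (simp add: L2_norm_Pi_ge fL2 T c_def)
qed

lemma high_energy_locally_ac:
  "locally_absolutely_continuous (\<lambda>t. (L2_norm (Pi_ge r (f t)))\<^sup>2)"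
  unfolding locally_absolutely_continuous_def using high_energy by blast

text \<open>One null set serves all \<open>r\<close>: there are only countably many modes, and each
  low-frequency energy is a finite sum of them.\<close>

lemma high_energy_deriv:
  "AE t in lebesgue. 0 < t \<longrightarrow> good t \<and>
    (\<forall>r. ((\<lambda>t. (L2_norm (Pi_ge r (f t)))\<^sup>2) has_real_derivative high_rate r t) (at t))"
proof -
  have "AE t in lebesgue. 0 < t \<longrightarrow> ((\<lambda>t. integral {0..t} (heat_lim dissip)) has_real_derivative heat_lim dissip t) (at t)"
    by (rule AE_indefinite_integral_deriv) (rule energy_identity)
  moreover have "AE t in lebesgue. \<forall>k. 0 < t \<longrightarrow> ((\<lambda>t. integral {0..t} (energy_rate k)) has_real_derivative energy_rate k t) (at t)"
    unfolding AE_all_countable by (intro allI AE_indefinite_integral_deriv energy_rate_integral)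
  ultimately show ?thesis using AE_good
  proof eventually_elim
    case (elim t)
    show ?case
    proof (intro impI conjI allI)
      assume t: "0 < t"
      then show "good t" using elim by simp
      fix r
      let ?lo = "{k :: int^'d. norm (freq k) < r}"
      let ?G = "\<lambda>t. (L2_norm (f 0))\<^sup>2 - 2 * \<nu> * integral {0..t} (heat_lim dissip)
        - (\<Sum>k\<in>?lo. (cmod (c k 0))\<^sup>2 + integral {0..t} (energy_rate k))"
      have "(?G has_real_derivative (0 - 2 * \<nu> * heat_lim dissip t) - (\<Sum>k\<in>?lo. 0 + energy_rate k t)) (at t)"
        using elim t by (intro derivative_intros DERIV_cmult) auto
      then have G: "(?G has_real_derivative high_rate r t) (at t)" by (simp add: high_rate_def)
      show "((\<lambda>t. (L2_norm (Pi_ge r (f t)))\<^sup>2) has_real_derivative high_rate r t) (at t)"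
      \<comment> \<open>The integral formula holds for nonnegative times only; a positive time has a
        whole neighbourhood on which it is valid.\<close>
      proof (rule has_field_derivative_transform_within_open[OF G, of "{0<..}"])
        fix s :: real assume "s \<in> {0<..}"
        then have s: "0 \<le> s" by simp
        show "?G s = (L2_norm (Pi_ge r (f s)))\<^sup>2"
          by (simp add: L2_norm_Pi_ge[OF fL2[OF s]] energy_identity(1)[OF s]
              energy_rate_integral(2)[OF s] c_def[symmetric])
      qed (use t in auto)
    qed
  qed
qed

text \<open>Up to the flux bound this is an equality. By Parseval, total dissipation minus the
  dissipation of the low modes is exactly the high-frequency dissipation, so the viscous terms
  cancel and twice the transfer out of the low modes remains.\<close>

lemma high_energy_inequality:
  fixes w :: "real \<Rightarrow> ennreal"
  assumes "good t" and r: "0 \<le> r"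
    and w: "mono_on {0..} w" "\<And>z. 0 \<le> z \<Longrightarrow> 1 \<le> w z"
  shows "ereal (high_rate r t + 2 * \<nu> * (\<Sum>j\<in>UNIV. (L2_norm (Pi_ge r (weak_deriv j (f t))))\<^sup>2))
    \<le> enn2ereal (ennreal (4 * pi * r) *
        flux_product (weighted_l1_norm w (v t)) (weight_conv w (f t) r))"
proof -
  interpret velocity_field "v t" by (rule velocity_field_good[OF \<open>good t\<close>])
  have f: "f t \<in> H1_torus" using \<open>good t\<close> by (simp add: good_def)
  let ?lo = "{k :: int^'d. norm (freq k) < r}"
  have "(\<Sum>j\<in>UNIV. (L2_norm (Pi_ge r (weak_deriv j (f t))))\<^sup>2)
    = (\<Sum>j\<in>UNIV. (L2_norm (weak_deriv j (f t)))\<^sup>2) - (\<Sum>j\<in>UNIV. \<Sum>k\<in>?lo. (cmod (fourier (weak_deriv j (f t)) k))\<^sup>2)"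
    by (simp add: L2_norm_Pi_ge[OF L2_weak_deriv[OF f]] sum_subtractf)
  also have "(\<Sum>j\<in>UNIV. \<Sum>k\<in>?lo. (cmod (fourier (weak_deriv j (f t)) k))\<^sup>2) = (\<Sum>k\<in>?lo. dissip k t)"
    unfolding dissip_has_sum(2)[OF \<open>good t\<close>] by (rule sum.swap)
  also have "(\<Sum>j\<in>UNIV. (L2_norm (weak_deriv j (f t)))\<^sup>2) = heat_lim dissip t"
    by (simp add: heat_lim_eq dissip_summable[OF \<open>good t\<close>] infsumI[OF dissip_has_sum(1)[OF \<open>good t\<close>]])
  finally have S: "(\<Sum>j\<in>UNIV. (L2_norm (Pi_ge r (weak_deriv j (f t))))\<^sup>2)
    = heat_lim dissip t - (\<Sum>k\<in>?lo. dissip k t)" .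
  have "(\<Sum>k\<in>?lo. energy_rate k t) = - 2 * (\<Sum>k\<in>?lo. b k t) - 2 * \<nu> * (\<Sum>k\<in>?lo. dissip k t)"
    by (simp add: energy_rate_def sum_subtractf sum_distrib_left sum_negf)
  then have "high_rate r t + 2 * \<nu> * (\<Sum>j\<in>UNIV. (L2_norm (Pi_ge r (weak_deriv j (f t))))\<^sup>2)
    = 2 * (\<Sum>k\<in>?lo. b k t)"
    unfolding high_rate_def S by (simp add: algebra_simps)
  then show ?thesis
    using flux_bound[OF f r w] by (simp add: b_def c_def)
qed

end

theorem theorem1p6:
  fixes M :: "'w measure"
    and u :: "'w \<Rightarrow> real \<Rightarrow> real^'d::finite \<Rightarrow> real^'d"
    and g :: "real^'d \<Rightarrow> complex"
    and \<phi> :: "real \<Rightarrow> 'w \<Rightarrow> real \<Rightarrow> real^'d \<Rightarrow> complex"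
    and K \<gamma> :: real
    and w :: "real \<Rightarrow> ennreal"
  assumes "prob_space M"
    and "\<And>t x. 0 \<le> t \<Longrightarrow> (\<lambda>\<omega>. u \<omega> t x) \<in> borel_measurable M"
    and "\<And>\<omega> t. \<omega> \<in> space M \<Longrightarrow> 0 \<le> t \<Longrightarrow> periodic (u \<omega> t)"
    and "AE \<omega> in M. admissible_velocity (u \<omega>)"
    and "stationary_process M u"
    and "g \<in> L2_torus" and "(\<integral>x. g x \<partial>torus) = 0" and "L2_norm g = 1"
    and "\<And>\<nu> \<omega>. 0 < \<nu> \<Longrightarrow> \<omega> \<in> space M \<Longrightarrow> admissible_velocity (u \<omega>) \<Longrightarrow>
           advection_diffusion_solution \<nu> (u \<omega>) g (\<phi> \<nu> \<omega>)"
    and "\<And>\<nu> t k. 0 < \<nu> \<Longrightarrow> 0 \<le> t \<Longrightarrow> (\<lambda>\<omega>. fourier (\<phi> \<nu> \<omega> t) k) \<in> borel_measurable M"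
    and "1 \<le> K" and "0 < \<gamma>"
    and "\<And>\<nu> t. 0 < \<nu> \<Longrightarrow> 0 < t \<Longrightarrow>
           (\<integral>\<^sup>+\<omega>. Hm1_norm_sq (\<phi> \<nu> \<omega> t) \<partial>M) \<le> ennreal (K * exp (- \<gamma> * t))"
    and "mono_on {0..} w" and "\<And>z. 0 \<le> z \<Longrightarrow> 1 \<le> w z"
  shows "\<forall>\<nu>>0. \<forall>\<omega>\<in>space M. admissible_velocity (u \<omega>) \<longrightarrow>
    (\<forall>r\<ge>0. locally_absolutely_continuous (\<lambda>t. (L2_norm (Pi_ge r (\<phi> \<nu> \<omega> t)))\<^sup>2)) \<and>
    (AE t in lebesgue. 0 < t \<longrightarrow> (\<forall>r\<ge>0. \<exists>D.
       ((\<lambda>t. (L2_norm (Pi_ge r (\<phi> \<nu> \<omega> t)))\<^sup>2) has_real_derivative D) (at t) \<and>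
       ereal (D + 2 * \<nu> * (\<Sum>j\<in>UNIV. (L2_norm (Pi_ge r (weak_deriv j (\<phi> \<nu> \<omega> t))))\<^sup>2))
         \<le> enn2ereal (ennreal (4 * pi * r) *
              flux_product (weighted_l1_norm w (u \<omega> t)) (weight_conv w (\<phi> \<nu> \<omega> t) r))))"
proof (intro allI ballI impI)
  fix \<nu> :: real and \<omega>
  assume "0 < \<nu>" "\<omega> \<in> space M" and adm: "admissible_velocity (u \<omega>)"
  then have "advection_diffusion_solution \<nu> (u \<omega>) g (\<phi> \<nu> \<omega>)"
    by (rule assms(9))
  then interpret advected \<nu> "u \<omega>" g "\<phi> \<nu> \<omega>"
    using \<open>0 < \<nu>\<close> adm by unfold_locales
  have "AE t in lebesgue. 0 < t \<longrightarrow> (\<forall>r\<ge>0. \<exists>D.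
      ((\<lambda>t. (L2_norm (Pi_ge r (\<phi> \<nu> \<omega> t)))\<^sup>2) has_real_derivative D) (at t) \<and>
      ereal (D + 2 * \<nu> * (\<Sum>j\<in>UNIV. (L2_norm (Pi_ge r (weak_deriv j (\<phi> \<nu> \<omega> t))))\<^sup>2))
        \<le> enn2ereal (ennreal (4 * pi * r) *
             flux_product (weighted_l1_norm w (u \<omega> t)) (weight_conv w (\<phi> \<nu> \<omega> t) r)))"
    using high_energy_deriv
    by eventually_elim (blast intro: high_energy_inequality assms(14) assms(15))
  then show "(\<forall>r\<ge>0. locally_absolutely_continuous (\<lambda>t. (L2_norm (Pi_ge r (\<phi> \<nu> \<omega> t)))\<^sup>2)) \<and>
    (AE t in lebesgue. 0 < t \<longrightarrow> (\<forall>r\<ge>0. \<exists>D.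
       ((\<lambda>t. (L2_norm (Pi_ge r (\<phi> \<nu> \<omega> t)))\<^sup>2) has_real_derivative D) (at t) \<and>
       ereal (D + 2 * \<nu> * (\<Sum>j\<in>UNIV. (L2_norm (Pi_ge r (weak_deriv j (\<phi> \<nu> \<omega> t))))\<^sup>2))
         \<le> enn2ereal (ennreal (4 * pi * r) *
              flux_product (weighted_l1_norm w (u \<omega> t)) (weight_conv w (\<phi> \<nu> \<omega> t) r))))"
    using high_energy_locally_ac by blast
qed

end
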